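(* Let $n\ge 1$, let $\mathbb{B}$ be the open unit ball of $\mathbb{C}^n$, and let $f:\mathbb{B}\to\mathbb{C}$ be holomorphic. Let $p,q,s,\alpha$ be real numbers such that $q>0$, $s>\max\{0,1-\frac{q}{n}\}$, $\alpha>q+ns-n-1$ and $p\ge 2(n+1+\alpha)$. Then $f\in\mathcal{N}(p,q,s)$ if and only if $$\sup_{a\in\mathbb{B}}\int_{\mathbb{B}}\int_{\mathbb{B}}\frac{|f(z)-f(w)|^p}{|w-P_w z-s_wQ_w z|^{2(n+1+\alpha)}}(1-|z|^2)^{q}(1-|\Phi_{a}(z)|^2)^{ns}\,dV_{\alpha}(w)\,dV_{\alpha}(z)<+\infty.$$
   Context: $\langle\cdot,\cdot\rangle$ is the usual Hermitian inner product on $\mathbb{C}^n$, $|z|^2=\langle z,z\rangle$, and $\mathbb{B}=\{z\in\mathbb{C}^n:|z|<1\}$. $dV$ is Lebesgue volume measure on $\mathbb{B}$ normalized so that $V(\mathbb{B})=1$, and $$dV_{\alpha}(z)=\frac{\Gamma(n+\alpha+1)}{n!\,\Gamma(\alpha+1)}(1-|z|^2)^{\alpha}\,dV(z),$$ where $\Gamma$ is the Gamma function (the hypotheses of the claim force $\alpha>-1$). The Möbius invariant measure is $d\lambda(z)=(1-|z|^2)^{-n-1}dV(z)$. For $a\in\mathbb{B}\setminus\{0\}$, put $s_a=\sqrt{1-|a|^2}$, let $P_az=\frac{\langle z,a\rangle}{|a|^2}a$ be the orthogonal projection of $z$ onto the complex line spanned by $a$, and let $Q_a=I-P_a$; for $a=0$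 put $s_0=1$, $P_0=0$, $Q_0=I$. The involutive automorphism $\Phi_a$ of $\mathbb{B}$ is $$\Phi_a(z)=\frac{a-P_az-s_aQ_az}{1-\langle z,a\rangle},\quad z\in\mathbb{B}.$$ For $p\ge1$, $q>0$, $s>0$, the space $\mathcal{N}(p,q,s)$ consists of all holomorphic functions $f$ on $\mathbb{B}$ with $$\sup_{a\in\mathbb{B}}\int_{\mathbb{B}}|f(z)|^p(1-|z|^2)^q(1-|\Phi_a(z)|^{2})^{ns}\,d\lambda(z)<+\infty.$$ *)

theory Defs
  imports "HOL-Analysis.Analysis"
begin

text \<open>The space $\mathbb{C}^n$ is \<open>complex ^ 'n\<close> with \<open>n = CARD('n)\<close>; its library norm is the
  Hermitian norm (lemma \<open>hinner_self\<close>), so the unit ball is \<open>ball 0 1\<close>.\<close>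

definition hinner :: "complex ^ 'n \<Rightarrow> complex ^ 'n \<Rightarrow> complex" where
  "hinner z w = (\<Sum>k\<in>UNIV. z $ k * cnj (w $ k))"

lemma hinner_self: "hinner z z = complex_of_real ((norm z)\<^sup>2)"
  by (simp only: hinner_def norm_vec_def L2_set_def sum_nonneg zero_le_power2 real_sqrt_pow2
      of_real_sum complex_norm_square)

text \<open>Holomorphy in several variables on an open set: the real Frechet derivative exists at every
  point and is complex linear.\<close>

definition holomorphic_Cn_on :: "(complex ^ 'n \<Rightarrow> complex) \<Rightarrow> (complex ^ 'n) set \<Rightarrow> bool" where
  "holomorphic_Cn_on f S \<longleftrightarrow>
     (\<forall>z\<in>S. \<exists>D. (f has_derivative D) (at z) \<and> (\<forall>c v. D (c *s v) = c * D v))"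

definition proj_line :: "complex ^ 'n \<Rightarrow> complex ^ 'n \<Rightarrow> complex ^ 'n" where
  "proj_line a z = (if a = 0 then 0 else (hinner z a / complex_of_real ((norm a)\<^sup>2)) *s a)"

definition proj_perp :: "complex ^ 'n \<Rightarrow> complex ^ 'n \<Rightarrow> complex ^ 'n" where
  "proj_perp a z = z - proj_line a z"

definition s_fac :: "complex ^ 'n \<Rightarrow> real" where
  "s_fac a = sqrt (1 - (norm a)\<^sup>2)"

text \<open>The numerator $a - P_a z - s_a Q_a z$ of the involution, which also occurs on its own.\<close>

definition Phi_num :: "complex ^ 'n \<Rightarrow> complex ^ 'n \<Rightarrow> complex ^ 'n" where
  "Phi_num a z = a - proj_line a z - s_fac a *\<^sub>R proj_perp a z"

definition Phi :: "complex ^ 'n \<Rightarrow> complex ^ 'n \<Rightarrow> complex ^ 'n" where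
  "Phi a z = (1 / (1 - hinner z a)) *s Phi_num a z"

text \<open>All measures live on the unit ball itself (their space is \<open>ball 0 1\<close>), so values of
  functions outside the ball play no role.\<close>

definition ball_vol :: "(complex ^ 'n) measure" where
  "ball_vol = uniform_measure (restrict_space lborel (ball 0 1)) (ball 0 1)"

lemma space_ball_vol: "space ball_vol = ball 0 1"
  by (simp add: ball_vol_def space_restrict_space)

lemma emeasure_ball_vol: "emeasure ball_vol (ball (0::complex ^ 'n) 1) = 1"
proof -
  have "emeasure lborel (ball (0::complex ^ 'n) 1) \<noteq> 0"
    using content_ball_pos[of 1 "0::complex ^ 'n"] by (auto simp: measure_def)
  moreover have "emeasure lborel (ball (0::complex ^ 'n) 1) \<noteq> \<infinity>"
    using emeasure_lborel_ball_finite[of "0::complex ^ 'n" 1] by simp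
  ultimately show ?thesis
    by (simp add: ball_vol_def emeasure_restrict_space sets_restrict_space_iff ennreal_divide_self less_top)
qed

definition weighted_vol :: "real \<Rightarrow> (complex ^ 'n) measure" where
  "weighted_vol \<alpha> = density ball_vol (\<lambda>z. ennreal
     (Gamma (real CARD('n) + \<alpha> + 1) / (fact CARD('n) * Gamma (\<alpha> + 1))
        * (1 - (norm z)\<^sup>2) powr \<alpha>))"

definition invariant_vol :: "(complex ^ 'n) measure" where
  "invariant_vol = density ball_vol (\<lambda>z. ennreal ((1 - (norm z)\<^sup>2) powr (- real CARD('n) - 1)))"

definition N_space :: "real \<Rightarrow> real \<Rightarrow> real \<Rightarrow> (complex ^ 'n \<Rightarrow> complex) set" where
  "N_space p q s = {f. holomorphic_Cn_on f (ball 0 1) \<and>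
     (SUP a \<in> ball 0 1. \<integral>\<^sup>+ z. ennreal
        (norm (f z) powr p * (1 - (norm z)\<^sup>2) powr q
          * (1 - (norm (Phi a z))\<^sup>2) powr (real CARD('n) * s)) \<partial>invariant_vol) < \<infinity>}"

end

theory Submission
  imports Defs "HOL-Complex_Analysis.Conformal_Mappings"
begin

text \<open>Put \<open>d z = 1 - |z|^2\<close>, \<open>k z w = |1 - <z,w>|\<close>, \<open>t = n + 1 + \<alpha>\<close>, \<open>\<sigma> = n s\<close> and
  \<open>\<beta> = q + n s - n - 1\<close>, so that \<open>-1 < \<beta> < \<alpha>\<close>. The function \<open>f\<close> lies in the space iff
  \<open>|f|^p d^\<beta> dV\<close> is a \<open>\<sigma>\<close>-Carleson measure, i.e. has mass at most \<open>C r^\<sigma>\<close> on every tent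
  \<open>{z. k z b < r}\<close>, and the double integral tests \<open>F d^\<beta> dV\<close> in the same way, where \<open>F z\<close>
  integrates \<open>|f z - f w|^p\<close> against \<open>d(z)^t d(w)^\<alpha> |Phi_num z w|^(-2t) dV(w)\<close>.

  If \<open>f\<close> is in the space, then off the diagonal \<open>|Phi_num z w|\<close> is comparable to \<open>k z w\<close>, and
  near it Cauchy's estimate makes \<open>|f z - f w|^p\<close> vanish to order \<open>p >= 2t\<close>. So \<open>F z\<close> is
  dominated by an average of \<open>|f z|^p + |f w|^p\<close> against \<open>d(z)^t d(w)^\<alpha> k(z,w)^(-2t)\<close>, and the
  Forelli-Rudin estimates for one and for two kernels finish the proof.

  Conversely, compare \<open>f z\<close> with its average over points \<open>w\<close> above \<open>z\<close> of height \<open>K d z\<close>. The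
  difference is controlled by \<open>F\<close>. The averages have Carleson constant at most
  \<open>C K^(-\<gamma>)\<close> times that of \<open>|f|^p d^\<beta> dV\<close>, with \<open>\<gamma> > 0\<close> because \<open>q > 0\<close> and \<open>q + n s > n\<close>, so
  for large \<open>K\<close> they are absorbed. As averaging only moves points towards the centre, this can be
  done on \<open>|z| < R\<close>, where the constant is finite beforehand, uniformly in \<open>R < 1\<close>.\<close>

section \<open>Hermitian geometry and anisotropic dilations\<close>

text \<open>Volumes are computed through linear maps that scale the complex line through a point by
  one factor and its orthogonal complement by another: their Jacobian is constant, and a unitary
  reflection reduces it to the case of a coordinate axis. The absorption step dictates the remaining
  choices. Points z averaged into w have height at most d(w)/K, which gains K^(-\<beta>-1), but they
  spread the mass over a tent K times larger, which costs K^\<sigma>. Since \<beta> + 1 - \<sigma> =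
  q - n, this alone fails for q <= n. An auxiliary exponent \<nu> repairs it: a tent of radius r
  receives only a fraction of the average at a point w far from its vertex b, and recording this as
  (r / k(w,b))^\<nu> lowers the cost to K^(\<sigma>-\<nu>). The net gain is K^(-\<gamma>) with
  \<gamma> = q - n + \<nu>, and the constraints max(0, n - q) < \<nu> < min(n, \<sigma>) can be met
  exactly because q > 0, s > 0 and q + n s > n.\<close>

lemma hinner_add_left: "hinner (x + y) z = hinner x z + hinner y z"
  by (simp add: hinner_def sum.distrib algebra_simps)

lemma hinner_add_right: "hinner z (x + y) = hinner z x + hinner z y"
  by (simp add: hinner_def sum.distrib algebra_simps)

lemma hinner_scale_left: "hinner (c *s x) z = c * hinner x z"
  by (simp add: hinner_def sum_distrib_left mult.assoc)

lemma hinner_scale_right: "hinner z (c *s x) = cnj c * hinner z x"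
  by (simp add: hinner_def sum_distrib_left mult.assoc mult.left_commute)

lemma scaleR_eq_vector_scale: "r *\<^sub>R x = complex_of_real r *s (x :: complex ^ 'n)"
  by (simp add: vec_eq_iff) (simp add: scaleR_conv_of_real)

lemma hinner_scaleR_left: "hinner (r *\<^sub>R x) z = of_real r * hinner x z"
  by (simp add: scaleR_eq_vector_scale hinner_scale_left)

lemma hinner_scaleR_right: "hinner z (r *\<^sub>R x) = of_real r * hinner z x"
  by (simp add: scaleR_eq_vector_scale hinner_scale_right)

lemma hinner_minus_left: "hinner (- x) z = - hinner x z"
  by (simp add: hinner_def sum_negf)

lemma hinner_minus_right: "hinner z (- x) = - hinner z x"
  by (simp add: hinner_def sum_negf)

lemma hinner_diff_left: "hinner (x - y) z = hinner x z - hinner y z"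
  using hinner_add_left[of x "- y" z] by (simp add: hinner_minus_left)

lemma hinner_diff_right: "hinner z (x - y) = hinner z x - hinner z y"
  using hinner_add_right[of z x "- y"] by (simp add: hinner_minus_right)

lemma hinner_zero [simp]: "hinner 0 z = 0" "hinner z 0 = 0"
  by (simp_all add: hinner_def)

lemmas hinner_simps = hinner_add_left hinner_add_right hinner_scale_left hinner_scale_right
  hinner_scaleR_left hinner_scaleR_right hinner_diff_left hinner_diff_right
  hinner_minus_left hinner_minus_right

lemma cnj_hinner: "cnj (hinner z w) = hinner w z"
  by (simp add: hinner_def mult.commute)

lemma norm_hinner_commute: "norm (hinner z w) = norm (hinner w z)"
  by (metis cnj_hinner complex_mod_cnj)

lemma Re_hinner: "Re (hinner z w) = z \<bullet> w"
  by (simp add: hinner_def inner_vec_def inner_complex_def)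

lemma norm_vector_scale: "norm (c *s (x :: complex ^ 'n)) = norm c * norm x"
proof -
  have "complex_of_real ((norm (c *s x))\<^sup>2) = of_real ((norm c * norm x)\<^sup>2)"
    unfolding hinner_self[symmetric] power_mult_distrib of_real_mult complex_norm_square[of c]
    by (simp add: hinner_simps mult_ac)
  then have "(norm (c *s x))\<^sup>2 = (norm c * norm x)\<^sup>2"
    using of_real_eq_iff by blast
  then show ?thesis by (simp add: power2_eq_iff_nonneg)
qed

text \<open>A factor of modulus at most 1 in the first argument makes the product real and
  nonnegative; the Cauchy-Schwarz inequality of the underlying real inner product then
  applies.\<close>

lemma norm_hinner_le: "norm (hinner z w) \<le> norm z * norm w"
proof -
  define c where "c = cnj (sgn (hinner z w))"
  have c: "norm c \<le> 1" by (simp add: c_def norm_sgn)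
  have "c * hinner z w = of_real (norm (hinner z w))"
  proof (cases "hinner z w = 0")
    case False
    then show ?thesis
      unfolding c_def sgn_eq
      by (simp add: complex_norm_square [symmetric] field_simps power2_eq_square)
  qed simp
  then have "norm (hinner z w) = Re (hinner (c *s z) w)"
    by (simp add: hinner_simps)
  also have "\<dots> \<le> norm (c *s z) * norm w"
    using Cauchy_Schwarz_ineq2[of "c *s z" w] by (simp add: Re_hinner)
  also have "\<dots> \<le> norm z * norm w"
    using c by (simp add: norm_vector_scale mult_left_le_one_le mult_right_mono)
  finally show ?thesis .
qed

lemma norm_add_sq: "(norm (x + y))\<^sup>2 = (norm x)\<^sup>2 + (norm y)\<^sup>2 + 2 * Re (hinner x y)"
  for x y :: "complex ^ 'n"
  by (simp add: Re_hinner power2_norm_eq_inner inner_add inner_commute)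

lemma norm_diff_sq: "(norm (x - y))\<^sup>2 = (norm x)\<^sup>2 + (norm y)\<^sup>2 - 2 * Re (hinner x y)"
  for x y :: "complex ^ 'n"
  by (simp add: Re_hinner power2_norm_eq_inner inner_diff inner_commute)

lemma continuous_on_hinner [continuous_intros]:
  assumes "continuous_on S f" "continuous_on S g"
  shows "continuous_on S (\<lambda>x. hinner (f x) (g x))"
  unfolding hinner_def by (intro continuous_intros assms)

lemma borel_measurable_hinner [measurable (raw)]:
  fixes f g :: "'b \<Rightarrow> complex ^ 'n"
  assumes [measurable]: "f \<in> borel_measurable M" "g \<in> borel_measurable M"
  shows "(\<lambda>x. hinner (f x) (g x)) \<in> borel_measurable M"
  by (rule borel_measurable_continuous_Pair[OF assms]) (intro continuous_intros continuous_on_hinner)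

lemma hinner_proj_line: "hinner (proj_line b u) b = hinner u b"
  by (auto simp: proj_line_def hinner_simps hinner_self)

lemma hinner_proj_perp: "hinner (proj_perp b u) b = 0"
  by (simp add: proj_perp_def hinner_simps hinner_proj_line)

lemma proj_line_eq_scale: "proj_line b u = (hinner u b / of_real ((norm b)\<^sup>2)) *s b"
  by (auto simp: proj_line_def)

lemma hinner_proj_line_perp: "hinner (proj_line b u) (proj_perp b v) = 0"
  using hinner_proj_perp[of b v]
  by (metis cnj_hinner complex_cnj_zero hinner_scale_left mult_zero_right proj_line_eq_scale)

lemma norm_proj_sq: "(norm u)\<^sup>2 = (norm (proj_line b u))\<^sup>2 + (norm (proj_perp b u))\<^sup>2"
  using norm_add_sq[of "proj_line b u" "proj_perp b u"]
  by (simp add: hinner_proj_line_perp) (simp add: proj_perp_def)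

lemma norm_proj_line: "b \<noteq> 0 \<Longrightarrow> norm (proj_line b u) = norm (hinner u b) / norm b"
  by (simp add: proj_line_eq_scale norm_vector_scale norm_divide norm_mult power2_eq_square)

lemma linear_proj_line: "linear (proj_line b)"
proof (rule linearI)
  show "proj_line b (x + y) = proj_line b x + proj_line b y" for x y
    by (simp add: proj_line_eq_scale hinner_simps add_divide_distrib vec.scale_left_distrib)
  show "proj_line b (c *\<^sub>R x) = c *\<^sub>R proj_line b x" for c x
    by (simp add: proj_line_eq_scale hinner_simps scaleR_eq_vector_scale vector_smult_assoc)
qed

lemma linear_proj_perp: "linear (proj_perp b)"
  unfolding proj_perp_def
  using linear_compose_sub[OF linear_id linear_proj_line[of b]] by (simp add: id_def)

lemma proj_line_scale: "proj_line b (c *s u) = c *s proj_line b u"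
  by (simp add: proj_line_eq_scale hinner_simps vector_smult_assoc)

lemma proj_perp_scale: "proj_perp b (c *s u) = c *s proj_perp b u"
  by (simp add: proj_perp_def proj_line_scale vec.scale_right_diff_distrib)

text \<open>With x = r and y = sqrt r these are the dilations natural to the sphere, where r in the
  complex normal direction corresponds to sqrt r in the complex tangential ones. For b = 0 the
  projection is 0 and the map is y times the identity.\<close>

definition aniso :: "real \<Rightarrow> real \<Rightarrow> complex ^ 'n \<Rightarrow> complex ^ 'n \<Rightarrow> complex ^ 'n" where
  "aniso x y b u = x *\<^sub>R proj_line b u + y *\<^sub>R proj_perp b u"

lemma linear_aniso: "linear (aniso x y b)"
  unfolding aniso_def
  by (intro linear_compose_add linear_compose_scale_right linear_proj_line linear_proj_perp)

lemma aniso_scale: "aniso x y b (c *s u) = c *s aniso x y b u"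
  by (simp add: aniso_def proj_line_scale proj_perp_scale scaleR_eq_vector_scale
      vector_smult_assoc vec.scale_right_distrib mult.commute)

lemma norm_aniso_sq: "(norm (aniso x y b u))\<^sup>2
    = x\<^sup>2 * (norm (proj_line b u))\<^sup>2 + y\<^sup>2 * (norm (proj_perp b u))\<^sup>2"
  by (simp add: aniso_def norm_add_sq hinner_simps hinner_proj_line_perp power_mult_distrib)

lemma proj_line_idem: "proj_line b (proj_line b u) = proj_line b u"
  by (simp add: proj_line_eq_scale[of b "proj_line b u"] hinner_proj_line)
     (simp add: proj_line_eq_scale)

lemma proj_line_perp_zero: "proj_line b (proj_perp b u) = 0"
  by (simp add: proj_line_eq_scale hinner_proj_perp)

lemma proj_aniso:
  "proj_line b (aniso x y b u) = x *\<^sub>R proj_line b u"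
  "proj_perp b (aniso x y b u) = y *\<^sub>R proj_perp b u"
proof -
  show 1: "proj_line b (aniso x y b u) = x *\<^sub>R proj_line b u"
    unfolding aniso_def
    by (simp add: linear_add[OF linear_proj_line] linear_cmul[OF linear_proj_line]
        proj_line_idem proj_line_perp_zero)
  show "proj_perp b (aniso x y b u) = y *\<^sub>R proj_perp b u"
    by (subst proj_perp_def, subst 1) (simp add: aniso_def)
qed

lemma aniso_zero_vec: "aniso x y 0 u = y *\<^sub>R u"
  by (simp add: aniso_def proj_perp_def proj_line_def)

section \<open>Lebesgue measure under translations and linear isometries\<close>

lemma borel_measurable_linear: "linear f \<Longrightarrow> f \<in> borel_measurable borel"
  for f :: "'a::euclidean_space \<Rightarrow> 'b::euclidean_space"
  by (intro borel_measurable_continuous_onI linear_continuous_on linear_conv_bounded_linear[THEN iffD1])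

lemma nn_integral_lborel_translate:
  fixes g :: "'a::euclidean_space \<Rightarrow> ennreal"
  assumes [measurable]: "g \<in> borel_measurable borel"
  shows "(\<integral>\<^sup>+ x. g (a + x) \<partial>lborel) = (\<integral>\<^sup>+ x. g x \<partial>lborel)"
  by (subst (2) lborel_distr_plus[symmetric, of a]) (simp add: nn_integral_distr)

lemma nn_integral_lborel_uminus:
  fixes g :: "'a::euclidean_space \<Rightarrow> ennreal"
  assumes [measurable]: "g \<in> borel_measurable borel"
  shows "(\<integral>\<^sup>+ x. g (- x) \<partial>lborel) = (\<integral>\<^sup>+ x. g x \<partial>lborel)"
proof -
  have T: "(\<lambda>x::'a. 0 + (\<Sum>j\<in>Basis. (-1 * (x \<bullet> j)) *\<^sub>R j)) = uminus"
    by (simp add: fun_eq_iff sum_negf euclidean_representation)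
  have "lborel = density (distr (lborel :: 'a measure) borel uminus) (\<lambda>_. 1)"
    using lborel_affine_euclidean[of "\<lambda>_::'a. -1" 0] unfolding T by simp
  then have "lborel = distr (lborel :: 'a measure) borel uminus"
    by (simp add: density_1)
  then have "(\<integral>\<^sup>+ x. g x \<partial>lborel) = (\<integral>\<^sup>+ x. g x \<partial>distr (lborel :: 'a measure) borel uminus)"
    by simp
  then show ?thesis by (simp add: nn_integral_distr)
qed

lemma emeasure_lborel_unit_ball:
  "emeasure lborel (ball (0::'a::euclidean_space) 1) \<noteq> 0"
  "emeasure lborel (ball (0::'a::euclidean_space) 1) \<noteq> \<infinity>"
  using content_ball_pos[of 1 "0::'a"] emeasure_lborel_ball_finite[of "0::'a" 1]
  by (auto simp: measure_def)

text \<open>Uniqueness of the translation invariant measure: comparing both sides by Fubini with the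
  indicator of the unit ball, which \<open>U\<close> preserves, fixes the constant.\<close>

lemma nn_integral_isometry:
  fixes U :: "'a::euclidean_space \<Rightarrow> 'a" and g :: "'a \<Rightarrow> ennreal"
  assumes U: "linear U" "\<And>v. norm (U v) = norm v" "surj U"
    and [measurable]: "g \<in> borel_measurable borel"
  shows "(\<integral>\<^sup>+ x. g (U x) \<partial>lborel) = (\<integral>\<^sup>+ x. g x \<partial>lborel)"
proof -
  have [measurable]: "U \<in> borel_measurable borel" by (rule borel_measurable_linear[OF U(1)])
  define h :: "'a \<Rightarrow> ennreal" where "h = indicator (ball 0 1)"
  have [measurable]: "h \<in> borel_measurable borel" by (simp add: h_def borel_measurable_indicator)
  let ?V = "emeasure lborel (ball (0::'a) 1)"
  have hU: "h (U x) = h x" for x by (simp add: h_def indicator_def U(2))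
  have hV: "(\<integral>\<^sup>+ x. h x \<partial>lborel) = ?V" by (simp add: h_def)
  have "(\<integral>\<^sup>+ x. g (U x) \<partial>lborel) * ?V = (\<integral>\<^sup>+ x. (\<integral>\<^sup>+ y. g (U x) * h (U x + y) \<partial>lborel) \<partial>lborel)"
    by (simp add: nn_integral_cmult nn_integral_lborel_translate hV nn_integral_multc)
  also have "\<dots> = (\<integral>\<^sup>+ y. (\<integral>\<^sup>+ x. g (U x) * h (U x + y) \<partial>lborel) \<partial>lborel)"
    by (rule lborel_pair.Fubini') measurable
  also have "\<dots> = (\<integral>\<^sup>+ y. (\<integral>\<^sup>+ x. g (U x - y) * h (U x) \<partial>lborel) \<partial>lborel)"
  proof (rule nn_integral_cong)
    fix y
    \<comment> \<open>Translating x by - y' replaces \<open>U x\<close> by \<open>U x - y\<close>,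
      which moves the dependence on y from h to g.\<close>
    obtain y' where y': "y = U y'" using U(3) by (metis surjD)
    have "(\<integral>\<^sup>+ x. g (U x) * h (U x + y) \<partial>lborel) = (\<integral>\<^sup>+ x. g (U (- y' + x)) * h (U (- y' + x) + y) \<partial>lborel)"
      by (rule nn_integral_lborel_translate[symmetric]) measurable
    also have "\<dots> = (\<integral>\<^sup>+ x. g (U x - y) * h (U x) \<partial>lborel)"
      by (simp add: y' linear_diff[OF U(1)] linear_add[OF U(1)] linear_neg[OF U(1)])
    finally show "(\<integral>\<^sup>+ x. g (U x) * h (U x + y) \<partial>lborel) = (\<integral>\<^sup>+ x. g (U x - y) * h (U x) \<partial>lborel)" .
  qed
  also have "\<dots> = (\<integral>\<^sup>+ x. (\<integral>\<^sup>+ y. g (U x - y) * h (U x) \<partial>lborel) \<partial>lborel)"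
    by (rule lborel_pair.Fubini') measurable
  also have "\<dots> = (\<integral>\<^sup>+ x. (\<integral>\<^sup>+ y. g y \<partial>lborel) * h x \<partial>lborel)"
  proof (rule nn_integral_cong)
    fix x
    have "(\<integral>\<^sup>+ y. g (U x - y) \<partial>lborel) = (\<integral>\<^sup>+ y. g (U x + y) \<partial>lborel)"
      using nn_integral_lborel_uminus[of "\<lambda>y. g (U x + y)"] by simp
    then have "(\<integral>\<^sup>+ y. g (U x - y) \<partial>lborel) = (\<integral>\<^sup>+ y. g y \<partial>lborel)"
      by (simp add: nn_integral_lborel_translate)
    then show "(\<integral>\<^sup>+ y. g (U x - y) * h (U x) \<partial>lborel) = (\<integral>\<^sup>+ y. g y \<partial>lborel) * h x"
      by (simp add: nn_integral_multc hU)
  qed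
  also have "\<dots> = (\<integral>\<^sup>+ y. g y \<partial>lborel) * ?V"
    by (simp add: nn_integral_cmult hV)
  finally show ?thesis
    using emeasure_lborel_unit_ball[where 'a='a]
    by (metis ennreal_mult_divide_eq infinity_ennreal_def)
qed

section \<open>Householder reflections and the Jacobian of anisotropic dilations\<close>

definition householder :: "complex ^ 'n \<Rightarrow> complex ^ 'n \<Rightarrow> complex ^ 'n" where
  "householder d v = v - (2 * hinner v d / of_real ((norm d)\<^sup>2)) *s d"

lemma linear_householder: "linear (householder d)"
proof -
  have "householder d v = v - 2 *\<^sub>R proj_line d v" for v
    by (simp add: householder_def proj_line_eq_scale scaleR_eq_vector_scale vector_smult_assoc)
  then have "householder d = (\<lambda>v. v - 2 *\<^sub>R proj_line d v)" by auto
  then show ?thesis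
    by (simp only:) (intro linear_compose_sub linear_compose_scale_right linear_proj_line linear_ident)
qed

lemma householder_involution: "householder d (householder d v) = v"
proof -
  have H: "householder d v = v - 2 *\<^sub>R proj_line d v" for v
    by (simp add: householder_def proj_line_eq_scale scaleR_eq_vector_scale vector_smult_assoc)
  show ?thesis
    unfolding H linear_diff[OF linear_proj_line] linear_cmul[OF linear_proj_line] proj_line_idem
    by (simp add: scaleR_2)
qed

lemma hinner_householder: "hinner (householder d v) (householder d w) = hinner v w"
proof (cases "d = 0")
  case False
  define N where "N = complex_of_real ((norm d)\<^sup>2)"
  have N: "N \<noteq> 0" "cnj N = N" "hinner d d = N" using False by (simp_all add: N_def hinner_self)
  have "hinner (householder d v) (householder d w)
    = hinner v w - 2 * hinner v d / N * hinner d w -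
     2 * hinner d w / N * (hinner v d - 2 * hinner v d / N * N)"
    unfolding householder_def N_def[symmetric]
    by (simp only: hinner_simps N complex_cnj_divide complex_cnj_mult cnj_hinner complex_cnj_numeral)
  also have "\<dots> = hinner v w"
    using N(1) by (simp add: field_simps)
  finally show ?thesis .
qed (simp add: householder_def)

lemma norm_householder: "norm (householder d v) = norm v"
proof -
  have "(norm (householder d v))\<^sup>2 = (norm v)\<^sup>2"
    using hinner_householder[of d v v] unfolding hinner_self of_real_eq_iff .
  then show ?thesis by (simp add: power2_eq_iff_nonneg)
qed

text \<open>For equal norms and real <b,e> one has 2 <b, b - e> = |b - e|^2, so the reflection
  subtracts exactly b - e from b.\<close>

lemma householder_maps:
  assumes "norm e = norm b" "Im (hinner b e) = 0"
  shows "householder (b - e) b = e"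
proof (cases "b = e")
  case False
  have r: "hinner b e = of_real (Re (hinner b e))" using assms(2) by (simp add: complex_eq_iff)
  have "2 * hinner b (b - e) = of_real ((norm (b - e))\<^sup>2)"
    unfolding norm_diff_sq hinner_diff_right hinner_self assms(1)
    by (subst r) (simp add: algebra_simps)
  then show ?thesis using False by (simp add: householder_def)
qed (simp add: householder_def)

lemma householder_scale: "householder d (c *s v) = c *s householder d v"
  by (simp add: householder_def hinner_simps vector_smult_assoc vec.scale_right_diff_distrib mult_ac)

text \<open>Unitary maps carry the projections along b to those along the image of b. This
  transports a dilation along b to one along a coordinate axis.\<close>

lemma householder_aniso:
  "householder d (aniso x y b u) = aniso x y (householder d b) (householder d u)"
proof -
  have 1: "householder d (proj_line b u) = proj_line (householder d b) (householder d u)" for u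
    by (simp add: proj_line_eq_scale householder_scale hinner_householder norm_householder)
  show ?thesis
    by (simp add: aniso_def proj_perp_def 1 linear_add[OF linear_householder]
      linear_diff[OF linear_householder] linear_cmul[OF linear_householder])
qed

lemma norm_axis_complex: "norm (axis k c :: complex ^ 'n) = norm c"
proof -
  have "(\<Sum>i\<in>UNIV. (norm ((axis k c :: complex ^ 'n) $ i))\<^sup>2) = (\<Sum>i\<in>UNIV. if i = k then (norm c)\<^sup>2 else 0)"
    by (rule sum.cong) (auto simp: axis_def)
  then show ?thesis by (simp add: norm_vec_def L2_set_def)
qed

lemma proj_line_axis: "c \<noteq> 0 \<Longrightarrow> proj_line (axis k c) u = axis k (u $ k)"
proof -
  assume c: "c \<noteq> 0"
  have "hinner u (axis k c) = u $ k * cnj c"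
    by (simp add: hinner_def axis_def if_distrib cong: if_cong)
  moreover have "of_real ((norm (axis k c))\<^sup>2) = c * cnj c"
    by (simp only: norm_axis_complex complex_norm_square)
  ultimately show ?thesis
    using c by (simp add: proj_line_eq_scale vec_eq_iff axis_def del: of_real_power)
qed

text \<open>Along a coordinate axis the dilation is diagonal over the reals: the complex line is
  spanned by the two real basis vectors \<open>axis k 1\<close> and \<open>axis k \<i>\<close>. In
  this form the affine transformation rule of Lebesgue measure applies.\<close>

lemma aniso_axis:
  assumes "c \<noteq> 0"
  shows "aniso x y (axis k c) u
    = (\<Sum>j\<in>Basis. ((if j \<in> {axis k 1, axis k \<i>} then x else y) * (u \<bullet> j)) *\<^sub>R j)"
    (is "?L = ?R")
proof (rule euclidean_eqI)
  fix j :: "complex ^ 'a"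
  assume j: "j \<in> Basis"
  then obtain i e where ie: "j = axis i e" "e \<in> Basis" by (auto simp: Basis_vec_def)
  then have e: "e = 1 \<or> e = \<i>" by (simp add: Basis_complex_def)
  have "?R \<bullet> j = (if j \<in> {axis k 1, axis k \<i>} then x else y) * (u \<bullet> j)"
    using j by (simp add: inner_sum_left inner_Basis if_distrib sum.delta cong: if_cong)
  also have "j \<in> {axis k 1, axis k \<i>} \<longleftrightarrow> i = k"
    using e by (auto simp: ie axis_eq_axis)
  also have "(if i = k then x else y) * (u \<bullet> j) = ?L \<bullet> j"
    using e by (auto simp: ie aniso_def proj_perp_def proj_line_axis[OF assms] inner_axis
        inner_add_left inner_diff_left) (auto simp: axis_def)
  finally show "?L \<bullet> j = ?R \<bullet> j" by simp
qed

lemma card_Basis_axis: "card {axis k 1 :: complex ^ 'n, axis k \<i>} = 2"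
  by (simp add: axis_eq_axis)

lemma nn_integral_aniso_axis:
  fixes g :: "complex ^ 'n \<Rightarrow> ennreal"
  assumes c: "c \<noteq> 0" and xy: "x > 0" "y > 0" and [measurable]: "g \<in> borel_measurable borel"
  shows "(\<integral>\<^sup>+ w. g w \<partial>lborel)
    = ennreal (x\<^sup>2 * y ^ (2 * (CARD('n) - 1))) * (\<integral>\<^sup>+ u. g (aniso x y (axis k c) u) \<partial>lborel)"
proof -
  let ?A = "{axis k 1 :: complex ^ 'n, axis k \<i>}"
  let ?c = "\<lambda>j. if j \<in> ?A then x else y"
  have T: "(\<lambda>u. 0 + (\<Sum>j\<in>Basis. (?c j * (u \<bullet> j)) *\<^sub>R j)) = aniso x y (axis k c)"
    using aniso_axis[OF c, of x y k] by auto
  have A: "?A \<subseteq> Basis" by (auto simp: Basis_vec_def Basis_complex_def)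
  have "(\<Prod>j\<in>Basis. \<bar>?c j\<bar>) = (\<Prod>j\<in>?A. \<bar>?c j\<bar>) * (\<Prod>j\<in>Basis - ?A. \<bar>?c j\<bar>)"
    using prod.subset_diff[OF A finite_Basis, of "\<lambda>j. \<bar>?c j\<bar>"] by (simp only: mult.commute)
  also have "(\<Prod>j\<in>?A. \<bar>?c j\<bar>) = (\<Prod>j\<in>?A. x)" using xy by (intro prod.cong) auto
  also have "(\<Prod>j\<in>Basis - ?A. \<bar>?c j\<bar>) = (\<Prod>j\<in>Basis - ?A. y)" using xy by (intro prod.cong) auto
  also have "(\<Prod>j\<in>?A. x) * (\<Prod>j\<in>Basis - ?A. y) = x\<^sup>2 * y ^ (2 * (CARD('n) - 1))"
    unfolding prod_constant card_Basis_axis card_Diff_subset[OF finite_subset[OF A finite_Basis] A]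
    by (simp add: algebra_simps numeral_2_eq_2)
  finally have P: "(\<Prod>j\<in>Basis. \<bar>?c j\<bar>) = x\<^sup>2 * y ^ (2 * (CARD('n) - 1))" .
  have [measurable]: "aniso x y (axis k c) \<in> borel_measurable borel"
    by (rule borel_measurable_linear[OF linear_aniso])
  have "lborel = density (distr (lborel :: (complex ^ 'n) measure) borel (aniso x y (axis k c)))
      (\<lambda>_. ennreal (x\<^sup>2 * y ^ (2 * (CARD('n) - 1))))"
    using lborel_affine_euclidean[of ?c 0] xy unfolding T P by (auto simp: prod_ennreal P)
  then have "(\<integral>\<^sup>+ w. g w \<partial>lborel) = (\<integral>\<^sup>+ w. g w \<partial>density (distr (lborel :: (complex ^ 'n) measure) borel
      (aniso x y (axis k c))) (\<lambda>_. ennreal (x\<^sup>2 * y ^ (2 * (CARD('n) - 1)))))"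
    by simp
  also have "\<dots> = ennreal (x\<^sup>2 * y ^ (2 * (CARD('n) - 1))) * (\<integral>\<^sup>+ u. g (aniso x y (axis k c) u) \<partial>lborel)"
    by (simp add: nn_integral_density nn_integral_distr nn_integral_cmult)
  finally show ?thesis .
qed

text \<open>The exponents count real dimensions: 2 for the complex line through b, and 2 (n - 1) for
  its complement. The case of a general b is conjugated by a reflection, which preserves Lebesgue
  measure, to that of an axis.\<close>

lemma nn_integral_aniso:
  fixes g :: "complex ^ 'n \<Rightarrow> ennreal"
  assumes b: "b \<noteq> 0" and xy: "x > 0" "y > 0" and [measurable]: "g \<in> borel_measurable borel"
  shows "(\<integral>\<^sup>+ w. g w \<partial>lborel)
    = ennreal (x\<^sup>2 * y ^ (2 * (CARD('n) - 1))) * (\<integral>\<^sup>+ u. g (c + aniso x y b u) \<partial>lborel)"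
proof -
  obtain k :: 'n where True by simp
  \<comment> \<open>The axis vector gets the length of b and the phase of the k-th coordinate of b,
    so that its product with b is real, as the reflection requires. If that coordinate is 0, any
    phase will do.\<close>
  define c0 where "c0 = of_real (norm b) * (if b $ k = 0 then 1 else sgn (b $ k))"
  have c0: "norm c0 = norm b" by (simp add: c0_def norm_mult norm_sgn)
  have "hinner b (axis k c0) = b $ k * cnj c0"
    by (simp add: hinner_def axis_def if_distrib cong: if_cong)
  also have "\<dots> = of_real (norm b * norm (b $ k))"
    by (simp add: c0_def sgn_eq complex_norm_square[symmetric] power2_eq_square mult_ac)
  finally have h: "Im (hinner b (axis k c0)) = 0" by simp
  define d where "d = b - axis k c0"
  have d: "householder d b = axis k c0"
    unfolding d_def by (rule householder_maps) (simp_all add: norm_axis_complex c0 h)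
  have c00: "c0 \<noteq> 0" using c0 b by auto
  have [measurable]: "householder d \<in> borel_measurable borel" "aniso x y b \<in> borel_measurable borel"
    "aniso x y (axis k c0) \<in> borel_measurable borel"
    by (rule borel_measurable_linear[OF linear_householder] borel_measurable_linear[OF linear_aniso])+
  have su: "surj (householder d)" by (metis householder_involution surjI)
  note iso = nn_integral_isometry[OF linear_householder norm_householder su]
  have "(\<integral>\<^sup>+ w. g w \<partial>lborel) = (\<integral>\<^sup>+ w. g (c + w) \<partial>lborel)"
    by (simp add: nn_integral_lborel_translate)
  also have "\<dots> = (\<integral>\<^sup>+ w. g (c + householder d w) \<partial>lborel)"
    by (rule iso[symmetric]) measurable
  also have "\<dots> = ennreal (x\<^sup>2 * y ^ (2 * (CARD('n) - 1)))
      * (\<integral>\<^sup>+ u. g (c + householder d (aniso x y (axis k c0) u)) \<partial>lborel)"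
    by (rule nn_integral_aniso_axis[OF c00 xy]) measurable
  also have "(\<integral>\<^sup>+ u. g (c + householder d (aniso x y (axis k c0) u)) \<partial>lborel)
      = (\<integral>\<^sup>+ u. g (c + aniso x y b (householder d u)) \<partial>lborel)"
    by (simp add: householder_aniso d[symmetric] householder_involution)
  also have "\<dots> = (\<integral>\<^sup>+ u. g (c + aniso x y b u) \<partial>lborel)"
    by (rule iso) measurable
  finally show ?thesis .
qed

section \<open>Tents\<close>

definition defect :: "complex ^ 'n \<Rightarrow> real" where
  "defect z = 1 - (norm z)\<^sup>2"

definition kdist :: "complex ^ 'n \<Rightarrow> complex ^ 'n \<Rightarrow> real" where
  "kdist z w = norm (1 - hinner z w)"

text \<open>These are Carleson boxes with the vertex inside the ball. As |1 - <z,b>| >= 1 - |b|,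
  they are empty for r <= 1 - |b|, so quantifying over all b and all r > 0 does no harm.\<close>

definition tent :: "complex ^ 'n \<Rightarrow> real \<Rightarrow> (complex ^ 'n) set" where
  "tent b r = {z \<in> ball 0 1. kdist z b < r}"

lemma defect_pos: "z \<in> ball 0 1 \<Longrightarrow> 0 < defect z"
  by (simp add: defect_def power_less_one_iff abs_square_less_1)

lemma defect_le_1: "defect z \<le> 1"
  by (simp add: defect_def)

lemma kdist_commute: "kdist z w = kdist w z"
proof -
  have "cnj (1 - hinner z w) = 1 - hinner w z" by (simp add: cnj_hinner)
  then show ?thesis unfolding kdist_def by (metis complex_mod_cnj)
qed

lemma kdist_ge:
  assumes "norm w \<le> 1"
  shows "1 - norm z \<le> kdist z w"
proof -
  have "norm (hinner z w) \<le> norm z"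
    using norm_hinner_le[of z w] assms by (meson dual_order.trans mult_left_le norm_ge_zero)
  then show ?thesis
    unfolding kdist_def using norm_triangle_ineq2[of 1 "hinner z w"] by simp
qed

lemma defect_le_one_minus_norm: "norm z \<le> 1 \<Longrightarrow> defect z \<le> 2 * (1 - norm z)"
proof -
  assume "norm z \<le> 1"
  then have "(1 - norm z) * (1 + norm z) \<le> (1 - norm z) * 2"
    by (intro mult_left_mono) auto
  then show ?thesis by (simp add: defect_def power2_eq_square algebra_simps)
qed

lemma defect_le_kdist: "z \<in> ball 0 1 \<Longrightarrow> w \<in> ball 0 1 \<Longrightarrow> defect z \<le> 2 * kdist z w"
  using kdist_ge[of w z] defect_le_one_minus_norm[of z] by auto

lemma defect_le_kdist': "z \<in> ball 0 1 \<Longrightarrow> w \<in> ball 0 1 \<Longrightarrow> defect w \<le> 2 * kdist z w"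
  using defect_le_kdist[of w z] by (simp add: kdist_commute)

lemma kdist_pos: "z \<in> ball 0 1 \<Longrightarrow> w \<in> ball 0 1 \<Longrightarrow> 0 < kdist z w"
  using defect_le_kdist[of z w] defect_pos[of z] by simp

lemma kdist_le_2:
  assumes "z \<in> ball 0 1" "w \<in> ball 0 1"
  shows "kdist z w < 2"
proof -
  have "norm z * norm w < 1"
    using assms mult_strict_mono'[of "norm z" 1 "norm w" 1] by simp
  then have "norm (hinner z w) < 1" using norm_hinner_le[of z w] by simp
  then show ?thesis unfolding kdist_def using norm_triangle_ineq4[of 1 "hinner z w"] by simp
qed

text \<open>Expanding the square gives |z - w|^2 = 2 Re (1 - <z,w>) - d(z) - d(w), and both defects
  are positive.\<close>

lemma norm_diff_sq_le_kdist:
  assumes "z \<in> ball 0 1" "w \<in> ball 0 1"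
  shows "(norm (z - w))\<^sup>2 \<le> 2 * kdist z w"
proof -
  have "(norm (z - w))\<^sup>2 = 2 * Re (1 - hinner z w) - defect z - defect w"
    by (simp add: norm_diff_sq defect_def)
  also have "\<dots> \<le> 2 * Re (1 - hinner z w)"
    using defect_pos[OF assms(1)] defect_pos[OF assms(2)] by linarith
  also have "\<dots> \<le> 2 * kdist z w"
    unfolding kdist_def using complex_Re_le_cmod[of "1 - hinner z w"] by linarith
  finally show ?thesis .
qed

text \<open>The identity 1 - <a,w> = (1 - <a,z>) + (1 - <z,w>) - d(z) - <a - z, w - z> has two
  correction terms, each at most k(a,z) + k(z,w). This accounts for the factor 3 = 1 + 1 +
  1.\<close>

lemma kdist_triangle:
  assumes "a \<in> ball 0 1" "z \<in> ball 0 1" "w \<in> ball 0 1"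
  shows "kdist a w \<le> 3 * (kdist a z + kdist z w)"
proof -
  have e: "1 - hinner a w = (1 - hinner a z) + (1 - hinner z w) - of_real (defect z) - hinner (a - z) (w - z)"
    by (simp add: hinner_simps defect_def hinner_self)
  have "norm (hinner (a - z) (w - z)) \<le> norm (a - z) * norm (w - z)"
    by (rule norm_hinner_le)
  also have "\<dots> \<le> ((norm (a - z))\<^sup>2 + (norm (w - z))\<^sup>2) / 2"
    using sum_squares_bound[of "norm (a - z)" "norm (w - z)"] by simp
  also have "\<dots> \<le> kdist a z + kdist z w"
    using norm_diff_sq_le_kdist[OF assms(1,2)] norm_diff_sq_le_kdist[OF assms(3,2)]
    by (simp add: kdist_commute)
  finally have h: "norm (hinner (a - z) (w - z)) \<le> kdist a z + kdist z w" .
  have "defect z \<le> kdist a z + kdist z w"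
    using defect_le_kdist'[OF assms(1,2)] defect_le_kdist[OF assms(2,3)] by simp
  then have d: "norm (complex_of_real (defect z)) \<le> kdist a z + kdist z w"
    using defect_pos[OF assms(2)] by simp
  have "kdist a w \<le> kdist a z + kdist z w + norm (complex_of_real (defect z)) + norm (hinner (a - z) (w - z))"
    unfolding kdist_def[of a w] e
    using norm_triangle_ineq[of "1 - hinner a z" "1 - hinner z w"]
      norm_triangle_ineq4[of "1 - hinner a z + (1 - hinner z w)" "of_real (defect z)"]
      norm_triangle_ineq4[of "1 - hinner a z + (1 - hinner z w) - of_real (defect z)" "hinner (a - z) (w - z)"]
    by (simp add: kdist_def)
  then show ?thesis using h d by simp
qed

section \<open>Identities for the involution and its numerator\<close>

lemma Phi_num_add:
  "Phi_num z (z + h) = - (proj_line z h + s_fac z *\<^sub>R proj_perp z h)"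
proof -
  have "proj_line z z = z"
    by (auto simp: proj_line_def hinner_self)
  then have "proj_line z (z + h) = z + proj_line z h" "proj_perp z (z + h) = proj_perp z h"
    by (simp_all add: linear_add[OF linear_proj_line] proj_perp_def)
  then show ?thesis by (simp add: Phi_num_def)
qed

lemma s_fac_sq: "z \<in> ball 0 1 \<Longrightarrow> (s_fac z)\<^sup>2 = defect z"
  using defect_pos[of z] by (simp add: s_fac_def defect_def)

lemma norm_Phi_num_add_sq:
  assumes "z \<in> ball 0 1"
  shows "(norm (Phi_num z (z + h)))\<^sup>2 = (norm (proj_line z h))\<^sup>2 + defect z * (norm (proj_perp z h))\<^sup>2"
  unfolding Phi_num_add norm_minus_cancel
  using norm_aniso_sq[of 1 "s_fac z" z h] s_fac_sq[OF assms] by (simp add: aniso_def)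

text \<open>The numerator of the classical formula for 1 - |Phi_a z|^2. The vector z - a is split
  along a, and |a|^2 |P h|^2 = |<h,a>|^2 removes the projection; this relation also holds at a = 0.
  The right side is symmetric in a and z, although the numerator itself is not.\<close>

lemma norm_Phi_num_sq:
  assumes "a \<in> ball 0 1"
  shows "(norm (Phi_num a z))\<^sup>2 = (kdist z a)\<^sup>2 - defect z * defect a"
proof -
  let ?h = "z - a"
  have P: "(norm a)\<^sup>2 * (norm (proj_line a ?h))\<^sup>2 = (norm (hinner ?h a))\<^sup>2"
    by (cases "a = 0") (simp_all add: norm_proj_line power_divide)
  have "(norm (Phi_num a z))\<^sup>2 = (norm (proj_line a ?h))\<^sup>2 + defect a * (norm (proj_perp a ?h))\<^sup>2"
    using norm_Phi_num_add_sq[OF assms, of ?h] by simp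
  also have "\<dots> = (norm ?h)\<^sup>2 - (norm a)\<^sup>2 * (norm ?h)\<^sup>2 + (norm (hinner ?h a))\<^sup>2"
    unfolding P[symmetric] using norm_proj_sq[of ?h a] by (simp add: defect_def algebra_simps)
  also have "\<dots> = (kdist z a)\<^sup>2 - defect z * defect a"
    unfolding kdist_def cmod_power2 norm_diff_sq[of z a] defect_def
    by (simp add: hinner_simps hinner_self) (simp add: algebra_simps power2_eq_square)
  finally show ?thesis .
qed

lemma norm_Phi_num_le:
  assumes "a \<in> ball 0 1" "z \<in> ball 0 1"
  shows "norm (Phi_num a z) \<le> kdist z a"
  by (rule power2_le_imp_le)
     (use assms in \<open>simp_all add: norm_Phi_num_sq defect_pos less_imp_le kdist_def\<close>)

lemma one_minus_norm_Phi_sq: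
  assumes "a \<in> ball 0 1" "z \<in> ball 0 1"
  shows "1 - (norm (Phi a z))\<^sup>2 = defect a * defect z / (kdist z a)\<^sup>2"
proof -
  have "norm (Phi a z) = norm (Phi_num a z) / kdist z a"
    by (simp add: Phi_def norm_vector_scale norm_divide kdist_def)
  then have "(norm (Phi a z))\<^sup>2 = ((kdist z a)\<^sup>2 - defect z * defect a) / (kdist z a)\<^sup>2"
    by (simp only: power_divide norm_Phi_num_sq[OF assms(1)])
  then show ?thesis
    using kdist_pos[OF assms(2,1)] by (simp add: field_simps)
qed

section \<open>Volumes of tents and of thin shells inside them\<close>

lemma borel_measurable_defect [measurable]: "defect \<in> borel_measurable borel"
  unfolding defect_def[abs_def] by measurable

lemma borel_measurable_kdist [measurable (raw)]:
  assumes [measurable]: "f \<in> borel_measurable M" "g \<in> borel_measurable M"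
  shows "(\<lambda>x. kdist (f x) (g x)) \<in> borel_measurable M"
  unfolding kdist_def by measurable

lemma tent_sets [measurable]: "tent b r \<in> sets borel"
proof -
  have "tent b r = ball 0 1 \<inter> {z \<in> space borel. kdist z b < r}" by (auto simp: tent_def)
  also have "\<dots> \<in> sets borel" by (rule sets.Int) (simp, measurable)
  finally show ?thesis .
qed

lemma tent_subset_ball: "tent b r \<subseteq> ball 0 1"
  by (auto simp: tent_def)

text \<open>Coordinates are centred at the boundary point b / |b|, where a tent has size r in the
  normal and sqrt r in the tangential directions. The bound r < 1/2 forces |b| > 1/2 when the tent
  is not empty. The normal part of u is at most 4 and the square of the tangential part at most 2,
  and 16 + 2 < 25.\<close>

lemma aniso_coords_of_tent:
  assumes b: "b \<in> ball 0 1" and r: "0 < r" "r < 1/2"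
    and z: "(1 / norm b) *\<^sub>R b + aniso r (sqrt r) b u \<in> tent b r"
  shows "norm u < 5"
proof -
  define \<omega> where "\<omega> = (1 / norm b) *\<^sub>R b"
  define z where "z = \<omega> + aniso r (sqrt r) b u"
  have zB: "z \<in> ball 0 1" and k: "kdist z b < r" using z by (auto simp: tent_def z_def \<omega>_def)
  have nb: "norm b < 1" "1 - norm b < r"
    using b k kdist_ge[of z b] zB by (auto simp: kdist_commute)
  then have b0: "b \<noteq> 0" "norm b > 1/2" using r by auto
  have h: "hinner \<omega> b = of_real (norm b)"
    using b0 by (simp add: \<omega>_def hinner_simps hinner_self power2_eq_square)
  have au: "aniso r (sqrt r) b u = z - \<omega>" by (simp add: z_def)
  have "norm (hinner z b - of_real (norm b)) \<le> norm (hinner z b - 1) + norm (1 - complex_of_real (norm b))"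
    using norm_triangle_ineq[of "hinner z b - 1" "1 - of_real (norm b)"] by simp
  also have "norm (1 - complex_of_real (norm b)) = 1 - norm b"
    using nb(1) norm_of_real[of "1 - norm b", where 'a=complex] by simp
  finally have 1: "norm (hinner (z - \<omega>) b) \<le> 2 * r"
    using k nb by (simp add: hinner_simps h kdist_def norm_minus_commute)
  have "norm (proj_line b (z - \<omega>)) \<le> 4 * r"
  proof -
    have "norm (hinner (z - \<omega>) b) \<le> 4 * r * norm b"
      using 1 mult_left_mono[of "1/2" "norm b" "4 * r"] b0(2) r by linarith
    then show ?thesis using b0 by (simp add: norm_proj_line field_simps)
  qed
  then have "r * norm (proj_line b u) \<le> 4 * r"
    using r by (simp add: au[symmetric] proj_aniso)
  then have Pu: "norm (proj_line b u) \<le> 4" using r by simp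
  have "proj_perp b \<omega> = 0"
    unfolding \<omega>_def linear_cmul[OF linear_proj_perp]
    by (simp add: proj_perp_def proj_line_def hinner_self)
  then have "proj_perp b (z - \<omega>) = proj_perp b z"
    by (simp add: linear_diff[OF linear_proj_perp])
  then have "sqrt r *\<^sub>R proj_perp b u = proj_perp b z"
    by (simp add: au[symmetric] proj_aniso)
  then have q: "sqrt r * norm (proj_perp b u) = norm (proj_perp b z)"
    using r norm_scaleR[of "sqrt r" "proj_perp b u"] by simp
  have hz: "norm (hinner z b) \<le> norm (proj_line b z)"
    using b0 nb mult_right_mono[of "norm b" 1 "norm (hinner z b)"] by (simp add: norm_proj_line field_simps)
  have hz1: "norm (hinner z b) \<ge> 1 - r"
    using k norm_triangle_ineq2[of 1 "hinner z b"] by (simp add: kdist_def)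
  have "(1 - r)\<^sup>2 \<le> (norm (proj_line b z))\<^sup>2"
    using hz hz1 r by (intro power_mono) auto
  then have "(norm (proj_perp b z))\<^sup>2 \<le> (norm z)\<^sup>2 - (1 - r)\<^sup>2"
    using norm_proj_sq[of z b] by simp
  also have "\<dots> \<le> 1 - (1 - r)\<^sup>2"
    using zB by (simp add: power_le_one)
  also have "\<dots> \<le> 2 * r" by (simp add: power2_eq_square algebra_simps)
  finally have "(sqrt r * norm (proj_perp b u))\<^sup>2 \<le> 2 * r" unfolding q .
  then have "(norm (proj_perp b u))\<^sup>2 \<le> 2" using r by (simp add: power_mult_distrib)
  moreover have "(norm (proj_line b u))\<^sup>2 \<le> 4\<^sup>2" using Pu by (intro power_mono) auto
  ultimately have "(norm u)\<^sup>2 < 5\<^sup>2" using norm_proj_sq[of u b] by simp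
  then show ?thesis by (rule power2_less_imp_less) simp
qed

text \<open>The anisotropic Jacobian is r^2 (sqrt r)^(2 (n - 1)) = r^(n + 1). For r >= 1/2 the
  volume of the whole ball suffices, and for b = 0 a tent with r < 1/2 is empty because k(z,0) =
  1.\<close>

lemma emeasure_tent_le:
  "\<exists>C>0. \<forall>b\<in>ball 0 1. \<forall>r>0. emeasure lborel (tent (b :: complex ^ 'n) r) \<le> ennreal (C * r ^ (CARD('n) + 1))"
proof -
  let ?V = "\<lambda>r. measure lborel (ball (0 :: complex ^ 'n) r)"
  have V: "emeasure lborel (ball (0 :: complex ^ 'n) r) = ennreal (?V r)" for r
    using emeasure_lborel_ball_finite[of "0::complex ^ 'n" r]
    by (intro emeasure_eq_ennreal_measure) simp
  let ?C = "?V 1 * 2 ^ (CARD('n) + 1) + ?V 5"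
  have pos: "?V 1 > 0" "?V 5 > 0" by (simp_all add: content_ball_pos)
  show ?thesis
  proof (intro exI[of _ ?C] conjI ballI allI impI)
    fix b :: "complex ^ 'n" and r :: real
    assume b: "b \<in> ball 0 1" and r: "r > 0"
    show "emeasure lborel (tent b r) \<le> ennreal (?C * r ^ (CARD('n) + 1))"
    proof (cases "r < 1/2")
      case False
      have "1 \<le> (2 * r) ^ (CARD('n) + 1)" using False by (intro one_le_power) auto
      then have 1: "?V 1 \<le> ?V 1 * 2 ^ (CARD('n) + 1) * r ^ (CARD('n) + 1)"
        using pos by (simp add: power_mult_distrib mult_ac)
      have "emeasure lborel (tent b r) \<le> emeasure lborel (ball (0 :: complex ^ 'n) 1)"
        by (intro emeasure_mono tent_subset_ball) auto
      also have "\<dots> \<le> ennreal (?C * r ^ (CARD('n) + 1))"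
        unfolding V using 1 pos r
        by (intro ennreal_leI) (simp add: distrib_right add_increasing2)
      finally show ?thesis .
    next
      case True
      show ?thesis
      proof (cases "b = 0")
        case True
        then have "tent b r = {}" using \<open>r < 1/2\<close> by (auto simp: tent_def kdist_def)
        then show ?thesis by simp
      next
        case b0: False
        have "emeasure lborel (tent b r) = (\<integral>\<^sup>+ z. indicator (tent b r) z \<partial>lborel)" by simp
        also have "\<dots> = ennreal (r\<^sup>2 * sqrt r ^ (2 * (CARD('n) - 1)))
            * (\<integral>\<^sup>+ u. indicator (tent b r) ((1 / norm b) *\<^sub>R b + aniso r (sqrt r) b u) \<partial>lborel)"
          using r b0 by (intro nn_integral_aniso) auto
        also have "\<dots> \<le> ennreal (r\<^sup>2 * sqrt r ^ (2 * (CARD('n) - 1)))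
            * (\<integral>\<^sup>+ u. indicator (ball (0 :: complex ^ 'n) 5) u \<partial>lborel)"
        proof (intro mult_left_mono nn_integral_mono)
          fix u
          show "indicator (tent b r) ((1 / norm b) *\<^sub>R b + aniso r (sqrt r) b u)
              \<le> (indicator (ball (0 :: complex ^ 'n) 5) u :: ennreal)"
            using aniso_coords_of_tent[OF b r True, of u]
            by (cases "(1 / norm b) *\<^sub>R b + aniso r (sqrt r) b u \<in> tent b r") simp_all
        qed simp
        also have "sqrt r ^ (2 * (CARD('n) - 1)) = r ^ (CARD('n) - 1)"
          using r by (simp add: power_mult)
        also have "r\<^sup>2 * r ^ (CARD('n) - 1) = r ^ (CARD('n) + 1)"
          by (simp add: power_add[symmetric])
        also have "ennreal (r ^ (CARD('n) + 1)) * (\<integral>\<^sup>+ u. indicator (ball (0 :: complex ^ 'n) 5) u \<partial>lborel)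
            = ennreal (r ^ (CARD('n) + 1) * ?V 5)"
          using r by (simp add: V ennreal_mult)
        also have "\<dots> \<le> ennreal (?C * r ^ (CARD('n) + 1))"
          using pos r by (intro ennreal_leI) (simp add: distrib_right mult_ac)
        finally show ?thesis .
      qed
    qed
  qed (use pos in \<open>simp add: add_pos_pos\<close>)
qed

lemma nn_integral_scale:
  fixes g :: "complex ^ 'n \<Rightarrow> ennreal"
  assumes x: "x > 0" and g: "g \<in> borel_measurable borel"
  shows "(\<integral>\<^sup>+ w. g w \<partial>lborel) = ennreal (x ^ (2 * CARD('n))) * (\<integral>\<^sup>+ u. g (c + x *\<^sub>R u) \<partial>lborel)"
proof -
  \<comment> \<open>Any nonzero vector serves: with equal factors the dilation does not see its
    direction.\<close>
  define b :: "complex ^ 'n" where "b = 1"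
  have b: "b \<noteq> 0" by (simp add: b_def)
  have "aniso x x b u = x *\<^sub>R u" for u
    by (simp add: aniso_def proj_perp_def algebra_simps)
  moreover have "x\<^sup>2 * x ^ (2 * (CARD('n) - 1)) = x ^ (2 * CARD('n))"
  proof -
    obtain m where "CARD('n) = Suc m" using zero_less_card_finite[where 'a='n] gr0_conv_Suc by blast
    then show ?thesis by (simp add: power_add power2_eq_square)
  qed
  ultimately show ?thesis
    using nn_integral_aniso[OF b x x g, of c] by simp
qed

text \<open>The dilates of the shell by powers of \<open>sqrt (1 - h)\<close> are disjoint and fill up a tent of
  comparable size, which gains the factor \<open>h / r\<close> over the measure of the tent.\<close>

lemma emeasure_tent_shell_le_aux:
  fixes b :: "complex ^ 'n"
  assumes A: "A > 0" "\<forall>b\<in>ball 0 1. \<forall>r>0. emeasure lborel (tent (b :: complex ^ 'n) r) \<le> ennreal (A * r ^ (CARD('n) + 1))"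
    and b: "b \<in> ball 0 1" and r: "0 < r" "r \<le> 4" and h: "0 < h" "h \<le> r / 8"
  shows "emeasure lborel {z \<in> tent b r. defect z < h} \<le> ennreal (A * 2 ^ (2 * CARD('n) + 5) * h * r ^ CARD('n))"
proof -
  define S where "S = {z \<in> tent b r. defect z < h}"
  define \<sigma> where "\<sigma> = sqrt (1 - h)"
  \<comment> \<open>The number of dilates used. For j < m one has j h <= r / 8, so the j-th dilation
    moves points so little that they stay in the tent of radius 2 r; still, m >= r / (16 h).\<close>
  define m where "m = nat \<lfloor>r / (8 * h)\<rfloor>"
  have h1: "h \<le> 1/2" using h r by linarith
  have \<sigma>: "0 < \<sigma>" "\<sigma> < 1" "1 - h \<le> \<sigma>" "\<sigma>\<^sup>2 = 1 - h"
  proof -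
    show "0 < \<sigma>" "\<sigma> < 1" "\<sigma>\<^sup>2 = 1 - h" using h1 h by (simp_all add: \<sigma>_def)
    have "(1 - h)\<^sup>2 \<le> 1 - h" using mult_left_le[of "1 - h" "1 - h"] h h1 unfolding power2_eq_square by linarith
    then show "1 - h \<le> \<sigma>" unfolding \<sigma>_def by (rule real_le_rsqrt)
  qed
  have fl: "real m \<le> r / (8 * h)" "r / (8 * h) < real m + 1"
  proof -
    have "0 \<le> r / (8 * h)" using h r by simp
    then have "real m = of_int \<lfloor>r / (8 * h)\<rfloor>" unfolding m_def by (subst of_nat_nat) simp_all
    then show "real m \<le> r / (8 * h)" "r / (8 * h) < real m + 1"
      using of_int_floor_le[of "r / (8 * h)"] floor_correct[of "r / (8 * h)"] by linarith+
  qed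
  have "1 \<le> r / (8 * h)" using h by (simp add: field_simps)
  then have "0 < m" using fl(2) by linarith
  then have m1: "1 \<le> real m" by simp
  have mge: "r / (16 * h) \<le> real m" proof -
    have "h * 1 \<le> h * real m" using m1 h by (intro mult_left_mono) auto
    moreover have "r < 8 * h * (real m + 1)" using fl(2) h by (simp add: field_simps)
    ultimately have "r \<le> real m * (16 * h)" by (simp add: algebra_simps)
    then show ?thesis using h by (simp add: field_simps)
  qed
  have [measurable]: "S \<in> sets borel"
  proof -
    have "S = tent b r \<inter> {z \<in> space borel. defect z < h}" by (auto simp: S_def)
    also have "\<dots> \<in> sets borel" by (rule sets.Int) measurable
    finally show ?thesis .
  qed
  have Snorm: "\<sigma> < norm z" "norm z < 1" if "z \<in> S" for z
  proof -
    have "\<sigma>\<^sup>2 < (norm z)\<^sup>2" using that by (simp add: S_def defect_def \<sigma>(4))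
    then show "\<sigma> < norm z" by (rule power2_less_imp_less) simp
    show "norm z < 1" using that by (simp add: S_def tent_def)
  qed
  have jh: "real j * h \<le> r / 8" if "j < m" for j
  proof -
    have "real j * h \<le> r / (8 * h) * h" using that fl(1) h by (intro mult_right_mono) auto
    then show ?thesis using h by simp
  qed
  have pw: "1 - real j * h \<le> (1 - h) ^ j" for j
    using Bernoulli_inequality[of "- h" j] h1 by simp
  define G where "G j w = (indicator S ((1 / \<sigma> ^ j) *\<^sub>R w) :: ennreal)" for j w
  have [measurable]: "G j \<in> borel_measurable borel" for j unfolding G_def by measurable
  have sum_le: "(\<Sum>j<m. G j w) \<le> indicator (tent b (2 * r)) w" for w
  proof (cases "\<exists>j<m. (1 / \<sigma> ^ j) *\<^sub>R w \<in> S")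
    case True
    then obtain j0 where j0: "j0 < m" "(1 / \<sigma> ^ j0) *\<^sub>R w \<in> S" by blast
    \<comment> \<open>The shell lies in \<sigma> < |z| < 1, hence its j-th dilate lies strictly
      between the spheres of radii \<sigma>^(j+1) and \<sigma>^j. This is why a point belongs to at
      most one dilate.\<close>
    have bnd: "\<sigma> ^ Suc j < norm w" "norm w < \<sigma> ^ j" if "(1 / \<sigma> ^ j) *\<^sub>R w \<in> S" for j
      using Snorm[OF that] \<sigma>(1) by (simp_all add: field_simps)
    have un: "j = j0" if "(1 / \<sigma> ^ j) *\<^sub>R w \<in> S" for j
    proof -
      have "\<not> i < k" if "(1 / \<sigma> ^ i) *\<^sub>R w \<in> S" "(1 / \<sigma> ^ k) *\<^sub>R w \<in> S" for i k
      proof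
        assume "i < k"
        then have "\<sigma> ^ k \<le> \<sigma> ^ Suc i" using \<sigma> by (intro power_decreasing) auto
        then show False using bnd(1)[OF that(1)] bnd(2)[OF that(2)] by simp
      qed
      from this[OF that j0(2)] this[OF j0(2) that] show ?thesis by simp
    qed
    have "G j w = (if j = j0 then 1 else 0)" for j
    proof (cases "(1 / \<sigma> ^ j) *\<^sub>R w \<in> S")
      case True
      then show ?thesis using un[OF True] by (simp add: G_def)
    next
      case False
      then have "j \<noteq> j0" using j0(2) by blast
      then show ?thesis using False by (simp add: G_def)
    qed
    then have "(\<Sum>j<m. G j w) = (\<Sum>j<m. if j = j0 then 1 else 0)" by simp
    also have "\<dots> = 1" using j0 by simp
    finally have s1: "(\<Sum>j<m. G j w) = 1" .
    define z where "z = (1 / \<sigma> ^ j0) *\<^sub>R w"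
    have w: "w = \<sigma> ^ j0 *\<^sub>R z" using \<sigma>(1) by (simp add: z_def)
    have z: "z \<in> S" using j0 by (simp add: z_def)
    have s: "0 < \<sigma> ^ j0" "\<sigma> ^ j0 \<le> 1" using \<sigma> by (simp_all add: power_le_one)
    have "(1 - h) ^ j0 \<le> \<sigma> ^ j0" using h1 \<sigma>(3) by (intro power_mono) auto
    then have s2: "1 - \<sigma> ^ j0 \<le> r / 8" using pw[of j0] jh[OF j0(1)] by simp
    have nz: "norm z < 1" using Snorm[OF z] by simp
    have hz: "norm (hinner z b) \<le> 1"
      using norm_hinner_le[of z b] nz b mult_mono[of "norm z" 1 "norm b" 1] by simp
    have "1 - hinner w b = (1 - hinner z b) + of_real (1 - \<sigma> ^ j0) * hinner z b"
      by (simp add: w hinner_simps algebra_simps)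
    then have "kdist w b \<le> kdist z b + norm (complex_of_real (1 - \<sigma> ^ j0) * hinner z b)"
      unfolding kdist_def using norm_triangle_ineq[of "1 - hinner z b" "of_real (1 - \<sigma> ^ j0) * hinner z b"]
      by (simp only:)
    also have "norm (complex_of_real (1 - \<sigma> ^ j0) * hinner z b) \<le> (1 - \<sigma> ^ j0) * 1"
      unfolding norm_mult norm_of_real using s hz by (intro mult_mono) auto
    finally have "kdist w b < 2 * r"
      using z s2 r by (simp add: S_def tent_def)
    moreover have "norm w < 1"
      using s nz mult_mono[of "\<sigma> ^ j0" 1 "norm z" "norm z"] by (simp add: w)
    ultimately have "w \<in> tent b (2 * r)" by (simp add: tent_def)
    then show ?thesis using s1 by simp
  next
    case False
    then have "(\<Sum>j<m. G j w) = 0" by (intro sum.neutral) (auto simp: G_def)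
    then show ?thesis by simp
  qed
  \<comment> \<open>Since r <= 4, Bernoulli's inequality gives (1 - h)^j >= 1 - r / 8 >= 1/2, so no
    dilate shrinks the volume by more than 2^(-n).\<close>
  have Gint: "ennreal ((1/2) ^ CARD('n)) * emeasure lborel S \<le> (\<integral>\<^sup>+ w. G j w \<partial>lborel)" if "j < m" for j
  proof -
    have s: "0 < \<sigma> ^ j" using \<sigma> by simp
    have "(\<integral>\<^sup>+ w. G j w \<partial>lborel) = ennreal ((\<sigma> ^ j) ^ (2 * CARD('n))) * (\<integral>\<^sup>+ u. G j (0 + \<sigma> ^ j *\<^sub>R u) \<partial>lborel)"
      by (rule nn_integral_scale[OF s]) measurable
    also have "(\<integral>\<^sup>+ u. G j (0 + \<sigma> ^ j *\<^sub>R u) \<partial>lborel) = emeasure lborel S"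
      using s \<sigma>(1) by (simp add: G_def)
    also have "(\<sigma> ^ j) ^ (2 * CARD('n)) = ((1 - h) ^ j) ^ CARD('n)"
    proof -
      have "(\<sigma> ^ j) ^ (2 * CARD('n)) = ((\<sigma>\<^sup>2) ^ j) ^ CARD('n)"
        by (simp only: power_mult[symmetric] mult.commute mult.left_commute)
      then show ?thesis by (simp only: \<sigma>(4))
    qed
    finally have eq: "(\<integral>\<^sup>+ w. G j w \<partial>lborel) = ennreal (((1 - h) ^ j) ^ CARD('n)) * emeasure lborel S" .
    have "(1/2) ^ CARD('n) \<le> ((1 - h) ^ j) ^ CARD('n)"
      using pw[of j] jh[OF that] r by (intro power_mono) auto
    then show ?thesis unfolding eq by (intro mult_right_mono ennreal_leI) auto
  qed
  have "ennreal (r / (16 * h) * (1/2) ^ CARD('n)) * emeasure lborel S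
      \<le> ennreal (real m * (1/2) ^ CARD('n)) * emeasure lborel S"
    using mge by (intro mult_right_mono ennreal_leI) auto
  also have "\<dots> = (\<Sum>j<m. ennreal ((1/2) ^ CARD('n)) * emeasure lborel S)"
    by (simp add: ennreal_mult ennreal_of_nat_eq_real_of_nat mult.assoc)
  also have "\<dots> \<le> (\<Sum>j<m. \<integral>\<^sup>+ w. G j w \<partial>lborel)"
    using Gint by (intro sum_mono) auto
  also have "\<dots> = (\<integral>\<^sup>+ w. (\<Sum>j<m. G j w) \<partial>lborel)"
    by (rule nn_integral_sum[symmetric]) measurable
  also have "\<dots> \<le> (\<integral>\<^sup>+ w. indicator (tent b (2 * r)) w \<partial>lborel)"
    by (intro nn_integral_mono sum_le)
  also have "\<dots> = emeasure lborel (tent b (2 * r))" by simp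
  also have "\<dots> \<le> ennreal (A * (2 * r) ^ (CARD('n) + 1))"
    by (intro A(2)[rule_format] b) (use r in simp)
  finally have main: "ennreal (r / (16 * h) * (1/2) ^ CARD('n)) * emeasure lborel S
    \<le> ennreal (A * (2 * r) ^ (CARD('n) + 1))" .
  define c where "c = 16 * h / r * 2 ^ CARD('n)"
  have c: "c > 0" "c * (r / (16 * h) * (1/2) ^ CARD('n)) = 1"
    using h r by (simp_all add: c_def power_divide)
  have "emeasure lborel S = ennreal c * (ennreal (r / (16 * h) * (1/2) ^ CARD('n)) * emeasure lborel S)"
    using c h r by (simp add: mult.assoc[symmetric] ennreal_mult[symmetric])
  also have "\<dots> \<le> ennreal c * ennreal (A * (2 * r) ^ (CARD('n) + 1))"
    by (intro mult_left_mono main) simp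
  also have "\<dots> = ennreal (c * (A * (2 * r) ^ (CARD('n) + 1)))"
    using c(1) A r by (simp add: ennreal_mult)
  also have "c * (A * (2 * r) ^ (CARD('n) + 1)) = A * 2 ^ (2 * CARD('n) + 5) * h * r ^ CARD('n)"
  proof -
    have e: "(2::real) ^ (2 * CARD('n) + 5) = 32 * (2 ^ CARD('n) * 2 ^ CARD('n))"
      by (simp add: power_add power_even_eq power2_eq_square)
    have e': "(2 * r) ^ (CARD('n) + 1) = 2 * r * (2 ^ CARD('n) * r ^ CARD('n))"
      by (simp add: power_mult_distrib)
    define X where "X = (2::real) ^ CARD('n)"
    define Y where "Y = r ^ CARD('n)"
    show ?thesis unfolding e e' c_def X_def[symmetric] Y_def[symmetric] using r by (simp add: field_simps)
  qed
  finally show ?thesis by (simp only: S_def)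
qed

text \<open>The size restrictions are harmless. For h > r / 8 the volume of the whole tent is
  already of order h r^n, and for r > 4 the tent equals the one of radius 4, because k < 2 on the
  ball.\<close>

lemma emeasure_tent_shell_le:
  "\<exists>C>0. \<forall>b\<in>ball 0 1. \<forall>r>0. \<forall>h>0.
     emeasure lborel {z \<in> tent (b :: complex ^ 'n) r. defect z < h} \<le> ennreal (C * h * r ^ CARD('n))"
proof -
  obtain A where A: "A > 0" "\<forall>b\<in>ball 0 1. \<forall>r>0. emeasure lborel (tent (b :: complex ^ 'n) r) \<le> ennreal (A * r ^ (CARD('n) + 1))"
    using emeasure_tent_le by blast
  let ?C = "A * 2 ^ (2 * CARD('n) + 5)"
  have le4: "emeasure lborel {z \<in> tent b r. defect z < h} \<le> ennreal (?C * h * r ^ CARD('n))"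
    if b: "b \<in> ball 0 1" and r: "0 < r" "r \<le> 4" and h: "0 < h" for b :: "complex ^ 'n" and r h
  proof (cases "h \<le> r / 8")
    case True
    then show ?thesis by (intro emeasure_tent_shell_le_aux[OF A b r h])
  next
    case False
    have "emeasure lborel {z \<in> tent b r. defect z < h} \<le> emeasure lborel (tent b r)"
      by (intro emeasure_mono) auto
    also have "\<dots> \<le> ennreal (A * r ^ (CARD('n) + 1))" using A b r by simp
    also have "A * r ^ (CARD('n) + 1) \<le> A * (8 * h) * r ^ CARD('n)"
      using False A r by (simp add: mult_ac)
    also have "A * (8 * h) * r ^ CARD('n) \<le> ?C * h * r ^ CARD('n)"
    proof -
      have "(2::real) ^ 3 \<le> 2 ^ (2 * CARD('n) + 5)" by (intro power_increasing) auto
      then have "A * 8 * (h * r ^ CARD('n)) \<le> ?C * (h * r ^ CARD('n))"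
        using A r h by (intro mult_right_mono mult_left_mono) auto
      then show ?thesis by (simp add: mult_ac)
    qed
    finally show ?thesis by (simp add: ennreal_leI)
  qed
  show ?thesis
  proof (intro exI[of _ ?C] conjI ballI allI impI)
    fix b :: "complex ^ 'n" and r h :: real
    assume b: "b \<in> ball 0 1" and r: "0 < r" and h: "0 < h"
    show "emeasure lborel {z \<in> tent b r. defect z < h} \<le> ennreal (?C * h * r ^ CARD('n))"
    proof (cases "r \<le> 4")
      case True
      then show ?thesis by (intro le4 b r h)
    next
      case False
      have "{z \<in> tent b r. defect z < h} = {z \<in> tent b 4. defect z < h}"
        using order.strict_trans[OF kdist_le_2[OF _ b], of _ r] order.strict_trans[OF kdist_le_2[OF _ b], of _ 4] False
        by (auto simp: tent_def)
      then have "emeasure lborel {z \<in> tent b r. defect z < h} \<le> ennreal (?C * h * 4 ^ CARD('n))"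
        using le4[OF b _ _ h, of 4] by simp
      also have "\<dots> \<le> ennreal (?C * h * r ^ CARD('n))"
        using False h A by (intro ennreal_leI mult_left_mono power_mono) auto
      finally show ?thesis .
    qed
  qed (use A in simp)
qed

section \<open>Kernel integrals and Carleson measures\<close>

text \<open>On a layer \<rho> / 2 <= \<kappa> < \<rho> the power is at most 2^|e| \<rho>^(-e),
  whatever the sign of e. Summing over \<rho> = D s^j gives a geometric series of ratio s^(m - e).
  The choice s = 1/2 serves integrals over small \<kappa> with e < m, and s = 2 those over large
  \<kappa> with e > m.\<close>

lemma nn_integral_layers:
  fixes \<kappa> :: "'a \<Rightarrow> real" and C :: ennreal
  assumes [measurable]: "\<kappa> \<in> borel_measurable M" "A \<in> sets M"
    and s: "s > 0" "s powr (m - e) < 1" and D: "D > 0"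
    and meas: "\<And>r. 0 < r \<Longrightarrow> emeasure M {x \<in> space M. \<kappa> x < r} \<le> C * ennreal (r powr m)"
    and A: "\<And>x. x \<in> A \<Longrightarrow> \<exists>j. D * s ^ j / 2 \<le> \<kappa> x \<and> \<kappa> x < D * s ^ j"
  shows "(\<integral>\<^sup>+ x. ennreal (\<kappa> x powr (- e)) * indicator A x \<partial>M)
      \<le> C * ennreal (2 powr \<bar>e\<bar> / (1 - s powr (m - e)) * D powr (m - e))"
proof -
  define \<rho> where "\<rho> j = D * s ^ j" for j
  have \<rho>: "\<rho> j > 0" for j using s D by (simp add: \<rho>_def)
  define f where "f j x = ennreal (2 powr \<bar>e\<bar> * \<rho> j powr (- e)) * indicator {x \<in> space M. \<kappa> x < \<rho> j} x" for j x
  have [measurable]: "f j \<in> borel_measurable M" for j unfolding f_def by measurable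
  have pt: "ennreal (\<kappa> x powr (- e)) * indicator A x \<le> (\<Sum>j. f j x)" if x: "x \<in> space M" for x
  proof (cases "x \<in> A")
    case True
    then obtain j where j: "\<rho> j / 2 \<le> \<kappa> x" "\<kappa> x < \<rho> j" using A[of x] by (auto simp: \<rho>_def)
    have "\<kappa> x powr (- e) \<le> 2 powr \<bar>e\<bar> * \<rho> j powr (- e)"
    proof (cases "e \<ge> 0")
      case True
      have "\<kappa> x powr (- e) \<le> (\<rho> j / 2) powr (- e)"
        using True j \<rho>[of j] by (intro powr_mono2') auto
      also have "\<dots> = 2 powr \<bar>e\<bar> * \<rho> j powr (- e)"
        using True \<rho>[of j] by (simp add: powr_divide powr_minus field_simps)
      finally show ?thesis .
    next
      case False
      have "\<kappa> x powr (- e) \<le> \<rho> j powr (- e)"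
        using False j \<rho>[of j] by (intro powr_mono2) auto
      also have "\<dots> \<le> 2 powr \<bar>e\<bar> * \<rho> j powr (- e)"
        using ge_one_powr_ge_zero[of 2 "\<bar>e\<bar>"] mult_right_mono[of 1 "2 powr \<bar>e\<bar>" "\<rho> j powr (- e)"] by simp
      finally show ?thesis .
    qed
    then have "ennreal (\<kappa> x powr (- e)) * indicator A x \<le> f j x"
      using True j x by (simp add: f_def ennreal_leI)
    also have "\<dots> \<le> (\<Sum>j. f j x)"
      using sum_le_suminf[of "\<lambda>j. f j x" "{j}"] by simp
    finally show ?thesis .
  qed simp
  have eq: "2 powr \<bar>e\<bar> * \<rho> j powr (- e) * \<rho> j powr m
      = 2 powr \<bar>e\<bar> * D powr (m - e) * (s powr (m - e)) ^ j" for j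
  proof -
    have "\<rho> j powr (- e) * \<rho> j powr m = \<rho> j powr (m - e)"
      by (simp add: powr_add[symmetric])
    also have "\<dots> = D powr (m - e) * (s ^ j) powr (m - e)"
      using s D by (simp add: \<rho>_def powr_mult)
    also have "(s ^ j) powr (m - e) = (s powr (m - e)) ^ j"
      using s by (simp add: powr_realpow[symmetric] powr_powr mult.commute)
    finally show ?thesis by (simp add: mult.assoc)
  qed
  have fint: "(\<integral>\<^sup>+ x. f j x \<partial>M) \<le> C * ennreal (2 powr \<bar>e\<bar> * D powr (m - e) * (s powr (m - e)) ^ j)" for j
  proof -
    have "(\<integral>\<^sup>+ x. f j x \<partial>M) = ennreal (2 powr \<bar>e\<bar> * \<rho> j powr (- e)) * emeasure M {x \<in> space M. \<kappa> x < \<rho> j}"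
      unfolding f_def by (simp add: nn_integral_cmult)
    also have "\<dots> \<le> ennreal (2 powr \<bar>e\<bar> * \<rho> j powr (- e)) * (C * ennreal (\<rho> j powr m))"
      by (intro mult_left_mono meas \<rho>) simp
    also have "\<dots> = C * ennreal (2 powr \<bar>e\<bar> * \<rho> j powr (- e) * \<rho> j powr m)"
      by (simp add: ennreal_mult mult_ac)
    finally show ?thesis unfolding eq .
  qed
  have sums: "(\<lambda>j. 2 powr \<bar>e\<bar> * D powr (m - e) * (s powr (m - e)) ^ j)
      sums (2 powr \<bar>e\<bar> * D powr (m - e) * (1 / (1 - s powr (m - e))))"
    using s by (intro sums_mult geometric_sums) simp
  have "(\<integral>\<^sup>+ x. ennreal (\<kappa> x powr (- e)) * indicator A x \<partial>M) \<le> (\<integral>\<^sup>+ x. (\<Sum>j. f j x) \<partial>M)"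
    by (intro nn_integral_mono pt)
  also have "\<dots> = (\<Sum>j. \<integral>\<^sup>+ x. f j x \<partial>M)"
    by (rule nn_integral_suminf) measurable
  also have "\<dots> \<le> (\<Sum>j. C * ennreal (2 powr \<bar>e\<bar> * D powr (m - e) * (s powr (m - e)) ^ j))"
    by (intro suminf_le fint summableI)
  also have "\<dots> = C * (\<Sum>j. ennreal (2 powr \<bar>e\<bar> * D powr (m - e) * (s powr (m - e)) ^ j))"
    by simp
  also have "\<dots> = C * ennreal (2 powr \<bar>e\<bar> * D powr (m - e) * (1 / (1 - s powr (m - e))))"
    using s by (subst suminf_ennreal_eq[OF _ sums]) auto
  finally show ?thesis by (simp add: field_simps)
qed

lemma power_bracket:
  fixes x :: real
  assumes "0 < x" "x < 1"
  shows "\<exists>j. (1/2) ^ j / 2 \<le> x \<and> x < (1/2) ^ j"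
proof -
  obtain k where k: "(1/2) ^ k < x" using real_arch_pow_inv[of x "1/2"] assms by auto
  define P where "P i \<longleftrightarrow> (1/2) ^ i \<le> x" for i :: nat
  define i where "i = (LEAST i. P i)"
  have Pi: "P i" unfolding i_def using k by (intro LeastI[of P k]) (simp add: P_def)
  then have "i \<noteq> 0" using assms by (intro notI) (simp add: P_def)
  then obtain j where j: "i = Suc j" using not0_implies_Suc by blast
  then have "\<not> P j" using not_less_Least[of j P] by (simp add: i_def)
  then show ?thesis using Pi j by (intro exI[of _ j]) (simp add: P_def)
qed

lemma half_powr_less_one: "y > 0 \<Longrightarrow> (1/2::real) powr y < 1"
  using powr_less_mono2[of y "1/2" 1] by simp

lemma nn_integral_layer_small:
  fixes \<kappa> :: "'a \<Rightarrow> real" and C :: ennreal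
  assumes [measurable]: "\<kappa> \<in> borel_measurable M" "A \<in> sets M"
    and e: "e < m" and D: "D > 0"
    and meas: "\<And>r. 0 < r \<Longrightarrow> emeasure M {x \<in> space M. \<kappa> x < r} \<le> C * ennreal (r powr m)"
    and A: "\<And>x. x \<in> A \<Longrightarrow> 0 < \<kappa> x \<and> \<kappa> x < D"
  shows "(\<integral>\<^sup>+ x. ennreal (\<kappa> x powr (- e)) * indicator A x \<partial>M)
      \<le> C * ennreal (2 powr \<bar>e\<bar> / (1 - (1/2) powr (m - e)) * D powr (m - e))"
proof (rule nn_integral_layers[OF assms(1,2) _ _ D meas])
  show "(1/2::real) powr (m - e) < 1"
    using e by (intro half_powr_less_one) auto
  fix x assume "x \<in> A"
  then have "0 < \<kappa> x / D" "\<kappa> x / D < 1" using A[of x] D by auto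
  from power_bracket[OF this] obtain j where "(1/2) ^ j / 2 \<le> \<kappa> x / D" "\<kappa> x / D < (1/2) ^ j" by blast
  then show "\<exists>j. D * (1/2) ^ j / 2 \<le> \<kappa> x \<and> \<kappa> x < D * (1/2) ^ j"
    using D by (intro exI[of _ j]) (simp add: field_simps)
qed simp_all

lemma nn_integral_layer_big:
  fixes \<kappa> :: "'a \<Rightarrow> real" and C :: ennreal
  assumes [measurable]: "\<kappa> \<in> borel_measurable M" "A \<in> sets M"
    and e: "m < e" and D: "D > 0"
    and meas: "\<And>r. 0 < r \<Longrightarrow> emeasure M {x \<in> space M. \<kappa> x < r} \<le> C * ennreal (r powr m)"
    and A: "\<And>x. x \<in> A \<Longrightarrow> D \<le> \<kappa> x"
  shows "(\<integral>\<^sup>+ x. ennreal (\<kappa> x powr (- e)) * indicator A x \<partial>M)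
      \<le> C * ennreal (2 powr \<bar>e\<bar> / (1 - 2 powr (m - e)) * D powr (m - e))"
proof (rule nn_integral_layers[OF assms(1,2) _ _ D meas])
  show "(2::real) powr (m - e) < 1"
    using e by (simp add: powr_less_cancel_iff[of 2 _ 0, simplified])
  fix x assume x: "x \<in> A"
  \<comment> \<open>Bracketing the reciprocal between consecutive powers of 1/2 places \<kappa> in a
    layer above D. The factor 2 makes the index start at 0.\<close>
  define y where "y = D / (2 * \<kappa> x)"
  have kp: "\<kappa> x > 0" using A[OF x] D by simp
  have y: "0 < y" "y < 1" using A[OF x] D kp by (simp_all add: y_def field_simps)
  from power_bracket[OF this] obtain j where j: "(1/2) ^ j / 2 \<le> y" "y < (1/2) ^ j" by blast
  have 1: "D * 2 ^ j / 2 < \<kappa> x" using j(2) kp by (simp add: y_def field_simps)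
  have 2: "\<kappa> x \<le> D * 2 ^ j" using j(1) kp by (simp add: y_def field_simps)
  show "\<exists>j. D * 2 ^ j / 2 \<le> \<kappa> x \<and> \<kappa> x < D * 2 ^ j"
  \<comment> \<open>Inverting swaps the open and the closed end of the bracket, so the upper end may
    be attained; such a point belongs to the next layer.\<close>
  proof (cases "\<kappa> x = D * 2 ^ j")
    case True
    then show ?thesis using D by (intro exI[of _ "Suc j"]) simp
  next
    case False
    then show ?thesis using 1 2 by (intro exI[of _ j]) simp
  qed
qed simp_all

lemma ball_measurable [measurable]: "ball (0 :: 'a::euclidean_space) r \<in> sets borel"
  by simp

text \<open>Here the layers are those of the defect: on a tent it is below 2 r, and its sublevel
  sets have measure linear in the height by the shell estimate. Thus the exponent m of the layer
  lemma is 1, and x > -1 is the condition for convergence.\<close>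

lemma nn_integral_tent_defect_le:
  assumes x: "x > -1"
  shows "\<exists>C>0. \<forall>b\<in>ball 0 1. \<forall>r>0.
    (\<integral>\<^sup>+ z. ennreal (defect z powr x) * indicator (tent (b :: complex ^ 'n) r) z \<partial>lborel)
      \<le> ennreal (C * r powr (real CARD('n) + 1 + x))"
proof -
  obtain A where A: "A > 0" "\<forall>b\<in>ball 0 1. \<forall>r>0. \<forall>h>0.
     emeasure lborel {z \<in> tent (b :: complex ^ 'n) r. defect z < h} \<le> ennreal (A * h * r ^ CARD('n))"
    using emeasure_tent_shell_le by blast
  define c where "c = 2 powr \<bar>x\<bar> / (1 - (1/2) powr (1 + x)) * 2 powr (1 + x)"
  have "(1/2::real) powr (1 + x) < 1" using x by (intro half_powr_less_one) auto
  then have c: "c > 0" by (simp add: c_def)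
  show ?thesis
  proof (intro exI[of _ "A * c"] conjI ballI allI impI)
    fix b :: "complex ^ 'n" and r :: real
    assume b: "b \<in> ball 0 1" and r: "r > 0"
    let ?M = "density lborel (indicator (tent b r))"
    have "(\<integral>\<^sup>+ z. ennreal (defect z powr x) * indicator (tent b r) z \<partial>lborel)
      = (\<integral>\<^sup>+ z. ennreal (defect z powr (- (- x))) * indicator (tent b r) z \<partial>?M)"
      by (subst nn_integral_density) (auto intro!: nn_integral_cong split: split_indicator)
    also have "\<dots> \<le> ennreal (A * r ^ CARD('n))
        * ennreal (2 powr \<bar>- x\<bar> / (1 - (1/2) powr (1 - (- x))) * (2 * r) powr (1 - (- x)))"
    proof (rule nn_integral_layer_small)
      show "- x < 1" "0 < 2 * r" using x r by auto
      show "0 < defect z \<and> defect z < 2 * r" if "z \<in> tent b r" for z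
        using that defect_le_kdist[OF _ b, of z] defect_pos[of z] by (auto simp: tent_def)
      fix h :: real assume h: "h > 0"
      have "emeasure ?M {z \<in> space ?M. defect z < h} = emeasure lborel {z \<in> tent b r. defect z < h}"
        by (subst emeasure_density)
           (auto intro!: nn_integral_cong split: split_indicator simp: nn_integral_indicator[symmetric] simp del: nn_integral_indicator)
      also have "\<dots> \<le> ennreal (A * h * r ^ CARD('n))" using A(2) b r h by blast
      also have "\<dots> = ennreal (A * r ^ CARD('n)) * ennreal (h powr 1)"
        using A h r by (simp add: ennreal_mult[symmetric] mult_ac)
      finally show "emeasure ?M {z \<in> space ?M. defect z < h} \<le> ennreal (A * r ^ CARD('n)) * ennreal (h powr 1)" .
    qed (simp_all)
    also have "\<dots> = ennreal (A * r ^ CARD('n) * (c * r powr (1 + x)))"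
      using A r by (simp add: ennreal_mult'[symmetric] c_def powr_mult mult_ac)
    also have "A * r ^ CARD('n) * (c * r powr (1 + x)) = A * c * r powr (real CARD('n) + 1 + x)"
      using r by (simp add: powr_add[of r "real CARD('n)" "1 + x", simplified add.assoc[symmetric]] powr_realpow)
    finally show "(\<integral>\<^sup>+ z. ennreal (defect z powr x) * indicator (tent b r) z \<partial>lborel)
      \<le> ennreal (A * c * r powr (real CARD('n) + 1 + x))" .
  qed (use A c in simp)
qed

section \<open>Forelli-Rudin estimates with one and two kernels\<close>

lemma emeasure_weighted_sublevel:
  assumes "W \<in> borel_measurable borel" "b \<in> ball 0 1"
  shows "emeasure (density lborel (\<lambda>z. W z * indicator (ball 0 1) z)) {z \<in> space (density lborel (\<lambda>z. W z * indicator (ball 0 1) z)). kdist z b < r}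
    = (\<integral>\<^sup>+ z. W z * indicator (tent b r) z \<partial>lborel)"
  using assms(1) [measurable]
  by (subst emeasure_density) (auto intro!: nn_integral_cong split: split_indicator simp: tent_def)

text \<open>As k(z,w) >= d(w) / 2 on the ball, only layers above d(w) / 2 occur. The weighted volume
  of a tent grows like r^(n+1+x), so the exponent e beyond this makes the lowest layer
  dominate.\<close>

lemma nn_integral_kernel_le:
  assumes x: "x > -1" and e: "e > real CARD('n) + 1 + x"
  shows "\<exists>C>0. \<forall>w\<in>ball 0 1.
    (\<integral>\<^sup>+ z. ennreal (defect z powr x * kdist z (w :: complex ^ 'n) powr (- e)) * indicator (ball 0 1) z \<partial>lborel)
      \<le> ennreal (C * defect w powr (real CARD('n) + 1 + x - e))"
proof -
  let ?m = "real CARD('n) + 1 + x"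
  obtain A where A: "A > 0" "\<forall>b\<in>ball 0 1. \<forall>r>0.
    (\<integral>\<^sup>+ z. ennreal (defect z powr x) * indicator (tent (b :: complex ^ 'n) r) z \<partial>lborel) \<le> ennreal (A * r powr ?m)"
    using nn_integral_tent_defect_le[OF x] by blast
  define c where "c = 2 powr \<bar>e\<bar> / (1 - 2 powr (?m - e)) * (1/2) powr (?m - e)"
  have "(2::real) powr (?m - e) < 1" using e by (simp add: powr_less_cancel_iff[of 2 _ 0, simplified])
  then have c: "c > 0" by (simp add: c_def)
  show ?thesis
  proof (intro exI[of _ "A * c"] conjI ballI)
    fix w :: "complex ^ 'n" assume w: "w \<in> ball 0 1"
    let ?W = "\<lambda>z. ennreal (defect z powr x)"
    let ?M = "density lborel (\<lambda>z :: complex ^ 'n. ?W z * indicator (ball 0 1) z)"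
    have "(\<integral>\<^sup>+ z. ennreal (defect z powr x * kdist z w powr (- e)) * indicator (ball 0 1) z \<partial>lborel)
      = (\<integral>\<^sup>+ z. ennreal (kdist z w powr (- e)) * indicator (ball 0 1) z \<partial>?M)"
      by (subst nn_integral_density) (auto intro!: nn_integral_cong split: split_indicator simp: ennreal_mult)
    also have "\<dots> \<le> ennreal A * ennreal (2 powr \<bar>e\<bar> / (1 - 2 powr (?m - e)) * (defect w / 2) powr (?m - e))"
    proof (rule nn_integral_layer_big)
      show "0 < defect w / 2" using defect_pos[OF w] by simp
      show "defect w / 2 \<le> kdist z w" if "z \<in> ball 0 1" for z
        using defect_le_kdist'[OF that w] by simp
      fix r :: real assume r: "r > 0"
      show "emeasure ?M {z \<in> space ?M. kdist z w < r} \<le> ennreal A * ennreal (r powr ?m)"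
        using A r w by (subst emeasure_weighted_sublevel) (auto simp: ennreal_mult[symmetric])
    qed (use e in simp_all)
    also have "\<dots> = ennreal (A * c * defect w powr (?m - e))"
      using A defect_pos[OF w] by (simp add: ennreal_mult'[symmetric] c_def powr_divide mult_ac)
    finally show "(\<integral>\<^sup>+ z. ennreal (defect z powr x * kdist z w powr (- e)) * indicator (ball 0 1) z \<partial>lborel)
      \<le> ennreal (A * c * defect w powr (?m - e))" .
  qed (use A c in simp)
qed

text \<open>The counterpart for a kernel of small exponent, which is integrable near w uniformly in
  w; the outermost layer dominates. It handles the second kernel where it is the singular
  one.\<close>

lemma nn_integral_tent_kernel_le:
  assumes x: "x > -1" and e: "e < real CARD('n) + 1 + x"
  shows "\<exists>C>0. \<forall>w\<in>ball 0 1. \<forall>D>0.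
    (\<integral>\<^sup>+ z. ennreal (defect z powr x * kdist z (w :: complex ^ 'n) powr (- e)) * indicator (tent w D) z \<partial>lborel)
      \<le> ennreal (C * D powr (real CARD('n) + 1 + x - e))"
proof -
  let ?m = "real CARD('n) + 1 + x"
  obtain A where A: "A > 0" "\<forall>b\<in>ball 0 1. \<forall>r>0.
    (\<integral>\<^sup>+ z. ennreal (defect z powr x) * indicator (tent (b :: complex ^ 'n) r) z \<partial>lborel) \<le> ennreal (A * r powr ?m)"
    using nn_integral_tent_defect_le[OF x] by blast
  define c where "c = 2 powr \<bar>e\<bar> / (1 - (1/2) powr (?m - e))"
  have "(1/2::real) powr (?m - e) < 1" using e by (intro half_powr_less_one) auto
  then have c: "c > 0" by (simp add: c_def)
  show ?thesis
  proof (intro exI[of _ "A * c"] conjI ballI allI impI)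
    fix w :: "complex ^ 'n" and D :: real assume w: "w \<in> ball 0 1" and D: "D > 0"
    let ?W = "\<lambda>z. ennreal (defect z powr x)"
    let ?M = "density lborel (\<lambda>z :: complex ^ 'n. ?W z * indicator (ball 0 1) z)"
    have "(\<integral>\<^sup>+ z. ennreal (defect z powr x * kdist z w powr (- e)) * indicator (tent w D) z \<partial>lborel)
      = (\<integral>\<^sup>+ z. ennreal (kdist z w powr (- e)) * indicator (tent w D) z \<partial>?M)"
      by (subst nn_integral_density)
         (auto intro!: nn_integral_cong split: split_indicator simp: ennreal_mult tent_def)
    also have "\<dots> \<le> ennreal A * ennreal (2 powr \<bar>e\<bar> / (1 - (1/2) powr (?m - e)) * D powr (?m - e))"
    proof (rule nn_integral_layer_small)
      show "0 < kdist z w \<and> kdist z w < D" if "z \<in> tent w D" for z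
        using that kdist_pos[OF _ w] by (auto simp: tent_def)
      fix r :: real assume r: "r > 0"
      show "emeasure ?M {z \<in> space ?M. kdist z w < r} \<le> ennreal A * ennreal (r powr ?m)"
        using A r w by (subst emeasure_weighted_sublevel) (auto simp: ennreal_mult[symmetric])
    qed (use e D in simp_all)
    also have "\<dots> = ennreal (A * c * D powr (?m - e))"
      using A D by (simp add: ennreal_mult'[symmetric] c_def mult_ac)
    finally show "(\<integral>\<^sup>+ z. ennreal (defect z powr x * kdist z w powr (- e)) * indicator (tent w D) z \<partial>lborel)
      \<le> ennreal (A * c * D powr (?m - e))" .
  qed (use A c in simp)
qed

text \<open>With D = k(w,a), either k(z,a) >= D/6 and the second kernel is frozen at D, or the
  quasi-triangle inequality with constant 3 forces k(z,w) >= D/6 and the first one is frozen. The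
  second region then contributes D^(n+1+x-A-B).\<close>

lemma nn_integral_two_kernels_le:
  assumes x: "x > -1" and A: "A > real CARD('n) + 1 + x" and B: "0 \<le> B" "B < real CARD('n) + 1 + x"
  shows "\<exists>C>0. \<forall>w\<in>ball 0 1. \<forall>a\<in>ball 0 1.
    (\<integral>\<^sup>+ z. ennreal (defect z powr x * kdist z w powr (- A) * kdist z (a :: complex ^ 'n) powr (- B))
        * indicator (ball 0 1) z \<partial>lborel)
      \<le> ennreal (C * (defect w powr (real CARD('n) + 1 + x - A) * kdist w a powr (- B)))"
proof -
  let ?m = "real CARD('n) + 1 + x"
  obtain C1 where C1: "C1 > 0" "\<And>w :: complex ^ 'n. w \<in> ball 0 1 \<Longrightarrow>
      (\<integral>\<^sup>+ z. ennreal (defect z powr x * kdist z w powr (- A)) * indicator (ball 0 1) z \<partial>lborel)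
      \<le> ennreal (C1 * defect w powr (?m - A))"
    using nn_integral_kernel_le[OF x A] by blast
  obtain C2 where C2: "C2 > 0" "\<And>(w :: complex ^ 'n) D. w \<in> ball 0 1 \<Longrightarrow> D > 0 \<Longrightarrow>
      (\<integral>\<^sup>+ z. ennreal (defect z powr x * kdist z w powr (- B)) * indicator (tent w D) z \<partial>lborel)
      \<le> ennreal (C2 * D powr (?m - B))"
    using nn_integral_tent_kernel_le[OF x B(2)] by blast
  define K1 where "K1 = (1/6) powr (- B) * C1"
  define K2 where "K2 = C2 * (1/6) powr (?m - B - A) * (1/2) powr (?m - A)"
  have K: "K1 > 0" "K2 > 0" using C1 C2 by (simp_all add: K1_def K2_def)
  show ?thesis
  proof (intro exI[of _ "K1 + K2"] conjI ballI)
    fix w a :: "complex ^ 'n" assume w: "w \<in> ball 0 1" and a: "a \<in> ball 0 1"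
    define D where "D = kdist w a"
    have D: "D > 0" using kdist_pos[OF w a] by (simp add: D_def)
    have pt: "ennreal (defect z powr x * kdist z w powr (- A) * kdist z a powr (- B)) * indicator (ball 0 1) z
      \<le> ennreal ((D/6) powr (- B)) * (ennreal (defect z powr x * kdist z w powr (- A)) * indicator (ball 0 1) z)
        + ennreal ((D/6) powr (- A)) * (ennreal (defect z powr x * kdist z a powr (- B)) * indicator (tent a (D/6)) z)"
      (is "?l \<le> ?r1 + ?r2") for z
    proof (cases "z \<in> ball 0 1")
      case z: True
      show ?thesis
      proof (cases "kdist z a \<ge> D/6")
        case True
        have "kdist z a powr (- B) \<le> (D/6) powr (- B)"
          using True B D by (intro powr_mono2') auto
        then have "defect z powr x * kdist z w powr (- A) * kdist z a powr (- B)
          \<le> (D/6) powr (- B) * (defect z powr x * kdist z w powr (- A))"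
          by (subst mult.commute) (intro mult_right_mono, auto)
        then have "?l \<le> ?r1" using z by (simp add: ennreal_mult[symmetric] ennreal_leI)
        then show ?thesis by (simp add: add_increasing2)
      next
        case False
        then have k: "kdist z w \<ge> D/6"
          using kdist_triangle[OF w z a] by (simp add: D_def kdist_commute)
        have "kdist z w powr (- A) \<le> (D/6) powr (- A)"
          using k D A x by (intro powr_mono2') auto
        then have "defect z powr x * kdist z w powr (- A) * kdist z a powr (- B)
          \<le> (D/6) powr (- A) * (defect z powr x * kdist z a powr (- B))"
          using mult_right_mono[of "kdist z w powr (- A)" "(D/6) powr (- A)" "defect z powr x * kdist z a powr (- B)"]
          by (simp add: mult_ac)
        moreover have "z \<in> tent a (D/6)" using z False by (simp add: tent_def)
        ultimately have "?l \<le> ?r2" using z by (simp add: ennreal_mult[symmetric] ennreal_leI)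
        then show ?thesis by (simp add: add_increasing)
      qed
    qed simp
    have "(\<integral>\<^sup>+ z. ennreal (defect z powr x * kdist z w powr (- A) * kdist z a powr (- B)) * indicator (ball 0 1) z \<partial>lborel)
      \<le> (\<integral>\<^sup>+ z. ennreal ((D/6) powr (- B)) * (ennreal (defect z powr x * kdist z w powr (- A)) * indicator (ball 0 1) z)
        + ennreal ((D/6) powr (- A)) * (ennreal (defect z powr x * kdist z a powr (- B)) * indicator (tent a (D/6)) z) \<partial>lborel)"
      by (intro nn_integral_mono pt)
    also have "\<dots> = ennreal ((D/6) powr (- B)) * (\<integral>\<^sup>+ z. ennreal (defect z powr x * kdist z w powr (- A)) * indicator (ball 0 1) z \<partial>lborel)
        + ennreal ((D/6) powr (- A)) * (\<integral>\<^sup>+ z. ennreal (defect z powr x * kdist z a powr (- B)) * indicator (tent a (D/6)) z \<partial>lborel)"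
      by (subst nn_integral_add) (auto simp: nn_integral_cmult)
    also have "\<dots> \<le> ennreal ((D/6) powr (- B)) * ennreal (C1 * defect w powr (?m - A))
        + ennreal ((D/6) powr (- A)) * ennreal (C2 * (D/6) powr (?m - B))"
      by (intro add_mono mult_left_mono C1 C2 w a) (use D in auto)
    also have "\<dots> = ennreal ((D/6) powr (- B) * (C1 * defect w powr (?m - A)) + (D/6) powr (- A) * (C2 * (D/6) powr (?m - B)))"
      using C1 C2 by (simp add: ennreal_mult[symmetric] ennreal_plus[symmetric] del: ennreal_plus)
    also have "\<dots> \<le> ennreal ((K1 + K2) * (defect w powr (?m - A) * kdist w a powr (- B)))"
    proof (rule ennreal_leI)
      have e1: "(D/6) powr (- B) * (C1 * defect w powr (?m - A)) = K1 * (defect w powr (?m - A) * D powr (- B))"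
        using D by (simp add: K1_def powr_divide powr_one_eq_one)
      have "(D/6) powr (- A) * (C2 * (D/6) powr (?m - B)) = C2 * (D/6) powr ((?m - B - A))"
        by (simp add: powr_add[symmetric] algebra_simps)
      also have "\<dots> = C2 * (1/6) powr (?m - B - A) * (D powr (?m - A) * D powr (- B))"
        using D by (simp add: powr_divide powr_add[symmetric] algebra_simps)
      also have "\<dots> \<le> C2 * (1/6) powr (?m - B - A) * (((1/2) powr (?m - A) * defect w powr (?m - A)) * D powr (- B))"
      proof -
        \<comment> \<open>The exponent is negative and D >= d(w) / 2, so the power of D can be
          traded for the same power of the defect.\<close>
        have "D powr (?m - A) \<le> (defect w / 2) powr (?m - A)"
          using defect_le_kdist[OF w a] defect_pos[OF w] A by (intro powr_mono2') (auto simp: D_def)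
        also have "\<dots> = (1/2) powr (?m - A) * defect w powr (?m - A)"
          using defect_pos[OF w] by (simp add: powr_divide)
        finally show ?thesis using C2 by (intro mult_left_mono mult_right_mono) auto
      qed
      also have "\<dots> = K2 * (defect w powr (?m - A) * D powr (- B))"
        by (simp add: K2_def mult_ac)
      finally show "(D/6) powr (- B) * (C1 * defect w powr (?m - A)) + (D/6) powr (- A) * (C2 * (D/6) powr (?m - B))
        \<le> (K1 + K2) * (defect w powr (?m - A) * kdist w a powr (- B))"
        unfolding e1 D_def[symmetric] by (simp add: distrib_right)
    qed
    finally show "(\<integral>\<^sup>+ z. ennreal (defect z powr x * kdist z w powr (- A) * kdist z a powr (- B)) * indicator (ball 0 1) z \<partial>lborel)
      \<le> ennreal ((K1 + K2) * (defect w powr (?m - A) * kdist w a powr (- B)))" .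
  qed (use K in simp)
qed

section \<open>Carleson measures: testing by tents and testing by Moebius weights are
  equivalent\<close>

lemma tent_le_of_carleson:
  fixes W :: "complex ^ 'n \<Rightarrow> ennreal"
  assumes \<sigma>: "\<sigma> > 0" and [measurable]: "W \<in> borel_measurable borel"
    and M: "\<And>a. a \<in> ball 0 1 \<Longrightarrow>
      (\<integral>\<^sup>+ z. W z * ennreal (defect a powr \<sigma> * kdist z a powr (- 2 * \<sigma>)) * indicator (ball 0 1) z \<partial>lborel) \<le> M"
    and b: "b \<in> ball 0 1" and r: "r > 0"
  shows "(\<integral>\<^sup>+ z. W z * indicator (tent b r) z \<partial>lborel) \<le> M * ennreal (2 powr (2 * \<sigma>) * r powr \<sigma>)"
proof -
  \<comment> \<open>Capping the radius at 1 keeps the test point in the ball. Nothing is lost: for r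
    > 1 the bound k < 2 already gives what is needed on the tent.\<close>
  define r' where "r' = min r 1"
  have r': "0 < r'" "r' \<le> 1" "r' \<le> r" using r by (auto simp: r'_def)
  \<comment> \<open>The test point is the vertex pulled inwards to depth about r'. There d(a) >= r'
    while k(z,a) <= 2 r' on the tent, so the weight d(a)^\<sigma> k(z,a)^(-2\<sigma>) is at least a
    multiple of r'^(-\<sigma>).\<close>
  define a where "a = (1 - r') *\<^sub>R b"
  have nb: "norm b < 1" using b by simp
  have na: "norm a = (1 - r') * norm b" using r' by (simp add: a_def)
  have na1: "norm a \<le> 1 - r'" using r' nb by (simp add: na mult_left_le)
  then have a: "a \<in> ball 0 1" using r' by simp
  have "(norm a)\<^sup>2 \<le> (1 - r') * 1"
    unfolding power2_eq_square using na1 r' by (intro mult_mono) auto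
  then have da: "r' \<le> defect a" by (simp add: defect_def)
  have k: "kdist z a \<le> 2 * r'" if z: "z \<in> tent b r" for z
  proof -
    have zB: "z \<in> ball 0 1" using z by (simp add: tent_def)
    have "norm z * norm b \<le> 1" using mult_mono[of "norm z" 1 "norm b" 1] zB nb by simp
    then have h: "norm (hinner z b) \<le> 1" using norm_hinner_le[of z b] by linarith
    have "1 - hinner z a = (1 - hinner z b) + of_real r' * hinner z b"
      by (simp add: a_def hinner_simps algebra_simps)
    then have "kdist z a = norm ((1 - hinner z b) + of_real r' * hinner z b)" by (simp only: kdist_def)
    then have "kdist z a \<le> kdist z b + r' * norm (hinner z b)"
      using norm_triangle_ineq[of "1 - hinner z b" "of_real r' * hinner z b"] r'
      by (simp add: norm_mult kdist_def)
    also have "r' * norm (hinner z b) \<le> r'" using h r' by (simp add: mult_left_le)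
    finally have 1: "kdist z a \<le> kdist z b + r'" by simp
    show ?thesis
    proof (cases "r \<le> 1")
      case True
      then show ?thesis using 1 z by (simp add: tent_def r'_def)
    next
      case False
      then show ?thesis using kdist_le_2[OF zB a] by (simp add: r'_def)
    qed
  qed
  have pt: "W z * indicator (tent b r) z
    \<le> ennreal (2 powr (2 * \<sigma>) * r powr \<sigma>) * (W z * ennreal (defect a powr \<sigma> * kdist z a powr (- 2 * \<sigma>)) * indicator (ball 0 1) z)" for z
  proof (cases "z \<in> tent b r")
    case True
    then have zB: "z \<in> ball 0 1" by (simp add: tent_def)
    have "1 = r' powr \<sigma> * (r' powr \<sigma> * r' powr (- 2 * \<sigma>))"
      using r' by (simp add: powr_add[symmetric])
    also have "\<dots> = 2 powr (2 * \<sigma>) * r' powr \<sigma> * (r' powr \<sigma> * (2 * r') powr (- 2 * \<sigma>))"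
      using r' by (simp add: powr_mult powr_minus field_simps)
    also have "\<dots> \<le> 2 powr (2 * \<sigma>) * r powr \<sigma> * (defect a powr \<sigma> * kdist z a powr (- 2 * \<sigma>))"
      using r' da \<sigma> k[OF True] kdist_pos[OF zB a]
      by (intro mult_mono powr_mono2 powr_mono2') auto
    finally have "1 \<le> ennreal (2 powr (2 * \<sigma>) * r powr \<sigma> * (defect a powr \<sigma> * kdist z a powr (- 2 * \<sigma>)))"
      by simp
    then have "W z * 1 \<le> W z * ennreal (2 powr (2 * \<sigma>) * r powr \<sigma> * (defect a powr \<sigma> * kdist z a powr (- 2 * \<sigma>)))"
      by (intro mult_left_mono) auto
    then show ?thesis using True zB by (simp add: ennreal_mult mult_ac)
  qed simp
  have "(\<integral>\<^sup>+ z. W z * indicator (tent b r) z \<partial>lborel)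
    \<le> (\<integral>\<^sup>+ z. ennreal (2 powr (2 * \<sigma>) * r powr \<sigma>) * (W z * ennreal (defect a powr \<sigma> * kdist z a powr (- 2 * \<sigma>)) * indicator (ball 0 1) z) \<partial>lborel)"
    by (intro nn_integral_mono pt)
  also have "\<dots> = ennreal (2 powr (2 * \<sigma>) * r powr \<sigma>) * (\<integral>\<^sup>+ z. W z * ennreal (defect a powr \<sigma> * kdist z a powr (- 2 * \<sigma>)) * indicator (ball 0 1) z \<partial>lborel)"
    by (rule nn_integral_cmult) measurable
  also have "\<dots> \<le> ennreal (2 powr (2 * \<sigma>) * r powr \<sigma>) * M"
    by (intro mult_left_mono M a) simp
  finally show ?thesis by (simp add: mult.commute)
qed

text \<open>Only layers k(z,a) >= d(a) / 2 occur, and the kernel exponent 2\<sigma> exceeds the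
  Carleson exponent \<sigma>. The sum is of order d(a)^(-\<sigma>), which the factor d(a)^\<sigma>
  cancels.\<close>

lemma carleson_of_tent_le:
  fixes W :: "complex ^ 'n \<Rightarrow> ennreal"
  assumes \<sigma>: "\<sigma> > 0" and [measurable]: "W \<in> borel_measurable borel"
    and M: "\<And>b r. b \<in> ball 0 1 \<Longrightarrow> r > 0 \<Longrightarrow> (\<integral>\<^sup>+ z. W z * indicator (tent b r) z \<partial>lborel) \<le> M * ennreal (r powr \<sigma>)"
    and a: "a \<in> ball 0 1"
  shows "(\<integral>\<^sup>+ z. W z * ennreal (defect a powr \<sigma> * kdist z a powr (- 2 * \<sigma>)) * indicator (ball 0 1) z \<partial>lborel)
    \<le> M * ennreal (2 powr (2 * \<sigma>) / (1 - 2 powr (- \<sigma>)) * 2 powr \<sigma>)"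
proof -
  let ?M = "density lborel (\<lambda>z. W z * indicator (ball 0 1) z)"
  have "(\<integral>\<^sup>+ z. W z * ennreal (defect a powr \<sigma> * kdist z a powr (- 2 * \<sigma>)) * indicator (ball 0 1) z \<partial>lborel)
    = ennreal (defect a powr \<sigma>) * (\<integral>\<^sup>+ z. ennreal (kdist z a powr (- (2 * \<sigma>))) * indicator (ball 0 1) z \<partial>?M)"
    by (subst nn_integral_density, measurable, subst nn_integral_cmult[symmetric], measurable)
       (auto intro!: nn_integral_cong split: split_indicator simp: ennreal_mult mult_ac)
  also have "\<dots> \<le> ennreal (defect a powr \<sigma>) *
      (M * ennreal (2 powr \<bar>2 * \<sigma>\<bar> / (1 - 2 powr (\<sigma> - 2 * \<sigma>)) * (defect a / 2) powr (\<sigma> - 2 * \<sigma>)))"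
  proof (intro mult_left_mono nn_integral_layer_big)
    show "0 < defect a / 2" using defect_pos[OF a] by simp
    show "defect a / 2 \<le> kdist z a" if "z \<in> ball 0 1" for z
      using defect_le_kdist'[OF that a] by simp
    fix r :: real assume r: "r > 0"
    show "emeasure ?M {z \<in> space ?M. kdist z a < r} \<le> M * ennreal (r powr \<sigma>)"
      using M[OF a r] a by (subst emeasure_weighted_sublevel) auto
  qed (use \<sigma> in simp_all)
  also have "\<dots> = M * ennreal (defect a powr \<sigma> * (2 powr (2 * \<sigma>) / (1 - 2 powr (- \<sigma>)) * (defect a / 2) powr (- \<sigma>)))"
    by (subst ennreal_mult') (use \<sigma> in \<open>simp_all add: mult_ac\<close>)
  also have "defect a powr \<sigma> * (2 powr (2 * \<sigma>) / (1 - 2 powr (- \<sigma>)) * (defect a / 2) powr (- \<sigma>))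
    = 2 powr (2 * \<sigma>) / (1 - 2 powr (- \<sigma>)) * 2 powr \<sigma>"
  proof -
    have "defect a powr \<sigma> * (defect a / 2) powr (- \<sigma>) = 2 powr \<sigma>"
      using defect_pos[OF a] by (simp add: powr_divide powr_minus field_simps)
    then show ?thesis by (subst mult.left_commute) (simp only:)
  qed
  finally show ?thesis .
qed

section \<open>Cauchy estimates\<close>

lemma bounded_linear_scale_vector: "bounded_linear (\<lambda>t. t *s (h :: complex ^ 'n))"
  by (rule bounded_linear_intro[of _ "norm h"])
     (simp_all add: vec.scale_left_distrib scaleR_eq_vector_scale norm_vector_scale vector_smult_assoc scaleR_conv_of_real)

lemma holomorphic_on_line:
  assumes f: "holomorphic_Cn_on f S" and U: "open U"
    and S: "\<And>t. t \<in> U \<Longrightarrow> v + t *s h \<in> S"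
  shows "(\<lambda>t. f (v + t *s h)) holomorphic_on U"
  unfolding holomorphic_on_open[OF U]
proof
  fix t assume t: "t \<in> U"
  obtain D where D: "(f has_derivative D) (at (v + t *s h))" "\<And>c v. D (c *s v) = c * D v"
    using f S[OF t] unfolding holomorphic_Cn_on_def by blast
  have "((\<lambda>t. v + t *s h) has_derivative (\<lambda>t. t *s h)) (at t)"
    using has_derivative_add[OF has_derivative_const[of v] bounded_linear_imp_has_derivative[OF bounded_linear_scale_vector[of h]]]
    by simp
  from has_derivative_compose[OF this D(1)]
  have "((\<lambda>t. f (v + t *s h)) has_derivative (*) (D h)) (at t)"
    by (simp add: D(2) mult.commute[of _ "D h"])
  then show "\<exists>f'. ((\<lambda>t. f (v + t *s h)) has_field_derivative f') (at t)"
    unfolding has_field_derivative_def by blast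
qed

lemma holomorphic_Cn_on_aniso:
  assumes f: "holomorphic_Cn_on f S" and S: "\<And>u. u \<in> T \<Longrightarrow> z + aniso x y b u \<in> S"
  shows "holomorphic_Cn_on (\<lambda>u. f (z + aniso x y b u)) T"
  unfolding holomorphic_Cn_on_def
proof
  fix u assume u: "u \<in> T"
  obtain D where D: "(f has_derivative D) (at (z + aniso x y b u))" "\<And>c v. D (c *s v) = c * D v"
    using f S[OF u] unfolding holomorphic_Cn_on_def by blast
  have "((\<lambda>u. z + aniso x y b u) has_derivative aniso x y b) (at u)"
    using has_derivative_add[OF has_derivative_const[of z] linear_imp_has_derivative[OF linear_aniso[of x y b]]]
    by simp
  from has_derivative_compose[OF this D(1)]
  have "((\<lambda>u. f (z + aniso x y b u)) has_derivative (\<lambda>v. D (aniso x y b v))) (at u)" .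
  moreover have "D (aniso x y b (c *s v)) = c * D (aniso x y b v)" for c v
    by (simp add: aniso_scale D(2))
  ultimately show "\<exists>D. ((\<lambda>u. f (z + aniso x y b u)) has_derivative D) (at u) \<and> (\<forall>c v. D (c *s v) = c * D v)"
    by blast
qed

lemma holomorphic_Cn_on_continuous:
  assumes "holomorphic_Cn_on f S"
  shows "continuous_on S f"
  using assms unfolding holomorphic_Cn_on_def
  by (intro continuous_at_imp_continuous_on) (blast dest: has_derivative_continuous)

text \<open>The graph of x^p lies above its tangent at m, by Young's inequality for x / m and 1.
  This is the only convexity needed to raise mean values to the power p.\<close>

lemma powr_tangent_le:
  fixes x m p :: real
  assumes p: "p > 1" and x: "x \<ge> 0" and m: "m \<ge> 0"
  shows "m powr p + p * m powr (p - 1) * (x - m) \<le> x powr p"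
proof (cases "m = 0")
  case False
  then have m: "m > 0" using m by simp
  define q where "q = p / (p - 1)"
  have q: "q > 1" "1 / p + 1 / q = 1" using p by (simp_all add: q_def field_simps)
  have "x / m * 1 \<le> (x / m) powr p / p + 1 powr q / q"
    using p q x m by (intro Youngs_inequality) auto
  then have "p * (x / m) \<le> (x / m) powr p + p / q"
    using p by (simp add: field_simps)
  also have "p / q = p - 1" using p by (simp add: q_def)
  finally have "p * (x / m) - (p - 1) \<le> x powr p / m powr p"
    using x m by (simp add: powr_divide)
  then have "(p * (x / m) - (p - 1)) * m powr p \<le> x powr p"
    using m by (simp add: pos_le_divide_eq)
  moreover have "m powr p = m powr (p - 1) * m"
    using m powr_add[of m "p - 1" 1] by simp
  then have "(p * (x / m) - (p - 1)) * m powr p = m powr p + p * m powr (p - 1) * (x - m)"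
    using m by (simp add: field_simps)
  ultimately show ?thesis by simp
qed (use p in simp)

text \<open>Cauchy's formula bounds the modulus at the centre by its mean over the circle.
  Integrating the tangent inequality at m = |\<phi>(0)| then gives the power p, since its linear
  term has a nonnegative integral.\<close>

lemma circle_mean_value_powr:
  fixes \<phi> :: "complex \<Rightarrow> complex"
  assumes p: "p > 1" and hol: "\<phi> holomorphic_on U" and U: "open U" "cball 0 1 \<subseteq> U"
  shows "ennreal (2 * pi * norm (\<phi> 0) powr p)
    \<le> (\<integral>\<^sup>+ t. ennreal (norm (\<phi> (cis t)) powr p) * indicator {0..2*pi} t \<partial>lborel)"
proof -
  let ?m = "norm (\<phi> 0)"
  have cont: "continuous_on {0..2*pi} (\<lambda>t. \<phi> (cis t))"
    using U by (intro continuous_on_compose2[OF holomorphic_on_imp_continuous_on[OF hol]] continuous_intros) auto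
  have "((\<lambda>u. \<phi> u / (u - 0)) has_contour_integral (2 * of_real pi * \<i> * \<phi> 0)) (part_circlepath 0 1 0 (2*pi))"
    using Cauchy_integral_circlepath_simple[of \<phi> 0 1 0] holomorphic_on_subset[OF hol U(2)]
    by (simp add: circlepath_def)
  then have "((\<lambda>t. \<phi> (cis t) * \<i>) has_integral (2 * of_real pi * \<i> * \<phi> 0)) {0..2*pi}"
    by (subst (asm) has_contour_integral_part_circlepath_iff) (simp_all add: field_simps cis_neq_zero)
  then have I1: "integral {0..2*pi} (\<lambda>t. \<phi> (cis t) * \<i>) = 2 * of_real pi * \<i> * \<phi> 0"
    by (rule integral_unique)
  define N where "N = integral {0..2*pi} (\<lambda>t. norm (\<phi> (cis t)))"
  have N: "((\<lambda>t. norm (\<phi> (cis t))) has_integral N) {0..2*pi}"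
    unfolding N_def using cont
    by (intro integrable_integral integrable_continuous_real continuous_intros)
  have "norm (integral {0..2*pi} (\<lambda>t. \<phi> (cis t) * \<i>)) \<le> N"
    unfolding N_def using cont
    by (intro integral_norm_bound_integral integrable_continuous_real continuous_intros)
       (auto simp: norm_mult)
  then have Nm: "2 * pi * ?m \<le> N"
    unfolding I1 by (simp add: norm_mult)
  define P where "P = integral {0..2*pi} (\<lambda>t. norm (\<phi> (cis t)) powr p)"
  have P: "((\<lambda>t. norm (\<phi> (cis t)) powr p) has_integral P) {0..2*pi}"
    unfolding P_def using cont p
    by (intro integrable_integral integrable_continuous_real continuous_on_powr' continuous_intros) auto
  have C: "((\<lambda>t. ?m powr p + p * ?m powr (p - 1) * (norm (\<phi> (cis t)) - ?m)) has_integral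
      (2 * pi * ?m powr p + p * ?m powr (p - 1) * (N - 2 * pi * ?m))) {0..2*pi}"
    using has_integral_const_real[of "?m powr p" 0 "2*pi"] has_integral_const_real[of ?m 0 "2*pi"]
    by (intro has_integral_add has_integral_mult_right has_integral_diff N) simp_all
  have "2 * pi * ?m powr p \<le> 2 * pi * ?m powr p + p * ?m powr (p - 1) * (N - 2 * pi * ?m)"
    using Nm p by simp
  also have "\<dots> \<le> P"
    by (rule has_integral_le[OF C P]) (use p in \<open>auto intro!: powr_tangent_le\<close>)
  finally have "ennreal (2 * pi * ?m powr p) \<le> ennreal P" by (rule ennreal_leI)
  also have "ennreal P = (\<integral>\<^sup>+ t. ennreal (norm (\<phi> (cis t)) powr p) * indicator {0..2*pi} t \<partial>lborel)"
    by (rule nn_integral_has_integral_lebesgue'[OF _ P, symmetric]) simp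
  finally show ?thesis .
qed

lemma linear_scale_vector: "linear (\<lambda>v :: complex ^ 'n. c *s v)"
  by (rule linearI) (simp_all add: vec.scale_right_distrib scaleR_eq_vector_scale vector_smult_assoc mult.commute)

lemma holomorphic_norm_powr_measurable:
  assumes "holomorphic_Cn_on (g :: complex ^ 'n \<Rightarrow> complex) (ball 0 1)"
  shows "(\<lambda>w. ennreal (norm (g w) powr p) * indicator (ball 0 1) w) \<in> borel_measurable borel"
proof -
  have "(\<lambda>w. indicat_real (ball 0 1) w *\<^sub>R g w) \<in> borel_measurable borel"
    by (rule borel_measurable_continuous_on_indicator[OF _ holomorphic_Cn_on_continuous[OF assms]]) simp
  then have "(\<lambda>w. ennreal (norm (indicat_real (ball 0 1) w *\<^sub>R g w) powr p) * indicator (ball 0 1) w) \<in> borel_measurable borel"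
    by measurable
  also have "(\<lambda>w. ennreal (norm (indicat_real (ball 0 1) w *\<^sub>R g w) powr p) * indicator (ball 0 1) w)
    = (\<lambda>w. ennreal (norm (g w) powr p) * indicator (ball 0 1) w)"
    by (auto simp: fun_eq_iff split: split_indicator)
  finally show ?thesis .
qed

text \<open>The circle estimate is applied on the slices t -> v + t h and integrated over |h| < 1/4;
  these circles stay in the ball because |v| <= 3/4. After exchanging the integrals, h -> cis t *s h
  is an isometry, so the inner integral is bounded independently of the angle.\<close>

lemma sub_mean_value:
  fixes g :: "complex ^ 'n \<Rightarrow> complex"
  assumes g: "holomorphic_Cn_on g (ball 0 1)" and p: "p > 1" and v: "norm v \<le> 3/4"
  shows "ennreal (norm (g v) powr p) * emeasure lborel (ball (0 :: complex ^ 'n) (1/4))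
    \<le> (\<integral>\<^sup>+ w. ennreal (norm (g w) powr p) * indicator (ball 0 1) w \<partial>lborel)"
proof -
  define G where "G w = ennreal (norm (g w) powr p) * indicator (ball 0 1) w" for w
  have [measurable]: "G \<in> borel_measurable borel"
    unfolding G_def by (rule holomorphic_norm_powr_measurable[OF g])
  let ?B = "ball (0 :: complex ^ 'n) (1/4)"
  have circ: "ennreal (2 * pi * norm (g v) powr p) * indicator ?B h
      \<le> (\<integral>\<^sup>+ t. G (v + cis t *s h) * indicator ?B h * indicator {0..2*pi} t \<partial>lborel)" for h
  proof (cases "h \<in> ?B")
    case True
    define U where "U = {t. v + t *s h \<in> ball 0 1}"
    have in_ball: "v + t *s h \<in> ball 0 1" if "norm t \<le> 1" for t
    proof -
      have "norm t * norm h \<le> 1 * norm h" using that by (intro mult_right_mono) auto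
      then show ?thesis
        using norm_triangle_ineq[of v "t *s h"] v True by (simp add: norm_vector_scale)
    qed
    have "continuous_on UNIV (\<lambda>t. v + t *s h)"
      by (intro continuous_intros linear_continuous_on bounded_linear_scale_vector)
    then have U: "open U" unfolding U_def
      using open_vimage[of "ball 0 1" "\<lambda>t. v + t *s h"] by (simp add: vimage_def)
    have "cball 0 1 \<subseteq> U" using in_ball by (auto simp: U_def)
    then have "ennreal (2 * pi * norm (g (v + 0 *s h)) powr p)
      \<le> (\<integral>\<^sup>+ t. ennreal (norm (g (v + cis t *s h)) powr p) * indicator {0..2*pi} t \<partial>lborel)"
      by (intro circle_mean_value_powr[OF p holomorphic_on_line[OF g U] U]) (auto simp: U_def)
    also have "\<dots> = (\<integral>\<^sup>+ t. G (v + cis t *s h) * indicator ?B h * indicator {0..2*pi} t \<partial>lborel)"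
      using True in_ball by (intro nn_integral_cong) (simp add: G_def)
    finally show ?thesis using True by simp
  qed simp
  have [measurable]: "(\<lambda>(t, h). cis t *s (h :: complex ^ 'n)) \<in> borel_measurable (borel \<Otimes>\<^sub>M borel)"
  proof -
    have "continuous_on UNIV (\<lambda>x :: real \<times> (complex ^ 'n). cis (fst x) *s snd x)"
      unfolding vector_scalar_mult_def by (intro continuous_intros)
    then show ?thesis
      by (simp add: borel_prod split_beta borel_measurable_continuous_onI)
  qed
  have m2 [measurable]: "(\<lambda>(t, h). G (v + cis t *s h)) \<in> borel_measurable (borel \<Otimes>\<^sub>M borel)"
    unfolding split_beta by measurable
  have "ennreal (2 * pi) * (ennreal (norm (g v) powr p) * emeasure lborel ?B)
    = (\<integral>\<^sup>+ h. ennreal (2 * pi * norm (g v) powr p) * indicator ?B h \<partial>lborel)"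
    by (simp add: nn_integral_cmult ennreal_mult mult.assoc)
  also have "\<dots> \<le> (\<integral>\<^sup>+ h. (\<integral>\<^sup>+ t. G (v + cis t *s h) * indicator ?B h * indicator {0..2*pi} t \<partial>lborel) \<partial>lborel)"
    by (intro nn_integral_mono circ)
  also have "\<dots> = (\<integral>\<^sup>+ t. (\<integral>\<^sup>+ h. G (v + cis t *s h) * indicator ?B h * indicator {0..2*pi} t \<partial>lborel) \<partial>lborel)"
    by (rule lborel_pair.Fubini') measurable
  also have "\<dots> \<le> (\<integral>\<^sup>+ t. (\<integral>\<^sup>+ w. G w \<partial>lborel) * indicator {0..2*pi} t \<partial>lborel)"
  proof (rule nn_integral_mono)
    fix t :: real
    have su: "surj (\<lambda>h :: complex ^ 'n. cis t *s h)"
      by (rule surjI[of _ "\<lambda>h. cis (- t) *s h"]) (simp add: vector_smult_assoc cis_mult)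
    have "(\<integral>\<^sup>+ h. G (v + cis t *s h) \<partial>lborel) = (\<integral>\<^sup>+ h. G (v + h) \<partial>lborel)"
      by (rule nn_integral_isometry[OF linear_scale_vector _ su, where g = "\<lambda>h. G (v + h)"])
         (simp_all add: norm_vector_scale)
    also have "\<dots> = (\<integral>\<^sup>+ w. G w \<partial>lborel)" by (rule nn_integral_lborel_translate) measurable
    finally have eq: "(\<integral>\<^sup>+ h. G (v + cis t *s h) \<partial>lborel) = (\<integral>\<^sup>+ w. G w \<partial>lborel)" .
    have "(\<integral>\<^sup>+ h. G (v + cis t *s h) * indicator ?B h * indicator {0..2*pi} t \<partial>lborel)
      \<le> (\<integral>\<^sup>+ h. G (v + cis t *s h) * indicator {0..2*pi} t \<partial>lborel)"
      by (intro nn_integral_mono) (auto split: split_indicator)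
    also have "\<dots> = (\<integral>\<^sup>+ w. G w \<partial>lborel) * indicator {0..2*pi} t"
      unfolding eq[symmetric] by (rule nn_integral_multc) measurable
    finally show "(\<integral>\<^sup>+ h. G (v + cis t *s h) * indicator ?B h * indicator {0..2*pi} t \<partial>lborel)
      \<le> (\<integral>\<^sup>+ w. G w \<partial>lborel) * indicator {0..2*pi} t" .
  qed
  also have "\<dots> = ennreal (2 * pi) * (\<integral>\<^sup>+ w. G w \<partial>lborel)"
    by (simp add: nn_integral_cmult mult.commute)
  finally have "ennreal (2 * pi) * (ennreal (norm (g v) powr p) * emeasure lborel ?B)
      \<le> ennreal (2 * pi) * (\<integral>\<^sup>+ w. G w \<partial>lborel)" .
  then show ?thesis
    unfolding G_def by (simp add: ennreal_mult_le_mult_iff)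
qed

text \<open>A gradient estimate from one variable only: the Schwarz lemma on the disc in the
  direction of u, with radius 3/4, where the bound M is available.\<close>

lemma schwarz_diff_le:
  fixes g :: "complex ^ 'n \<Rightarrow> complex"
  assumes g: "holomorphic_Cn_on g (ball 0 1)" and M: "\<And>v. norm v \<le> 3/4 \<Longrightarrow> norm (g v) \<le> M"
    and u: "norm u \<le> 1/2"
  shows "norm (g u - g 0) \<le> 4 * M * norm u"
proof (cases "u = 0 \<or> M = 0")
  case True
  then show ?thesis using M[of u] M[of 0] u by auto
next
  case False
  then have u0: "u \<noteq> 0" and M0: "M > 0" using order_trans[OF norm_ge_zero M[of 0]] by auto
  define h where "h = (3 / (4 * norm u)) *\<^sub>R u"
  have nh: "norm h = 3/4" using u0 by (simp add: h_def)
  have small: "norm (0 + t *s h) \<le> 3/4" if "norm t < 1" for t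
    using that nh mult_right_mono[of "norm t" 1 "norm h"] by (simp add: norm_vector_scale)
  have hol: "(\<lambda>t. g (0 + t *s h)) holomorphic_on ball 0 1"
  proof (rule holomorphic_on_line[OF g])
    fix t :: complex assume "t \<in> ball 0 1"
    then show "0 + t *s h \<in> ball 0 1" using small[of t] by simp
  qed simp
  \<comment> \<open>The divisor is 3 M instead of 2 M because the Schwarz lemma asks for modulus
    strictly below 1. As u corresponds to the parameter 4 |u| / 3, the final constant is 3 M * 4/3 =
    4 M.\<close>
  define \<psi> where "\<psi> t = (g (0 + t *s h) - g 0) / of_real (3 * M)" for t
  have h\<psi>: "\<psi> holomorphic_on ball 0 1"
    unfolding \<psi>_def by (intro holomorphic_intros hol) (use M0 in auto)
  have b\<psi>: "norm (\<psi> t) < 1" if "norm t < 1" for t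
  proof -
    have "norm (g (0 + t *s h) - g 0) \<le> norm (g (0 + t *s h)) + norm (g 0)" by (rule norm_triangle_ineq4)
    also have "\<dots> \<le> M + M" using M[OF small[OF that]] M[of 0] by (intro add_mono) auto
    also have "\<dots> < 3 * M" using M0 by simp
    finally show ?thesis using M0 by (simp add: \<psi>_def norm_divide norm_mult)
  qed
  define \<xi> where "\<xi> = complex_of_real (4 * norm u / 3)"
  have \<xi>: "norm \<xi> = 4 * norm u / 3" by (simp add: \<xi>_def norm_mult)
  have "norm (\<psi> \<xi>) \<le> norm \<xi>"
    by (rule Schwarz_Lemma(1)[OF h\<psi> _ b\<psi>]) (use u \<xi> in \<open>auto simp: \<psi>_def\<close>)
  moreover have "\<xi> *s h = u"
    using u0 by (simp add: \<xi>_def h_def scaleR_eq_vector_scale vector_smult_assoc)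
  ultimately show ?thesis
    using M0 by (simp add: \<psi>_def norm_divide norm_mult \<xi> field_simps)
qed

text \<open>The sub-mean value property supplies the sup bound on |v| <= 3/4 that the Schwarz lemma
  needs. The factor |u|^p is what will later beat the singularity of the kernel on the
  diagonal.\<close>

lemma cauchy_estimate_powr:
  assumes p: "p > 1"
  shows "\<exists>C>0. \<forall>g :: complex ^ 'n \<Rightarrow> complex. holomorphic_Cn_on g (ball 0 1) \<longrightarrow> (\<forall>u. norm u \<le> 1/2 \<longrightarrow>
    ennreal (norm (g u - g 0) powr p)
      \<le> ennreal (C * norm u powr p) * (\<integral>\<^sup>+ w. ennreal (norm (g w) powr p) * indicator (ball 0 1) w \<partial>lborel))"
proof -
  define V where "V = measure lborel (ball (0 :: complex ^ 'n) (1/4))"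
  have V: "V > 0" unfolding V_def by (simp add: content_ball_pos)
  have eV: "emeasure lborel (ball (0 :: complex ^ 'n) (1/4)) = ennreal V"
    unfolding V_def using emeasure_lborel_ball_finite[of "0::complex ^ 'n" "1/4"]
    by (intro emeasure_eq_ennreal_measure) simp
  show ?thesis
  proof (intro exI[of _ "4 powr p / V"] conjI allI impI)
    fix g :: "complex ^ 'n \<Rightarrow> complex" and u :: "complex ^ 'n"
    assume g: "holomorphic_Cn_on g (ball 0 1)" and u: "norm u \<le> 1/2"
    define I where "I = (\<integral>\<^sup>+ w. ennreal (norm (g w) powr p) * indicator (ball 0 1) w \<partial>lborel)"
    have "ennreal (norm (g u - g 0) powr p) \<le> ennreal (4 powr p / V * norm u powr p) * I"
    proof (cases "u = 0 \<or> I = \<infinity>")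
      case True
      then show ?thesis using V p by (auto simp: ennreal_mult_top)
    next
      case False
      then obtain i where i: "i \<ge> 0" "I = ennreal i" by (cases I) auto
      define M where "M = (i / V) powr (1 / p)"
      have M: "norm (g v) \<le> M" if "norm v \<le> 3/4" for v
      proof -
        have "ennreal (norm (g v) powr p) * ennreal V \<le> ennreal i"
          using sub_mean_value[OF g p that] by (simp add: eV I_def[symmetric] i)
        then have "norm (g v) powr p * V \<le> i"
          using V i by (simp add: ennreal_mult[symmetric])
        then have "norm (g v) powr p \<le> i / V" using V by (simp add: field_simps)
        then have "(norm (g v) powr p) powr (1 / p) \<le> (i / V) powr (1 / p)"
          using p by (intro powr_mono2) auto
        then show ?thesis using p by (simp add: M_def powr_powr)
      qed
      have "norm (g u - g 0) powr p \<le> (4 * M * norm u) powr p"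
        using schwarz_diff_le[OF g M u] p by (intro powr_mono2) auto
      also have "\<dots> = 4 powr p / V * norm u powr p * i"
        using V i p by (simp add: powr_mult M_def powr_powr)
      finally show ?thesis
        using V i by (simp add: ennreal_mult[symmetric] ennreal_leI)
    qed
    then show "ennreal (norm (g u - g 0) powr p) \<le> ennreal (4 powr p / V * norm u powr p)
        * (\<integral>\<^sup>+ w. ennreal (norm (g w) powr p) * indicator (ball 0 1) w \<partial>lborel)"
      by (simp add: I_def)
  qed (use V in simp)
qed

section \<open>The difference integral at a point\<close>

text \<open>On the ball this is \<open>norm (Phi_num z w)\<close>, in a form that is visibly symmetric and measurable.\<close>

definition pdist :: "complex ^ 'n \<Rightarrow> complex ^ 'n \<Rightarrow> real" where
  "pdist z w = sqrt ((kdist z w)\<^sup>2 - defect z * defect w)"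

lemma pdist_eq: "z \<in> ball 0 1 \<Longrightarrow> norm (Phi_num z w) = pdist z w"
proof -
  assume z: "z \<in> ball 0 1"
  have "(norm (Phi_num z w))\<^sup>2 = (kdist z w)\<^sup>2 - defect z * defect w"
    unfolding norm_Phi_num_sq[OF z] kdist_commute[of w z] mult.commute[of "defect w" "defect z"] ..
  then show ?thesis unfolding pdist_def by (intro real_sqrt_unique[symmetric] norm_ge_zero)
qed

lemma pdist_commute: "pdist z w = pdist w z"
  unfolding pdist_def kdist_commute[of z w] mult.commute[of "defect z" "defect w"] ..

lemma borel_measurable_pdist [measurable (raw)]:
  assumes [measurable]: "f \<in> borel_measurable M" "g \<in> borel_measurable M"
  shows "(\<lambda>x. pdist (f x) (g x)) \<in> borel_measurable M"
  unfolding pdist_def by measurable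

text \<open>With \<open>t = n + 1 + \<alpha>\<close>, the kernel of the double integral is \<open>pker\<close> after the factor
  \<open>(1 - |z|^2)^(-n-1)\<close> has been moved to the weight in \<open>z\<close>; \<open>bker\<close> is the same kernel
  without its singularity on the diagonal.\<close>

definition bker :: "real \<Rightarrow> real \<Rightarrow> complex ^ 'n \<Rightarrow> complex ^ 'n \<Rightarrow> real" where
  "bker t \<alpha> z w = defect z powr t * defect w powr \<alpha> * kdist z w powr (- 2 * t)"

definition pker :: "real \<Rightarrow> real \<Rightarrow> complex ^ 'n \<Rightarrow> complex ^ 'n \<Rightarrow> real" where
  "pker t \<alpha> z w = defect z powr t * defect w powr \<alpha> * pdist z w powr (- 2 * t)"

lemma borel_measurable_bker [measurable (raw)]:
  assumes [measurable]: "f \<in> borel_measurable M" "g \<in> borel_measurable M"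
  shows "(\<lambda>x. bker t \<alpha> (f x) (g x)) \<in> borel_measurable M"
  unfolding bker_def by measurable

lemma borel_measurable_pker [measurable (raw)]:
  assumes [measurable]: "f \<in> borel_measurable M" "g \<in> borel_measurable M"
  shows "(\<lambda>x. pker t \<alpha> (f x) (g x)) \<in> borel_measurable M"
  unfolding pker_def by measurable

lemma bker_nonneg: "bker t \<alpha> z w \<ge> 0" and pker_nonneg: "pker t \<alpha> z w \<ge> 0"
  by (simp_all add: bker_def pker_def)

text \<open>Taking the maximum and minimum of the two endpoint powers covers both signs of the
  exponent at once; this matters for \<alpha> and \<beta>, which are only known to exceed
  -1.\<close>

lemma powr_sandwich:
  fixes x d lo hi a :: real
  assumes "0 < lo" "0 < d" "lo * d \<le> x" "x \<le> hi * d"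
  shows "x powr a \<le> max (lo powr a) (hi powr a) * d powr a"
    and "min (lo powr a) (hi powr a) * d powr a \<le> x powr a"
proof -
  have ld: "0 < lo * d" using assms by simp
  have hd: "0 < hi * d" using assms ld by linarith
  then have h: "0 < hi" using assms by (simp add: zero_less_mult_iff)
  have x0: "0 < x" using ld assms by linarith
  have *: "x powr a \<le> max (lo powr a) (hi powr a) * d powr a \<and> min (lo powr a) (hi powr a) * d powr a \<le> x powr a"
  proof (cases "a \<ge> 0")
    case True
    have "(lo * d) powr a \<le> x powr a" "x powr a \<le> (hi * d) powr a"
      using True assms ld x0 by (auto intro!: powr_mono2)
    then have 1: "lo powr a * d powr a \<le> x powr a" "x powr a \<le> hi powr a * d powr a"
      using assms h by (simp_all add: powr_mult)
    have "hi powr a * d powr a \<le> max (lo powr a) (hi powr a) * d powr a"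
      "min (lo powr a) (hi powr a) * d powr a \<le> lo powr a * d powr a"
      by (intro mult_right_mono, simp_all)+
    then show ?thesis using 1 by linarith
  next
    case False
    have "x powr a \<le> (lo * d) powr a" "(hi * d) powr a \<le> x powr a"
      using False assms ld x0 by (auto intro!: powr_mono2')
    then have 1: "hi powr a * d powr a \<le> x powr a" "x powr a \<le> lo powr a * d powr a"
      using assms h by (simp_all add: powr_mult)
    have "lo powr a * d powr a \<le> max (lo powr a) (hi powr a) * d powr a"
      "min (lo powr a) (hi powr a) * d powr a \<le> hi powr a * d powr a"
      by (intro mult_right_mono, simp_all)+
    then show ?thesis using 1 by linarith
  qed
  then show "x powr a \<le> max (lo powr a) (hi powr a) * d powr a"
    and "min (lo powr a) (hi powr a) * d powr a \<le> x powr a" by auto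
qed

section \<open>Anisotropic charts around a point of the ball\<close>

text \<open>A linear substitute for \<open>Phi z\<close>: it maps the balls about 0 onto the sets
  \<open>{w. norm (Phi_num z w) < c}\<close>, and its Jacobian is constant.\<close>

definition chart :: "complex ^ 'n \<Rightarrow> complex ^ 'n \<Rightarrow> complex ^ 'n" where
  "chart z u = z + aniso (defect z / 4) (sqrt (defect z) / 4) z u"

text \<open>The point z = 0 is separate because the dilation has no distinguished line there; as
  d(0) = 1 the map is the isotropic scaling by 1/4 and the formula persists.\<close>

lemma nn_integral_chart:
  fixes g :: "complex ^ 'n \<Rightarrow> ennreal"
  assumes z: "z \<in> ball 0 1" and g: "g \<in> borel_measurable borel"
  shows "(\<integral>\<^sup>+ w. g w \<partial>lborel)
    = ennreal ((1/16) ^ CARD('n) * defect z ^ (CARD('n) + 1)) * (\<integral>\<^sup>+ u. g (chart z u) \<partial>lborel)"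
proof -
  obtain m where m: "CARD('n) = Suc m" using zero_less_card_finite[where 'a='n] gr0_conv_Suc by blast
  have d: "defect z > 0" using defect_pos[OF z] .
  show ?thesis
  proof (cases "z = 0")
    case True
    then have "chart z u = 0 + (1/4) *\<^sub>R u" for u by (simp add: chart_def aniso_zero_vec defect_def)
    moreover have "(1/4::real) ^ (2 * CARD('n)) = (1/16) ^ CARD('n)" by (simp add: power_mult power2_eq_square)
    ultimately show ?thesis using nn_integral_scale[of "1/4" g 0] g True by (simp add: defect_def)
  next
    case False
    have "(sqrt (defect z) / 4) ^ (2 * m) = ((sqrt (defect z) / 4)\<^sup>2) ^ m" by (rule power_mult)
    also have "\<dots> = (defect z / 16) ^ m" using d by (simp add: power_divide)
    finally have "(defect z / 4)\<^sup>2 * (sqrt (defect z) / 4) ^ (2 * (CARD('n) - 1)) = (1/16) ^ CARD('n) * defect z ^ (CARD('n) + 1)"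
      by (simp add: m power_divide power2_eq_square)
    then show ?thesis
      using nn_integral_aniso[OF False, of "defect z / 4" "sqrt (defect z) / 4" g z] d g
      by (simp add: chart_def)
  qed
qed

text \<open>In the numerator of the involution the tangential part carries an extra factor sqrt (d
  z). It turns the tangential scale sqrt (d z) / 4 of the chart into d z / 4, the same as the normal
  one.\<close>

lemma pdist_chart:
  assumes z: "z \<in> ball 0 1"
  shows "pdist z (chart z u) = defect z / 4 * norm u"
proof -
  have d: "defect z > 0" using defect_pos[OF z] .
  have "(norm (Phi_num z (chart z u)))\<^sup>2 = (defect z / 4)\<^sup>2 * (norm u)\<^sup>2"
  proof -
    have s: "\<bar>defect z / 4\<bar>\<^sup>2 = defect z * defect z / 16" "\<bar>sqrt (defect z) / 4\<bar>\<^sup>2 = defect z / 16"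
      using d by (simp_all add: power_divide power2_eq_square)
    have "(norm (Phi_num z (chart z u)))\<^sup>2 = defect z * defect z / 16 * (norm (proj_line z u))\<^sup>2
        + defect z * (defect z / 16 * (norm (proj_perp z u))\<^sup>2)"
      unfolding chart_def norm_Phi_num_add_sq[OF z] proj_aniso norm_scaleR power_mult_distrib s ..
    also have "\<dots> = defect z * defect z / 16 * (norm u)\<^sup>2"
      unfolding norm_proj_sq[of u z] by (simp add: distrib_left)
    finally show ?thesis by (simp add: power_divide power2_eq_square)
  qed
  then have "(norm (Phi_num z (chart z u)))\<^sup>2 = (defect z / 4 * norm u)\<^sup>2" by (simp only: power_mult_distrib)
  then have "norm (Phi_num z (chart z u)) = defect z / 4 * norm u"
    by (rule power2_eq_imp_eq) (use d in simp_all)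
  then show ?thesis by (simp only: pdist_eq[OF z])
qed

lemma chart_zero: "chart z 0 = z"
  by (simp add: chart_def linear_0[OF linear_aniso])

text \<open>The displacement A satisfies |A|^2 <= d(z) / 16 and |<A,z>| <= d(z) / 4. Hence the
  defect changes by at most 1/16 + 1/2 of itself downwards and 1/2 upwards, and 1 - <z + A, z> =
  d(z) - <A,z>. The quarter scale keeps the lower factor 7/16 positive.\<close>

lemma chart_bounds:
  assumes z: "z \<in> ball 0 1" and u: "norm u < 1"
  shows "chart z u \<in> ball 0 1"
    and "7/16 * defect z \<le> defect (chart z u)" and "defect (chart z u) \<le> 3/2 * defect z"
    and "kdist z (chart z u) \<le> 5/4 * defect z"
proof -
  have d: "defect z > 0" "defect z \<le> 1" using defect_pos[OF z] defect_le_1[of z] by simp_all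
  let ?A = "aniso (defect z / 4) (sqrt (defect z) / 4) z u"
  have "(norm ?A)\<^sup>2 = (defect z / 4)\<^sup>2 * (norm (proj_line z u))\<^sup>2 + (sqrt (defect z) / 4)\<^sup>2 * (norm (proj_perp z u))\<^sup>2"
    by (rule norm_aniso_sq)
  also have "(sqrt (defect z) / 4)\<^sup>2 = defect z / 16" using d by (simp add: power_divide)
  also have "(defect z / 4)\<^sup>2 * (norm (proj_line z u))\<^sup>2 \<le> defect z / 16 * (norm (proj_line z u))\<^sup>2"
    using d by (intro mult_right_mono) (auto simp: power2_eq_square mult_left_le)
  also have "defect z / 16 * (norm (proj_line z u))\<^sup>2 + defect z / 16 * (norm (proj_perp z u))\<^sup>2 = defect z / 16 * (norm u)\<^sup>2"
    by (simp add: norm_proj_sq[of u z] distrib_left)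
  also have "\<dots> \<le> defect z / 16 * 1"
    using u d by (intro mult_left_mono) (auto simp: power_le_one)
  finally have A2: "(norm ?A)\<^sup>2 \<le> defect z / 16" by simp
  have "hinner ?A z = of_real (defect z / 4) * hinner u z"
    by (simp add: aniso_def hinner_simps hinner_proj_line hinner_proj_perp)
  then have "norm (hinner ?A z) = norm (complex_of_real (defect z / 4) * hinner u z)" by (simp only:)
  also have "\<dots> = defect z / 4 * norm (hinner u z)"
    unfolding norm_mult norm_of_real using d by simp
  also have "norm (hinner u z) \<le> 1"
    using norm_hinner_le[of u z] mult_mono[of "norm u" 1 "norm z" 1] u z by simp
  then have "defect z / 4 * norm (hinner u z) \<le> defect z / 4" using d by (simp add: mult_left_le)
  finally have h: "norm (hinner ?A z) \<le> defect z / 4" .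
  then have "\<bar>Re (hinner z ?A)\<bar> \<le> defect z / 4"
    using abs_Re_le_cmod[of "hinner z ?A"] norm_hinner_commute[of z ?A] by linarith
  moreover have "defect (chart z u) = defect z - (norm ?A)\<^sup>2 - 2 * Re (hinner z ?A)"
    unfolding chart_def defect_def[of "z + _"] norm_add_sq by (simp add: defect_def)
  ultimately show b: "7/16 * defect z \<le> defect (chart z u)" and "defect (chart z u) \<le> 3/2 * defect z"
    using A2 zero_le_power2[of "norm ?A"] by linarith+
  have "0 < defect (chart z u)" using b d by linarith
  then have "(norm (chart z u))\<^sup>2 < 1\<^sup>2" by (simp add: defect_def)
  then have "norm (chart z u) < 1" by (rule power2_less_imp_less) simp
  then show "chart z u \<in> ball 0 1" by simp
  have "1 - hinner (chart z u) z = of_real (defect z) - hinner ?A z"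
    by (simp add: chart_def hinner_simps hinner_self defect_def)
  then have "kdist z (chart z u) = norm (complex_of_real (defect z) - hinner ?A z)"
    unfolding kdist_commute[of z] by (simp only: kdist_def)
  also have "\<dots> \<le> norm (complex_of_real (defect z)) + norm (hinner ?A z)" by (rule norm_triangle_ineq4)
  finally show "kdist z (chart z u) \<le> 5/4 * defect z" using h d by simp
qed

text \<open>By pdist^2 = k^2 - d(z) d(w), either k^2 <= 2 pdist^2, or k^2 < 2 d(z) d(w) <= 4 d(z) k,
  so that k < 4 d(z) <= 32 pdist by the distance assumption.\<close>

lemma kdist_le_pdist:
  assumes z: "z \<in> ball 0 1" and w: "w \<in> ball 0 1" and far: "defect z / 8 \<le> pdist z w"
  shows "kdist z w \<le> 32 * pdist z w"
proof -
  have k: "kdist z w > 0" using kdist_pos[OF z w] .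
  have d: "defect z > 0" "defect w > 0" using defect_pos[OF z] defect_pos[OF w] by simp_all
  have p: "pdist z w \<ge> 0" unfolding pdist_eq[OF z, symmetric] by (rule norm_ge_zero)
  have p2: "(pdist z w)\<^sup>2 = (kdist z w)\<^sup>2 - defect z * defect w"
    using norm_Phi_num_sq[OF z, of w] unfolding pdist_eq[OF z] kdist_commute[of w z] mult.commute[of "defect w" "defect z"] .
  show ?thesis
  proof (cases "defect z * defect w \<le> (kdist z w)\<^sup>2 / 2")
    case True
    have "(kdist z w)\<^sup>2 \<le> 1024 * (pdist z w)\<^sup>2"
      using True p2 zero_le_power2[of "pdist z w"] by linarith
    also have "\<dots> = (32 * pdist z w)\<^sup>2" by (simp only: power_mult_distrib) simp
    finally show ?thesis by (rule power2_le_imp_le) (use p in simp)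
  next
    case False
    have "defect z * defect w \<le> defect z * (2 * kdist z w)"
      using defect_le_kdist'[OF z w] d by (intro mult_left_mono) auto
    then have "kdist z w * kdist z w < (4 * defect z) * kdist z w"
      using False unfolding power2_eq_square by linarith
    then have "kdist z w < 4 * defect z"
      using k by (simp only: mult_less_cancel_right_pos)
    then show ?thesis using far by linarith
  qed
qed

lemma norm_diff_powr_le:
  fixes a b :: complex
  assumes "p > 0"
  shows "norm (a - b) powr p \<le> 2 powr p * (norm a powr p + norm b powr p)"
proof -
  define m where "m = max (norm a) (norm b)"
  have m: "norm a \<le> m" "norm b \<le> m" "0 \<le> m" by (simp_all add: m_def le_max_iff_disj)
  have "norm (a - b) \<le> 2 * m" using norm_triangle_ineq4[of a b] m by linarith
  then have "norm (a - b) powr p \<le> (2 * m) powr p"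
    using assms by (intro powr_mono2) simp_all
  also have "\<dots> = 2 powr p * m powr p" using m(3) by (intro powr_mult)
  also have "\<dots> \<le> 2 powr p * (norm a powr p + norm b powr p)"
    unfolding m_def max_def by (intro mult_left_mono) simp_all
  finally show ?thesis .
qed

lemma chart_measurable [measurable]: "chart z \<in> borel_measurable borel"
proof -
  have [measurable]: "aniso (defect z / 4) (sqrt (defect z) / 4) z \<in> borel_measurable borel"
    by (rule borel_measurable_linear[OF linear_aniso])
  show ?thesis unfolding chart_def[abs_def] by measurable
qed

text \<open>Far from z the kernels \<open>pker\<close> and \<open>bker\<close> are comparable and
  the difference is simply split. Near z the function is pulled back by the chart and Cauchy's
  estimate is used, its integral over the whole chart being controlled by the integral of |f w|^p
  against \<open>bker\<close>.\<close>

lemma difference_integral_le: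
  fixes t \<alpha> p :: real
  assumes t: "t = real CARD('n) + 1 + \<alpha>" "t > 0" and p: "p > 1" "p \<ge> 2 * t"
  shows "\<exists>C>0. \<forall>f :: complex ^ 'n \<Rightarrow> complex. f \<in> borel_measurable borel \<longrightarrow> holomorphic_Cn_on f (ball 0 1) \<longrightarrow>
    (\<forall>z \<in> ball 0 1. (\<integral>\<^sup>+ w. ennreal (norm (f z - f w) powr p * pker t \<alpha> z w) * indicator (ball 0 1) w \<partial>lborel)
      \<le> ennreal C * (\<integral>\<^sup>+ w. ennreal ((norm (f z) powr p + norm (f w) powr p) * bker t \<alpha> z w) * indicator (ball 0 1) w \<partial>lborel))"
proof -
  let ?n = "CARD('n)"
  obtain C0 where C0p: "C0 > 0" and C0q: "\<forall>g :: complex ^ 'n \<Rightarrow> complex. holomorphic_Cn_on g (ball 0 1) \<longrightarrow> (\<forall>u. norm u \<le> 1/2 \<longrightarrow>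
    ennreal (norm (g u - g 0) powr p)
      \<le> ennreal (C0 * norm u powr p) * (\<integral>\<^sup>+ w. ennreal (norm (g w) powr p) * indicator (ball 0 1) w \<partial>lborel))"
    using cauchy_estimate_powr[OF p(1), where 'n='n] by (elim exE conjE)
  note C0 = C0p C0q[rule_format]
  define Mx where "Mx = max ((7/16) powr \<alpha>) ((3/2) powr \<alpha>)"
  define Mn where "Mn = min ((7/16) powr \<alpha>) ((3/2) powr \<alpha>)"
  have Mx: "Mx > 0" and Mn: "Mn > 0" by (simp_all add: Mx_def Mn_def less_max_iff_disj)
  define V where "V = measure lborel (ball (0 :: complex ^ 'n) (1/2))"
  have V: "V > 0" unfolding V_def by (simp add: content_ball_pos)
  have eV: "emeasure lborel (ball (0 :: complex ^ 'n) (1/2)) = ennreal V"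
    unfolding V_def using emeasure_lborel_ball_finite[of "0::complex ^ 'n" "1/2"]
    by (intro emeasure_eq_ennreal_measure) simp
  define c16 where "c16 = (1/16::real) ^ ?n"
  have c16: "c16 > 0" by (simp add: c16_def)
  define B where "B = (5/4) powr (2 * t) / Mn"
  have B: "B > 0" using Mn by (simp add: B_def)
  define Cn where "Cn = c16 * Mx * 4 powr (2 * t) * C0 * V * (B / c16)"
  define Cf where "Cf = 2 powr p * 32 powr (2 * t)"
  have Cn: "Cn > 0" and Cf: "Cf > 0" using c16 Mx C0 V B by (simp_all add: Cn_def Cf_def)
  show ?thesis
  proof (intro exI[of _ "Cn + Cf"] conjI allI impI ballI)
    fix f :: "complex ^ 'n \<Rightarrow> complex" and z :: "complex ^ 'n"
    assume fm [measurable]: "f \<in> borel_measurable borel" and f: "holomorphic_Cn_on f (ball 0 1)" and z: "z \<in> ball 0 1"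
    define \<delta> where "\<delta> = defect z"
    have \<delta>: "\<delta> > 0" using defect_pos[OF z] by (simp add: \<delta>_def)
    \<comment> \<open>In the chart this is |u| < 1/2, the range of the Cauchy estimate.\<close>
    define N where "N = {w \<in> ball 0 1. pdist z w < \<delta> / 8}"
    have N [measurable]: "N \<in> sets borel"
    proof -
      have "N = ball 0 1 \<inter> {w \<in> space borel. pdist z w < \<delta> / 8}" by (auto simp: N_def)
      also have "\<dots> \<in> sets borel" by (rule sets.Int) (simp, measurable)
      finally show ?thesis .
    qed
    define R where "R = (\<integral>\<^sup>+ w. ennreal (norm (f w) powr p * bker t \<alpha> z w) * indicator (ball 0 1) w \<partial>lborel)"
    define g where "g u = f (chart z u)" for u
    have g: "holomorphic_Cn_on g (ball 0 1)"
      unfolding g_def chart_def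
      by (rule holomorphic_Cn_on_aniso[OF f]) (use chart_bounds(1)[OF z] in \<open>simp add: chart_def\<close>)
    define I where "I = (\<integral>\<^sup>+ w. ennreal (norm (g w) powr p) * indicator (ball 0 1) w \<partial>lborel)"
    \<comment> \<open>The Jacobian and the kernel are exactly balanced: n + 1 + (t + \<alpha> - 2t)
      = 0 by the choice of t, so all constants are independent of z.\<close>
    have \<delta>n: "\<delta> ^ (?n + 1) * \<delta> powr (t + \<alpha> - 2 * t) = 1"
    proof -
      have "\<delta> ^ (?n + 1) = \<delta> powr (real ?n + 1)" using \<delta> powr_realpow[of \<delta> "?n + 1"] by (simp add: add.commute)
      then show ?thesis using \<delta> by (simp add: powr_add[symmetric] t(1))
    qed
    \<comment> \<open>On the chart image all defects and the quasi-distance to z are of order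
      \<delta>, so \<open>bker\<close> is at least a multiple of \<delta>^(-n-1), the reciprocal of
      the Jacobian.\<close>
    have I_le: "I \<le> ennreal (B / c16) * R"
    proof -
      have low: "1 \<le> B * \<delta> ^ (?n + 1) * bker t \<alpha> z (chart z u)" if u: "norm u < 1" for u
      proof -
        note cb = chart_bounds[OF z u, folded \<delta>_def]
        have 1: "Mn * \<delta> powr \<alpha> \<le> defect (chart z u) powr \<alpha>"
          unfolding Mn_def by (rule powr_sandwich(2)[OF _ \<delta> cb(2,3)]) simp
        have 2: "(5/4 * \<delta>) powr (- 2 * t) \<le> kdist z (chart z u) powr (- 2 * t)"
          using cb(4) kdist_pos[OF z cb(1)] t by (intro powr_mono2') auto
        have e1: "B * Mn * (5/4) powr (- 2 * t) = 1"
          using Mn by (simp add: B_def powr_minus)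
        have e2: "\<delta> powr (t + \<alpha> - 2 * t) = \<delta> powr t * \<delta> powr \<alpha> * \<delta> powr (- 2 * t)"
          by (simp add: powr_add[symmetric])
        have e3: "(5/4 * \<delta>) powr (- 2 * t) = (5/4) powr (- 2 * t) * \<delta> powr (- 2 * t)"
          using \<delta> by (intro powr_mult)
        have "1 = (B * Mn * (5/4) powr (- 2 * t)) * (\<delta> ^ (?n + 1) * \<delta> powr (t + \<alpha> - 2 * t))"
          unfolding e1 \<delta>n by simp
        also have "\<dots> = B * \<delta> ^ (?n + 1) * (\<delta> powr t * (Mn * \<delta> powr \<alpha>) * (5/4 * \<delta>) powr (- 2 * t))"
          unfolding e2 e3 by (simp only: mult_ac)
        also have "\<dots> \<le> B * \<delta> ^ (?n + 1) * (\<delta> powr t * defect (chart z u) powr \<alpha> * kdist z (chart z u) powr (- 2 * t))"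
          using B \<delta> Mn by (intro mult_left_mono mult_mono 1 2) auto
        finally show ?thesis by (simp add: bker_def \<delta>_def)
      qed
      have "I \<le> (\<integral>\<^sup>+ u. ennreal (B * \<delta> ^ (?n + 1)) * (ennreal (norm (f (chart z u)) powr p * bker t \<alpha> z (chart z u)) * indicator (ball 0 1) (chart z u)) \<partial>lborel)"
        unfolding I_def
      proof (rule nn_integral_mono)
        fix u :: "complex ^ 'n"
        show "ennreal (norm (g u) powr p) * indicator (ball 0 1) u
          \<le> ennreal (B * \<delta> ^ (?n + 1)) * (ennreal (norm (f (chart z u)) powr p * bker t \<alpha> z (chart z u)) * indicator (ball 0 1) (chart z u))"
        proof (cases "norm u < 1")
          case True
          have "norm (g u) powr p * 1 \<le> norm (g u) powr p * (B * \<delta> ^ (?n + 1) * bker t \<alpha> z (chart z u))"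
            using low[OF True] by (intro mult_left_mono) auto
          then have "norm (g u) powr p \<le> B * \<delta> ^ (?n + 1) * (norm (f (chart z u)) powr p * bker t \<alpha> z (chart z u))"
            by (simp add: g_def mult_ac)
          then show ?thesis
            using True chart_bounds(1)[OF z True] B \<delta> by (simp add: ennreal_mult'[symmetric] ennreal_leI)
        qed simp
      qed
      also have "\<dots> = ennreal (B * \<delta> ^ (?n + 1)) * (\<integral>\<^sup>+ u. ennreal (norm (f (chart z u)) powr p * bker t \<alpha> z (chart z u)) * indicator (ball 0 1) (chart z u) \<partial>lborel)"
        by (rule nn_integral_cmult) measurable
      also have "\<dots> = ennreal (B / c16) * (ennreal (c16 * \<delta> ^ (?n + 1)) * (\<integral>\<^sup>+ u. ennreal (norm (f (chart z u)) powr p * bker t \<alpha> z (chart z u)) * indicator (ball 0 1) (chart z u) \<partial>lborel))"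
        using B c16 \<delta> by (simp add: mult.assoc[symmetric] ennreal_mult'[symmetric])
      also have "\<dots> = ennreal (B / c16) * R"
      proof -
        have "R = ennreal (c16 * \<delta> ^ (?n + 1)) * (\<integral>\<^sup>+ u. ennreal (norm (f (chart z u)) powr p * bker t \<alpha> z (chart z u)) * indicator (ball 0 1) (chart z u) \<partial>lborel)"
          unfolding R_def c16_def \<delta>_def by (rule nn_integral_chart[OF z]) measurable
        then show ?thesis by simp
      qed
      finally show ?thesis .
    qed
    have near: "(\<integral>\<^sup>+ w. ennreal (norm (f z - f w) powr p * pker t \<alpha> z w) * indicator N w \<partial>lborel) \<le> ennreal Cn * R"
    proof -
      have "(\<integral>\<^sup>+ w. ennreal (norm (f z - f w) powr p * pker t \<alpha> z w) * indicator N w \<partial>lborel)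
        = ennreal (c16 * \<delta> ^ (?n + 1)) * (\<integral>\<^sup>+ u. ennreal (norm (f z - f (chart z u)) powr p * pker t \<alpha> z (chart z u)) * indicator N (chart z u) \<partial>lborel)"
        unfolding c16_def \<delta>_def by (rule nn_integral_chart[OF z]) measurable
      also have "\<dots> \<le> ennreal (c16 * \<delta> ^ (?n + 1)) *
          (\<integral>\<^sup>+ u. (ennreal (\<delta> powr (t + \<alpha> - 2 * t) * Mx * 4 powr (2 * t) * C0) * I) * indicator (ball (0 :: complex ^ 'n) (1/2)) u \<partial>lborel)"
      proof (intro mult_left_mono nn_integral_mono)
        fix u :: "complex ^ 'n"
        show "ennreal (norm (f z - f (chart z u)) powr p * pker t \<alpha> z (chart z u)) * indicator N (chart z u)
          \<le> (ennreal (\<delta> powr (t + \<alpha> - 2 * t) * Mx * 4 powr (2 * t) * C0) * I) * indicator (ball (0 :: complex ^ 'n) (1/2)) u"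
        proof (cases "chart z u \<in> N")
          case True
          then have u: "norm u < 1/2"
            using \<delta> by (simp add: N_def pdist_chart[OF z] \<delta>_def)
          then have u1: "norm u < 1" by simp
          note cb = chart_bounds[OF z u1, folded \<delta>_def]
          \<comment> \<open>This is where p >= 2t enters: the |u|^p of the Cauchy estimate absorbs
            the |u|^(-2t) of the kernel.\<close>
          have up: "norm u powr (p - 2 * t) \<le> 1"
            using p u by (intro powr_le1) auto
          have K: "pker t \<alpha> z (chart z u) \<le> \<delta> powr (t + \<alpha> - 2 * t) * Mx * 4 powr (2 * t) * norm u powr (- 2 * t)"
          proof -
            have "pker t \<alpha> z (chart z u) = \<delta> powr t * defect (chart z u) powr \<alpha> * (\<delta> / 4 * norm u) powr (- 2 * t)"
              by (simp add: pker_def pdist_chart[OF z] \<delta>_def)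
            also have "\<dots> \<le> \<delta> powr t * (Mx * \<delta> powr \<alpha>) * (\<delta> / 4 * norm u) powr (- 2 * t)"
              unfolding Mx_def using \<delta> cb by (intro mult_right_mono mult_left_mono powr_sandwich(1)) auto
            also have "(\<delta> / 4 * norm u) powr (- 2 * t) = \<delta> powr (- 2 * t) * 4 powr (2 * t) * norm u powr (- 2 * t)"
            proof -
              have "(\<delta> / 4 * norm u) powr (- 2 * t) = (\<delta> / 4) powr (- 2 * t) * norm u powr (- 2 * t)"
                using \<delta> by (intro powr_mult)
              also have "(\<delta> / 4) powr (- 2 * t) = \<delta> powr (- 2 * t) / 4 powr (- 2 * t)"
                using \<delta> by (intro powr_divide)
              also have "\<dots> = \<delta> powr (- 2 * t) * 4 powr (2 * t)" by (simp add: powr_minus field_simps)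
              finally show ?thesis .
            qed
            also have "\<delta> powr t * (Mx * \<delta> powr \<alpha>) * (\<delta> powr (- 2 * t) * 4 powr (2 * t) * norm u powr (- 2 * t))
              = (\<delta> powr t * \<delta> powr \<alpha> * \<delta> powr (- 2 * t)) * Mx * 4 powr (2 * t) * norm u powr (- 2 * t)"
              by (simp only: mult_ac)
            also have "\<delta> powr t * \<delta> powr \<alpha> * \<delta> powr (- 2 * t) = \<delta> powr (t + \<alpha> - 2 * t)"
              by (simp add: powr_add[symmetric])
            finally show ?thesis .
          qed
          have "ennreal (norm (f z - f (chart z u)) powr p * pker t \<alpha> z (chart z u))
            = ennreal (norm (g u - g 0) powr p) * ennreal (pker t \<alpha> z (chart z u))"
            by (simp add: g_def chart_zero norm_minus_commute ennreal_mult'' pker_nonneg)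
          also have "\<dots> \<le> (ennreal (C0 * norm u powr p) * I) * ennreal (\<delta> powr (t + \<alpha> - 2 * t) * Mx * 4 powr (2 * t) * norm u powr (- 2 * t))"
            unfolding I_def using u by (intro mult_mono C0(2) g ennreal_leI K) auto
          also have "\<dots> = ennreal (\<delta> powr (t + \<alpha> - 2 * t) * Mx * 4 powr (2 * t) * C0 * (norm u powr p * norm u powr (- 2 * t))) * I"
            using C0(1) Mx by (simp add: ennreal_mult mult_ac)
          also have "\<dots> \<le> ennreal (\<delta> powr (t + \<alpha> - 2 * t) * Mx * 4 powr (2 * t) * C0 * 1) * I"
          proof (intro mult_right_mono ennreal_leI mult_left_mono)
            have "norm u powr p * norm u powr (- 2 * t) = norm u powr (p - 2 * t)"
              by (simp add: powr_add[symmetric])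
            then show "norm u powr p * norm u powr (- 2 * t) \<le> 1" using up by simp
          qed (use C0(1) Mx in auto)
          finally show ?thesis using True u by simp
        qed simp
      qed simp
      also have "\<dots> = ennreal (c16 * \<delta> ^ (?n + 1)) * (ennreal (\<delta> powr (t + \<alpha> - 2 * t) * Mx * 4 powr (2 * t) * C0) * I * ennreal V)"
        by (simp add: nn_integral_cmult eV)
      also have "\<dots> = ennreal (c16 * (\<delta> ^ (?n + 1) * \<delta> powr (t + \<alpha> - 2 * t)) * Mx * 4 powr (2 * t) * C0 * V) * I"
        using c16 \<delta> Mx C0(1) V by (simp add: ennreal_mult mult_ac)
      also have "\<dots> \<le> ennreal (c16 * (\<delta> ^ (?n + 1) * \<delta> powr (t + \<alpha> - 2 * t)) * Mx * 4 powr (2 * t) * C0 * V) * (ennreal (B / c16) * R)"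
        by (intro mult_left_mono I_le) simp
      also have "\<dots> = ennreal Cn * R"
        unfolding \<delta>n Cn_def using c16 Mx C0(1) V B
        by (simp add: ennreal_mult'[symmetric] mult.assoc[symmetric])
      finally show ?thesis .
    qed
    let ?R' = "\<integral>\<^sup>+ w. ennreal ((norm (f z) powr p + norm (f w) powr p) * bker t \<alpha> z w) * indicator (ball 0 1) w \<partial>lborel"
    have RR: "R \<le> ?R'"
      unfolding R_def by (intro nn_integral_mono mult_right_mono ennreal_leI) (auto simp: bker_nonneg)
    have far: "(\<integral>\<^sup>+ w. ennreal (norm (f z - f w) powr p * pker t \<alpha> z w) * indicator (ball 0 1 - N) w \<partial>lborel) \<le> ennreal Cf * ?R'"
    proof -
      have "(\<integral>\<^sup>+ w. ennreal (norm (f z - f w) powr p * pker t \<alpha> z w) * indicator (ball 0 1 - N) w \<partial>lborel)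
        \<le> (\<integral>\<^sup>+ w. ennreal Cf * (ennreal ((norm (f z) powr p + norm (f w) powr p) * bker t \<alpha> z w) * indicator (ball 0 1) w) \<partial>lborel)"
      proof (rule nn_integral_mono)
        fix w :: "complex ^ 'n"
        show "ennreal (norm (f z - f w) powr p * pker t \<alpha> z w) * indicator (ball 0 1 - N) w
          \<le> ennreal Cf * (ennreal ((norm (f z) powr p + norm (f w) powr p) * bker t \<alpha> z w) * indicator (ball 0 1) w)"
        proof (cases "w \<in> ball 0 1 - N")
          case True
          then have w: "w \<in> ball 0 1" and fw: "defect z / 8 \<le> pdist z w" by (auto simp: N_def \<delta>_def)
          have k: "kdist z w > 0" using kdist_pos[OF z w] .
          have "pdist z w powr (- 2 * t) \<le> (kdist z w / 32) powr (- 2 * t)"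
            using kdist_le_pdist[OF z w fw] k t by (intro powr_mono2') auto
          also have "\<dots> = kdist z w powr (- 2 * t) / 32 powr (- 2 * t)" using k by (intro powr_divide)
          also have "\<dots> = 32 powr (2 * t) * kdist z w powr (- 2 * t)"
            by (simp add: powr_minus field_simps)
          finally have "pker t \<alpha> z w \<le> defect z powr t * defect w powr \<alpha> * (32 powr (2 * t) * kdist z w powr (- 2 * t))"
            unfolding pker_def by (intro mult_left_mono) auto
          then have "pker t \<alpha> z w \<le> 32 powr (2 * t) * bker t \<alpha> z w"
            by (simp add: bker_def mult_ac)
          then have "norm (f z - f w) powr p * pker t \<alpha> z w
            \<le> (2 powr p * (norm (f z) powr p + norm (f w) powr p)) * (32 powr (2 * t) * bker t \<alpha> z w)"
            using p by (intro mult_mono norm_diff_powr_le) (auto simp: pker_nonneg)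
          then have "norm (f z - f w) powr p * pker t \<alpha> z w \<le> Cf * ((norm (f z) powr p + norm (f w) powr p) * bker t \<alpha> z w)"
            by (simp add: Cf_def mult_ac)
          then show ?thesis using True Cf by (simp add: ennreal_mult'[symmetric] ennreal_leI)
        qed simp
      qed
      also have "\<dots> = ennreal Cf * ?R'" by (rule nn_integral_cmult) measurable
      finally show ?thesis .
    qed
    have "(\<integral>\<^sup>+ w. ennreal (norm (f z - f w) powr p * pker t \<alpha> z w) * indicator (ball 0 1) w \<partial>lborel)
      = (\<integral>\<^sup>+ w. ennreal (norm (f z - f w) powr p * pker t \<alpha> z w) * indicator N w
          + ennreal (norm (f z - f w) powr p * pker t \<alpha> z w) * indicator (ball 0 1 - N) w \<partial>lborel)"
      by (intro nn_integral_cong) (auto simp: N_def split: split_indicator)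
    also have "\<dots> = (\<integral>\<^sup>+ w. ennreal (norm (f z - f w) powr p * pker t \<alpha> z w) * indicator N w \<partial>lborel)
        + (\<integral>\<^sup>+ w. ennreal (norm (f z - f w) powr p * pker t \<alpha> z w) * indicator (ball 0 1 - N) w \<partial>lborel)"
      by (rule nn_integral_add) measurable
    also have "\<dots> \<le> ennreal Cn * ?R' + ennreal Cf * ?R'"
      by (intro add_mono far order_trans[OF near] mult_left_mono RR) simp
    also have "\<dots> = ennreal (Cn + Cf) * ?R'"
      using Cn Cf by (simp add: distrib_right)
    finally show "(\<integral>\<^sup>+ w. ennreal (norm (f z - f w) powr p * pker t \<alpha> z w) * indicator (ball 0 1) w \<partial>lborel)
      \<le> ennreal (Cn + Cf) * ?R'" .
  qed (use Cn Cf in simp)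
qed

section \<open>Bounding the difference form\<close>

text \<open>The Moebius weight \<open>(1 - |Phi_a z|^2)^\<sigma>\<close> without its factor \<open>(1 - |z|^2)^\<sigma>\<close>.\<close>

definition mweight :: "real \<Rightarrow> complex ^ 'n \<Rightarrow> complex ^ 'n \<Rightarrow> real" where
  "mweight \<sigma> a z = defect a powr \<sigma> * kdist z a powr (- 2 * \<sigma>)"

lemma mweight_nonneg: "mweight \<sigma> a z \<ge> 0"
  by (simp add: mweight_def)

lemma borel_measurable_mweight [measurable]: "mweight \<sigma> a \<in> borel_measurable borel"
  unfolding mweight_def[abs_def] by measurable

text \<open>The function F of the overview. It is \<open>ennreal\<close>-valued because convergence
  of the integral is not known beforehand.\<close>

definition diff_int :: "real \<Rightarrow> real \<Rightarrow> real \<Rightarrow> (complex ^ 'n \<Rightarrow> complex) \<Rightarrow> complex ^ 'n \<Rightarrow> ennreal" where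
  "diff_int t \<alpha> p f z = (\<integral>\<^sup>+ w. ennreal (norm (f z - f w) powr p * pker t \<alpha> z w) * indicator (ball 0 1) w \<partial>lborel)"

lemma borel_measurable_diff_int [measurable]:
  assumes [measurable]: "f \<in> borel_measurable borel"
  shows "diff_int t \<alpha> p f \<in> borel_measurable borel"
  unfolding diff_int_def[abs_def] by measurable

text \<open>The one-kernel estimate with exponent 2t produces d(z)^(n+1+\<alpha>-2t) = d(z)^(-t),
  which the factor d(z)^t of the kernel cancels.\<close>

lemma nn_integral_bker_le:
  assumes t: "t = real CARD('n) + 1 + \<alpha>" and \<alpha>: "\<alpha> > -1"
  shows "\<exists>C>0. \<forall>z :: complex ^ 'n \<in> ball 0 1. (\<integral>\<^sup>+ w. ennreal (bker t \<alpha> z w) * indicator (ball 0 1) w \<partial>lborel) \<le> ennreal C"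
proof -
  have e: "2 * t > real CARD('n) + 1 + \<alpha>" using t \<alpha> by simp
  obtain C where C: "C > 0" and C1: "\<forall>w\<in>ball 0 1.
    (\<integral>\<^sup>+ z. ennreal (defect z powr \<alpha> * kdist z (w :: complex ^ 'n) powr (- (2 * t))) * indicator (ball 0 1) z \<partial>lborel)
      \<le> ennreal (C * defect w powr (real CARD('n) + 1 + \<alpha> - 2 * t))"
    using nn_integral_kernel_le[OF \<alpha> e] by (elim exE conjE)
  show ?thesis
  proof (intro exI[of _ C] conjI C ballI)
    fix z :: "complex ^ 'n" assume z: "z \<in> ball 0 1"
    have d: "defect z > 0" using defect_pos[OF z] .
    have "(\<integral>\<^sup>+ w. ennreal (bker t \<alpha> z w) * indicator (ball 0 1) w \<partial>lborel)
      = (\<integral>\<^sup>+ w. ennreal (defect z powr t) * (ennreal (defect w powr \<alpha> * kdist w z powr (- (2 * t))) * indicator (ball 0 1) w) \<partial>lborel)"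
      unfolding bker_def kdist_commute[of z]
      by (intro nn_integral_cong) (simp add: ennreal_mult'[symmetric] mult_ac split: split_indicator)
    also have "\<dots> = ennreal (defect z powr t) * (\<integral>\<^sup>+ w. ennreal (defect w powr \<alpha> * kdist w z powr (- (2 * t))) * indicator (ball 0 1) w \<partial>lborel)"
      by (rule nn_integral_cmult) measurable
    also have "\<dots> \<le> ennreal (defect z powr t) * ennreal (C * defect z powr (real CARD('n) + 1 + \<alpha> - 2 * t))"
      by (intro mult_left_mono C1[rule_format] z) simp
    also have "\<dots> = ennreal (C * (defect z powr t * defect z powr (real CARD('n) + 1 + \<alpha> - 2 * t)))"
      using C by (simp add: ennreal_mult'[symmetric] mult_ac)
    also have "defect z powr t * defect z powr (real CARD('n) + 1 + \<alpha> - 2 * t) = 1"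
      using d by (simp add: powr_add[symmetric] t)
    finally show "(\<integral>\<^sup>+ w. ennreal (bker t \<alpha> z w) * indicator (ball 0 1) w \<partial>lborel) \<le> ennreal C" by simp
  qed
qed

text \<open>Integration over z returns the weight to the point w. The two-kernel estimate is used
  with x = t + \<beta>, A = 2t, B = 2\<sigma>; its condition A > n + 1 + x amounts to \<alpha> >
  \<beta>, and the resulting d(w)^(\<beta>-\<alpha>) combines with the factor d(w)^\<alpha>.\<close>

lemma nn_integral_bker_mweight_le:
  assumes t: "t = real CARD('n) + 1 + \<alpha>" and \<alpha>: "\<alpha> > -1" and \<beta>: "\<beta> > -1" "\<beta> < \<alpha>"
    and \<sigma>: "\<sigma> > 0" "2 * \<sigma> < real CARD('n) + 1 + t + \<beta>"
  shows "\<exists>C>0. \<forall>w :: complex ^ 'n \<in> ball 0 1. \<forall>a\<in>ball 0 1.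
    (\<integral>\<^sup>+ z. ennreal (bker t \<alpha> z w * (defect z powr \<beta> * mweight \<sigma> a z)) * indicator (ball 0 1) z \<partial>lborel)
      \<le> ennreal (C * (defect w powr \<beta> * mweight \<sigma> a w))"
proof -
  have h: "t + \<beta> > -1" "2 * t > real CARD('n) + 1 + (t + \<beta>)" "0 \<le> 2 * \<sigma>" "2 * \<sigma> < real CARD('n) + 1 + (t + \<beta>)"
    using assms by simp_all
  obtain C where C: "C > 0" and C1: "\<forall>w\<in>ball 0 1. \<forall>a\<in>ball 0 1.
    (\<integral>\<^sup>+ z. ennreal (defect z powr (t + \<beta>) * kdist z w powr (- (2 * t)) * kdist z (a :: complex ^ 'n) powr (- (2 * \<sigma>)))
        * indicator (ball 0 1) z \<partial>lborel)
      \<le> ennreal (C * (defect w powr (real CARD('n) + 1 + (t + \<beta>) - 2 * t) * kdist w a powr (- (2 * \<sigma>))))"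
    using nn_integral_two_kernels_le[OF h] by (elim exE conjE)
  show ?thesis
  proof (intro exI[of _ C] conjI C ballI)
    fix w a :: "complex ^ 'n" assume w: "w \<in> ball 0 1" and a: "a \<in> ball 0 1"
    have "(\<integral>\<^sup>+ z. ennreal (bker t \<alpha> z w * (defect z powr \<beta> * mweight \<sigma> a z)) * indicator (ball 0 1) z \<partial>lborel)
      = (\<integral>\<^sup>+ z. ennreal (defect w powr \<alpha> * defect a powr \<sigma>) * (ennreal (defect z powr (t + \<beta>) * kdist z w powr (- (2 * t)) * kdist z a powr (- (2 * \<sigma>)))
        * indicator (ball 0 1) z) \<partial>lborel)"
      unfolding bker_def mweight_def
      by (intro nn_integral_cong) (simp add: ennreal_mult'[symmetric] powr_add mult_ac split: split_indicator)
    also have "\<dots> = ennreal (defect w powr \<alpha> * defect a powr \<sigma>) * (\<integral>\<^sup>+ z. ennreal (defect z powr (t + \<beta>) * kdist z w powr (- (2 * t)) * kdist z a powr (- (2 * \<sigma>)))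
        * indicator (ball 0 1) z \<partial>lborel)"
      by (rule nn_integral_cmult) measurable
    also have "\<dots> \<le> ennreal (defect w powr \<alpha> * defect a powr \<sigma>) *
        ennreal (C * (defect w powr (real CARD('n) + 1 + (t + \<beta>) - 2 * t) * kdist w a powr (- (2 * \<sigma>))))"
      by (intro mult_left_mono C1[rule_format] w a) simp
    also have "\<dots> = ennreal (C * ((defect w powr \<alpha> * defect w powr (real CARD('n) + 1 + (t + \<beta>) - 2 * t)) * mweight \<sigma> a w))"
      using C by (simp add: ennreal_mult'[symmetric] mweight_def mult_ac)
    also have "defect w powr \<alpha> * defect w powr (real CARD('n) + 1 + (t + \<beta>) - 2 * t) = defect w powr \<beta>"
      by (simp add: powr_add[symmetric] t)
    finally show "(\<integral>\<^sup>+ z. ennreal (bker t \<alpha> z w * (defect z powr \<beta> * mweight \<sigma> a z)) * indicator (ball 0 1) z \<partial>lborel)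
      \<le> ennreal (C * (defect w powr \<beta> * mweight \<sigma> a w))" .
  qed
qed

text \<open>In the term with |f z|^p the variable w is integrated first and \<open>bker\<close> has
  bounded mass. In the term with |f w|^p the order is exchanged and z is integrated first, which
  reproduces the weight at w.\<close>

proposition difference_form_le:
  fixes t \<alpha> \<beta> \<sigma> p :: real
  assumes t: "t = real CARD('n) + 1 + \<alpha>" and \<alpha>: "\<alpha> > -1" and \<beta>: "\<beta> > -1" "\<beta> < \<alpha>"
    and \<sigma>: "\<sigma> > 0" "2 * \<sigma> < real CARD('n) + 1 + t + \<beta>" and p: "p > 1" "p \<ge> 2 * t"
  shows "\<exists>C>0. \<forall>f :: complex ^ 'n \<Rightarrow> complex. f \<in> borel_measurable borel \<longrightarrow> holomorphic_Cn_on f (ball 0 1) \<longrightarrow>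
    (\<forall>a \<in> ball 0 1. (\<integral>\<^sup>+ z. diff_int t \<alpha> p f z * ennreal (defect z powr \<beta> * mweight \<sigma> a z) * indicator (ball 0 1) z \<partial>lborel)
      \<le> ennreal C * (\<integral>\<^sup>+ z. ennreal (norm (f z) powr p * (defect z powr \<beta> * mweight \<sigma> a z)) * indicator (ball 0 1) z \<partial>lborel))"
proof -
  have t0: "t > 0" using t \<alpha> by simp
  obtain C1 where C1: "C1 > 0" and C1': "\<forall>f :: complex ^ 'n \<Rightarrow> complex. f \<in> borel_measurable borel \<longrightarrow> holomorphic_Cn_on f (ball 0 1) \<longrightarrow>
    (\<forall>z \<in> ball 0 1. (\<integral>\<^sup>+ w. ennreal (norm (f z - f w) powr p * pker t \<alpha> z w) * indicator (ball 0 1) w \<partial>lborel)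
      \<le> ennreal C1 * (\<integral>\<^sup>+ w. ennreal ((norm (f z) powr p + norm (f w) powr p) * bker t \<alpha> z w) * indicator (ball 0 1) w \<partial>lborel))"
    using difference_integral_le[OF t t0 p] by (elim exE conjE)
  obtain C2 where C2: "C2 > 0" and C2': "\<forall>z :: complex ^ 'n \<in> ball 0 1.
      (\<integral>\<^sup>+ w. ennreal (bker t \<alpha> z w) * indicator (ball 0 1) w \<partial>lborel) \<le> ennreal C2"
    using nn_integral_bker_le[OF t \<alpha>] by (elim exE conjE)
  obtain C3 where C3: "C3 > 0" and C3': "\<forall>w :: complex ^ 'n \<in> ball 0 1. \<forall>a\<in>ball 0 1.
    (\<integral>\<^sup>+ z. ennreal (bker t \<alpha> z w * (defect z powr \<beta> * mweight \<sigma> a z)) * indicator (ball 0 1) z \<partial>lborel)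
      \<le> ennreal (C3 * (defect w powr \<beta> * mweight \<sigma> a w))"
    using nn_integral_bker_mweight_le[OF t \<alpha> \<beta> \<sigma>] by (elim exE conjE)
  show ?thesis
  proof (intro exI[of _ "C1 * (C2 + C3)"] conjI allI impI ballI)
    fix f :: "complex ^ 'n \<Rightarrow> complex" and a :: "complex ^ 'n"
    assume f [measurable]: "f \<in> borel_measurable borel" and hf: "holomorphic_Cn_on f (ball 0 1)" and a: "a \<in> ball 0 1"
    define B where "B = (indicator (ball 0 1) :: complex ^ 'n \<Rightarrow> ennreal)"
    have [measurable]: "B \<in> borel_measurable borel" by (simp add: B_def borel_measurable_indicator)
    have B: "B z = 0 \<or> (B z = 1 \<and> z \<in> ball 0 1)" for z by (simp add: B_def indicator_def)
    define P where "P z = ennreal (norm (f z) powr p)" for z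
    define m where "m z = ennreal (defect z powr \<beta> * mweight \<sigma> a z)" for z
    let ?k = "\<lambda>z w :: complex ^ 'n. ennreal (bker t \<alpha> z w)"
    have [measurable]: "P \<in> borel_measurable borel" "m \<in> borel_measurable borel"
      unfolding P_def[abs_def] m_def[abs_def] by measurable
    have P: "ennreal (norm (f z) powr p * (defect z powr \<beta> * mweight \<sigma> a z)) = P z * m z" for z
      by (simp add: P_def m_def ennreal_mult mweight_nonneg)
    define Na where "Na = (\<integral>\<^sup>+ z. P z * m z * B z \<partial>lborel)"
    have "(\<integral>\<^sup>+ z. (\<integral>\<^sup>+ w. P w * B w * (?k z w * m z * B z) \<partial>lborel) \<partial>lborel)
        = (\<integral>\<^sup>+ w. (\<integral>\<^sup>+ z. P w * B w * (?k z w * m z * B z) \<partial>lborel) \<partial>lborel)"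
      by (rule lborel_pair.Fubini') measurable
    also have "\<dots> \<le> (\<integral>\<^sup>+ w. ennreal C3 * (P w * m w * B w) \<partial>lborel)"
    proof (rule nn_integral_mono)
      fix w
      have "(\<integral>\<^sup>+ z. P w * B w * (?k z w * m z * B z) \<partial>lborel) = P w * B w * (\<integral>\<^sup>+ z. ?k z w * m z * B z \<partial>lborel)"
        by (rule nn_integral_cmult) measurable
      also have "\<dots> \<le> P w * B w * (ennreal C3 * m w)"
      proof (cases "w \<in> ball 0 1")
        case True
        have "(\<integral>\<^sup>+ z. ?k z w * m z * B z \<partial>lborel) \<le> ennreal C3 * m w"
          using C3'[rule_format, OF True a] C3
          by (simp add: m_def B_def ennreal_mult' bker_nonneg)
        then show ?thesis by (intro mult_left_mono) simp_all
      qed (simp add: B_def)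
      finally show "(\<integral>\<^sup>+ z. P w * B w * (?k z w * m z * B z) \<partial>lborel) \<le> ennreal C3 * (P w * m w * B w)"
        by (simp add: mult_ac)
    qed
    also have "\<dots> = ennreal C3 * Na"
      unfolding Na_def by (rule nn_integral_cmult) measurable
    finally have s2: "(\<integral>\<^sup>+ z. (\<integral>\<^sup>+ w. P w * B w * (?k z w * m z * B z) \<partial>lborel) \<partial>lborel) \<le> ennreal C3 * Na" .
    have "(\<integral>\<^sup>+ z. (\<integral>\<^sup>+ w. P z * m z * B z * (?k z w * B w) \<partial>lborel) \<partial>lborel) \<le> (\<integral>\<^sup>+ z. ennreal C2 * (P z * m z * B z) \<partial>lborel)"
    proof (rule nn_integral_mono)
      fix z
      have "(\<integral>\<^sup>+ w. P z * m z * B z * (?k z w * B w) \<partial>lborel) = P z * m z * B z * (\<integral>\<^sup>+ w. ?k z w * B w \<partial>lborel)"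
        by (rule nn_integral_cmult) measurable
      also have "\<dots> \<le> P z * m z * B z * ennreal C2"
      proof (cases "z \<in> ball 0 1")
        case True
        then show ?thesis using C2'[rule_format, OF True]
          by (intro mult_left_mono) (simp_all add: B_def)
      qed (simp add: B_def)
      finally show "(\<integral>\<^sup>+ w. P z * m z * B z * (?k z w * B w) \<partial>lborel) \<le> ennreal C2 * (P z * m z * B z)"
        by (simp add: mult_ac)
    qed
    also have "\<dots> = ennreal C2 * Na"
      unfolding Na_def by (rule nn_integral_cmult) measurable
    finally have s1: "(\<integral>\<^sup>+ z. (\<integral>\<^sup>+ w. P z * m z * B z * (?k z w * B w) \<partial>lborel) \<partial>lborel) \<le> ennreal C2 * Na" .
    have "(\<integral>\<^sup>+ z. diff_int t \<alpha> p f z * m z * B z \<partial>lborel)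
      \<le> (\<integral>\<^sup>+ z. (\<integral>\<^sup>+ w. ennreal C1 * (P z * m z * B z * (?k z w * B w) + P w * B w * (?k z w * m z * B z)) \<partial>lborel) \<partial>lborel)"
    proof (rule nn_integral_mono)
      fix z
      show "diff_int t \<alpha> p f z * m z * B z
        \<le> (\<integral>\<^sup>+ w. ennreal C1 * (P z * m z * B z * (?k z w * B w) + P w * B w * (?k z w * m z * B z)) \<partial>lborel)"
      proof (cases "z \<in> ball 0 1")
        case True
        have "diff_int t \<alpha> p f z \<le> ennreal C1 * (\<integral>\<^sup>+ w. (P z + P w) * ?k z w * B w \<partial>lborel)"
          using C1'[rule_format, OF f hf True]
          by (simp add: diff_int_def P_def B_def ennreal_mult bker_nonneg)
        then have "diff_int t \<alpha> p f z * m z \<le> ennreal C1 * (\<integral>\<^sup>+ w. (P z + P w) * ?k z w * B w \<partial>lborel) * m z"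
          by (intro mult_right_mono) simp_all
        also have "\<dots> = (\<integral>\<^sup>+ w. ennreal C1 * ((P z + P w) * ?k z w * B w) * m z \<partial>lborel)"
          by (simp add: nn_integral_cmult nn_integral_multc)
        also have "\<dots> = (\<integral>\<^sup>+ w. ennreal C1 * (P z * m z * B z * (?k z w * B w) + P w * B w * (?k z w * m z * B z)) \<partial>lborel)"
          using True by (intro nn_integral_cong) (simp add: B_def distrib_left distrib_right mult_ac)
        finally show ?thesis using True by (simp add: B_def)
      qed (simp add: B_def)
    qed
    also have "\<dots> = ennreal C1 * ((\<integral>\<^sup>+ z. (\<integral>\<^sup>+ w. P z * m z * B z * (?k z w * B w) \<partial>lborel) \<partial>lborel)
        + (\<integral>\<^sup>+ z. (\<integral>\<^sup>+ w. P w * B w * (?k z w * m z * B z) \<partial>lborel) \<partial>lborel))"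
    proof -
      let ?X = "\<lambda>z w. P z * m z * B z * (?k z w * B w)"
      let ?Y = "\<lambda>z w. P w * B w * (?k z w * m z * B z)"
      have inner: "(\<integral>\<^sup>+ w. ennreal C1 * (?X z w + ?Y z w) \<partial>lborel)
        = ennreal C1 * ((\<integral>\<^sup>+ w. ?X z w \<partial>lborel) + (\<integral>\<^sup>+ w. ?Y z w \<partial>lborel))" for z
      proof -
        have "(\<integral>\<^sup>+ w. ennreal C1 * (?X z w + ?Y z w) \<partial>lborel) = ennreal C1 * (\<integral>\<^sup>+ w. ?X z w + ?Y z w \<partial>lborel)"
          by (rule nn_integral_cmult) measurable
        also have "(\<integral>\<^sup>+ w. ?X z w + ?Y z w \<partial>lborel) = (\<integral>\<^sup>+ w. ?X z w \<partial>lborel) + (\<integral>\<^sup>+ w. ?Y z w \<partial>lborel)"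
          by (rule nn_integral_add) measurable
        finally show ?thesis .
      qed
      have "(\<integral>\<^sup>+ z. (\<integral>\<^sup>+ w. ennreal C1 * (?X z w + ?Y z w) \<partial>lborel) \<partial>lborel)
        = ennreal C1 * (\<integral>\<^sup>+ z. (\<integral>\<^sup>+ w. ?X z w \<partial>lborel) + (\<integral>\<^sup>+ w. ?Y z w \<partial>lborel) \<partial>lborel)"
        unfolding inner by (rule nn_integral_cmult) measurable
      also have "(\<integral>\<^sup>+ z. (\<integral>\<^sup>+ w. ?X z w \<partial>lborel) + (\<integral>\<^sup>+ w. ?Y z w \<partial>lborel) \<partial>lborel)
        = (\<integral>\<^sup>+ z. (\<integral>\<^sup>+ w. ?X z w \<partial>lborel) \<partial>lborel) + (\<integral>\<^sup>+ z. (\<integral>\<^sup>+ w. ?Y z w \<partial>lborel) \<partial>lborel)"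
        by (rule nn_integral_add) measurable
      finally show ?thesis .
    qed
    also have "\<dots> \<le> ennreal C1 * (ennreal C2 * Na + ennreal C3 * Na)"
      by (intro mult_left_mono add_mono s1 s2) simp
    also have "ennreal C1 * (ennreal C2 * Na + ennreal C3 * Na) = ennreal (C1 * (C2 + C3)) * Na"
      using C1 C2 C3 by (simp add: ennreal_mult distrib_right distrib_left mult_ac)
    finally have "(\<integral>\<^sup>+ z. diff_int t \<alpha> p f z * m z * B z \<partial>lborel) \<le> ennreal (C1 * (C2 + C3)) * Na" .
    then show "(\<integral>\<^sup>+ z. diff_int t \<alpha> p f z * ennreal (defect z powr \<beta> * mweight \<sigma> a z) * indicator (ball 0 1) z \<partial>lborel)
      \<le> ennreal (C1 * (C2 + C3)) * (\<integral>\<^sup>+ z. ennreal (norm (f z) powr p * (defect z powr \<beta> * mweight \<sigma> a z)) * indicator (ball 0 1) z \<partial>lborel)"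
      unfolding P Na_def m_def[symmetric] B_def[symmetric] .
  qed (use C1 C2 C3 in simp)
qed

section \<open>Averages over higher points\<close>

text \<open>Points \<open>w\<close> lying over \<open>z\<close> at height \<open>h\<close>: averaging over them moves mass towards the
  centre of the ball.\<close>

definition upper_set :: "real \<Rightarrow> complex ^ 'n \<Rightarrow> (complex ^ 'n) set" where
  "upper_set h z = {w \<in> ball 0 1. h \<le> defect w \<and> kdist z w \<le> 4 * h}"

text \<open>As a product of indicators of half-lines composed with measurable functions, membership
  is jointly measurable in z and w even when the height depends on z. Fubini's theorem needs this
  for the height K d z.\<close>

lemma upper_set_indicator:
  "indicator (upper_set h z) w
    = (indicator (ball 0 1) w * indicator {0..} (defect w - h) * indicator {0..} (4 * h - kdist z w) :: ennreal)"
  by (simp add: upper_set_def indicator_def)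

lemma upper_set_sets [measurable]: "upper_set h z \<in> sets borel"
proof -
  have "upper_set h z = ball 0 1 \<inter> {w \<in> space borel. h \<le> defect w} \<inter> {w \<in> space borel. kdist z w \<le> 4 * h}"
    by (auto simp: upper_set_def)
  also have "\<dots> \<in> sets borel" by (intro sets.Int) (simp, measurable)
  finally show ?thesis .
qed

lemma borel_measurable_upper_set_indicator [measurable (raw)]:
  fixes f g :: "'b \<Rightarrow> complex ^ 'n"
  assumes [measurable]: "h \<in> borel_measurable M" "f \<in> borel_measurable M" "g \<in> borel_measurable M"
  shows "(\<lambda>x. indicator (upper_set (h x) (f x)) (g x) :: ennreal) \<in> borel_measurable M"
proof -
  have [measurable]: "(indicator (ball 0 1) :: complex ^ 'n \<Rightarrow> ennreal) \<in> borel_measurable borel"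
    "(indicator {0..} :: real \<Rightarrow> ennreal) \<in> borel_measurable borel"
    by (simp_all add: borel_measurable_indicator)
  show ?thesis unfolding upper_set_indicator by measurable
qed

text \<open>The centre lies on the radius through z at norm 1 - 2h, and the perturbation has |A|^2
  <= h/4. This leaves a defect of at least 7h/4; since 1 - |z| <= d(z) <= h, the quasi-distance to z
  is at most h + 2h + h/2.\<close>

lemma aniso_in_upper_set:
  assumes z: "z \<in> ball 0 1" "z \<noteq> 0" and h: "defect z \<le> h" "h \<le> 1/2" and u: "norm u < 1"
  shows "((1 - 2 * h) / norm z) *\<^sub>R z + aniso (h / 2) (sqrt h / 2) z u \<in> upper_set h z"
proof -
  define c where "c = ((1 - 2 * h) / norm z) *\<^sub>R z"
  define A where "A = aniso (h / 2) (sqrt h / 2) z u"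
  have d: "0 < defect z" using defect_pos[OF z(1)] .
  then have h0: "0 < h" using h by simp
  have nz: "norm z < 1" "norm z > 0" using z by simp_all
  have "(norm A)\<^sup>2 = (h / 2)\<^sup>2 * (norm (proj_line z u))\<^sup>2 + (sqrt h / 2)\<^sup>2 * (norm (proj_perp z u))\<^sup>2"
    unfolding A_def by (rule norm_aniso_sq)
  also have "(sqrt h / 2)\<^sup>2 = h / 4" using h0 by (simp add: power_divide)
  also have "(h / 2)\<^sup>2 * (norm (proj_line z u))\<^sup>2 \<le> h / 4 * (norm (proj_line z u))\<^sup>2"
    using h h0 by (intro mult_right_mono) (simp_all add: power2_eq_square mult_left_le)
  also have "h / 4 * (norm (proj_line z u))\<^sup>2 + h / 4 * (norm (proj_perp z u))\<^sup>2 = h / 4 * (norm u)\<^sup>2"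
    by (simp add: norm_proj_sq[of u z] distrib_left)
  also have "\<dots> \<le> h / 4 * 1"
    using u h0 by (intro mult_left_mono) (simp_all add: power_le_one)
  finally have A2: "(norm A)\<^sup>2 \<le> h / 4" by simp
  have Az: "hinner A z = of_real (h / 2) * hinner u z"
    by (simp add: A_def aniso_def hinner_simps hinner_proj_line hinner_proj_perp)
  have "norm (hinner A z) = norm (complex_of_real (h / 2) * hinner u z)" by (simp only: Az)
  also have "\<dots> = h / 2 * norm (hinner u z)" unfolding norm_mult norm_of_real using h0 by simp
  also have "\<dots> \<le> h / 2 * (1 * norm z)"
  proof (intro mult_left_mono order_trans[OF norm_hinner_le] mult_right_mono)
    show "norm u \<le> 1" "0 \<le> norm z" "0 \<le> h / 2" using u h0 by simp_all
  qed
  finally have hAz: "norm (hinner A z) \<le> h / 2 * norm z" by simp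
  have nc: "norm c = 1 - 2 * h" using nz h by (simp add: c_def)
  have "Re (hinner c A) = (1 - 2 * h) / norm z * Re (hinner z A)"
    by (simp add: c_def hinner_simps)
  also have "\<dots> \<le> (1 - 2 * h) / norm z * (h / 2 * norm z)"
  proof (rule mult_left_mono)
    have "Re (hinner z A) \<le> norm (hinner z A)" by (rule complex_Re_le_cmod)
    then show "Re (hinner z A) \<le> h / 2 * norm z" using hAz norm_hinner_commute[of z A] by linarith
    show "0 \<le> (1 - 2 * h) / norm z" using h nz by simp
  qed
  also have "\<dots> = (1 - 2 * h) * (h / 2)" using nz by simp
  finally have RcA: "Re (hinner c A) \<le> (1 - 2 * h) * (h / 2)" .
  have "(norm (c + A))\<^sup>2 \<le> (1 - 2 * h)\<^sup>2 + h / 4 + 2 * ((1 - 2 * h) * (h / 2))"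
    unfolding norm_add_sq nc using A2 RcA by linarith
  also have "\<dots> = 1 - 11 / 4 * h + 2 * (h * h)" by (simp add: power2_eq_square algebra_simps)
  also have "\<dots> \<le> 1 - 11 / 4 * h + h"
  proof -
    have "h * h \<le> h * (1/2)" by (rule mult_left_mono) (use h h0 in simp_all)
    then show ?thesis by linarith
  qed
  finally have n2: "(norm (c + A))\<^sup>2 \<le> 1 - 7 / 4 * h" by simp
  then have dw: "h \<le> defect (c + A)" using h0 by (simp add: defect_def)
  have "(norm (c + A))\<^sup>2 < 1\<^sup>2" using n2 h0 by simp
  then have nB: "norm (c + A) < 1" by (rule power2_less_imp_less) simp
  have "hinner c z = of_real ((1 - 2 * h) * norm z)"
    using nz by (simp add: c_def hinner_simps hinner_self power2_eq_square)
  then have e: "1 - hinner (c + A) z = of_real (1 - (1 - 2 * h) * norm z) - hinner A z"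
    by (simp add: hinner_simps)
  have "kdist z (c + A) = norm (complex_of_real (1 - (1 - 2 * h) * norm z) - hinner A z)"
    unfolding kdist_commute[of z "c + A"] by (simp only: kdist_def e)
  also have "\<dots> \<le> norm (complex_of_real (1 - (1 - 2 * h) * norm z)) + norm (hinner A z)"
    by (rule norm_triangle_ineq4)
  also have "norm (complex_of_real (1 - (1 - 2 * h) * norm z)) = 1 - (1 - 2 * h) * norm z"
    unfolding norm_of_real using mult_mono[of "1 - 2 * h" 1 "norm z" 1] h h0 nz by simp
  also have "\<dots> + norm (hinner A z) \<le> 4 * h"
  proof -
    have "1 - norm z \<le> defect z"
      using nz by (simp add: defect_def power2_eq_square mult_left_le)
    moreover have "h * norm z \<le> h" using nz h0 by (simp add: mult_left_le)
    moreover have "(1 - 2 * h) * norm z = norm z - 2 * (h * norm z)" by (simp add: algebra_simps)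
    moreover have "norm (hinner A z) \<le> (h * norm z) / 2" using hAz by simp
    ultimately show ?thesis using h h0 by linarith
  qed
  finally show ?thesis
    using dw nB by (simp add: upper_set_def c_def A_def)
qed

lemma emeasure_upper_set_ge:
  "\<exists>c>0. \<forall>z :: complex ^ 'n \<in> ball 0 1. \<forall>h. defect z \<le> h \<longrightarrow> h \<le> 1/2 \<longrightarrow>
     ennreal (c * h ^ (CARD('n) + 1)) \<le> emeasure lborel (upper_set h z)"
proof -
  define V where "V = measure lborel (ball (0 :: complex ^ 'n) 1)"
  have V: "V > 0" unfolding V_def by (simp add: content_ball_pos)
  have eV: "emeasure lborel (ball (0 :: complex ^ 'n) 1) = ennreal V"
    unfolding V_def using emeasure_lborel_ball_finite[of "0::complex ^ 'n" 1]
    by (intro emeasure_eq_ennreal_measure) simp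
  obtain m where m: "CARD('n) = Suc m" using zero_less_card_finite[where 'a='n] gr0_conv_Suc by blast
  show ?thesis
  proof (intro exI[of _ "(1/4) ^ CARD('n) * V"] conjI ballI allI impI)
    fix z :: "complex ^ 'n" and h :: real
    assume z: "z \<in> ball 0 1" and h: "defect z \<le> h" "h \<le> 1/2"
    have h0: "0 < h" using defect_pos[OF z] h by simp
    \<comment> \<open>At the origin the defect is 1, which exceeds h.\<close>
    have z0: "z \<noteq> 0" using h by (auto simp: defect_def)
    let ?c = "((1 - 2 * h) / norm z) *\<^sub>R z"
    have J: "(h / 2)\<^sup>2 * (sqrt h / 2) ^ (2 * (CARD('n) - 1)) = (1/4) ^ CARD('n) * h ^ (CARD('n) + 1)"
    proof -
      have "(sqrt h / 2) ^ (2 * m) = ((sqrt h / 2)\<^sup>2) ^ m" by (rule power_mult)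
      also have "\<dots> = (h / 4) ^ m" using h0 by (simp add: power_divide)
      finally show ?thesis by (simp add: m power_divide power2_eq_square)
    qed
    have "ennreal ((1/4) ^ CARD('n) * V * h ^ (CARD('n) + 1))
      = ennreal ((1/4) ^ CARD('n) * h ^ (CARD('n) + 1)) * (\<integral>\<^sup>+ u. indicator (ball (0 :: complex ^ 'n) 1) u \<partial>lborel)"
      using h0 V by (simp add: eV ennreal_mult'[symmetric] mult_ac)
    also have "\<dots> \<le> ennreal ((1/4) ^ CARD('n) * h ^ (CARD('n) + 1))
      * (\<integral>\<^sup>+ u. indicator (upper_set h z) (?c + aniso (h / 2) (sqrt h / 2) z u) \<partial>lborel)"
    proof (rule mult_left_mono[OF nn_integral_mono])
      fix u :: "complex ^ 'n"
      show "(indicator (ball 0 1) u :: ennreal) \<le> indicator (upper_set h z) (?c + aniso (h / 2) (sqrt h / 2) z u)"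
      proof (cases "norm u < 1")
        case True
        then show ?thesis using aniso_in_upper_set[OF z z0 h True] by simp
      qed simp
    qed simp
    also have "\<dots> = (\<integral>\<^sup>+ w. indicator (upper_set h z) w \<partial>lborel)"
      unfolding J[symmetric] using h0
      by (intro nn_integral_aniso[symmetric] z0 borel_measurable_indicator) simp_all
    also have "\<dots> = emeasure lborel (upper_set h z)" by simp
    finally show "ennreal ((1/4) ^ CARD('n) * V * h ^ (CARD('n) + 1)) \<le> emeasure lborel (upper_set h z)" .
  qed (use V in simp)
qed

lemma pdist_pos:
  assumes z: "z \<in> ball 0 1" and ne: "w \<noteq> z"
  shows "0 < pdist z w"
proof -
  define h where "h = w - z"
  have d: "0 < defect z" using defect_pos[OF z] .
  have e: "(norm (Phi_num z w))\<^sup>2 = (norm (proj_line z h))\<^sup>2 + defect z * (norm (proj_perp z h))\<^sup>2"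
    using norm_Phi_num_add_sq[OF z, of h] by (simp add: h_def)
  have "0 < (norm h)\<^sup>2" using ne by (simp add: h_def)
  then have "proj_line z h \<noteq> 0 \<or> proj_perp z h \<noteq> 0"
    unfolding norm_proj_sq[of h z] by auto
  then have "0 < (norm (Phi_num z w))\<^sup>2"
  proof
    assume "proj_line z h \<noteq> 0"
    then have "0 < (norm (proj_line z h))\<^sup>2" by simp
    then show ?thesis unfolding e using d by (intro add_pos_nonneg) simp_all
  next
    assume "proj_perp z h \<noteq> 0"
    then have "0 < defect z * (norm (proj_perp z h))\<^sup>2" using d by simp
    then show ?thesis unfolding e by (intro add_nonneg_pos) simp_all
  qed
  then have "norm (Phi_num z w) \<noteq> 0" by simp
  then show ?thesis unfolding pdist_eq[OF z, symmetric] by simp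
qed

text \<open>The difference factor is kept for the sake of w = z: there \<open>pdist\<close> is 0 and
  \<open>pker\<close> is 0 by the convention for \<open>powr\<close>, while \<open>bker\<close> is
  positive, but both products vanish.\<close>

lemma diff_bker_le_diff_pker:
  assumes z: "z \<in> ball 0 1" and w: "w \<in> ball 0 1" and t: "t > 0"
  shows "norm (f z - f w) powr p * bker t \<alpha> z w \<le> norm (f z - f w) powr p * pker t \<alpha> z w"
proof (cases "w = z")
  case False
  have "pdist z w \<le> kdist z w"
    using norm_Phi_num_le[OF z w] unfolding pdist_eq[OF z] by (simp add: kdist_commute)
  then have "kdist z w powr (- 2 * t) \<le> pdist z w powr (- 2 * t)"
    using pdist_pos[OF z False] t by (intro powr_mono2') simp_all
  then show ?thesis unfolding bker_def pker_def by (intro mult_left_mono) simp_all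
qed simp

text \<open>The inequality |f z|^p <= 2^p (|f z - f w|^p + |f w|^p) is averaged over the upper set
  at height h = K d(z), whose volume is at least of order h^(n+1). There \<open>bker\<close> is at
  least of order K^(-t) h^(-n-1), so the difference part costs K^t, while the constant in front of
  the average is independent of K.\<close>

lemma powr_le_upper_average:
  assumes t: "t = real CARD('n) + 1 + \<alpha>" "t > 0" and p: "p > 0"
  shows "\<exists>C>0. \<forall>f :: complex ^ 'n \<Rightarrow> complex. f \<in> borel_measurable borel \<longrightarrow> (\<forall>K\<ge>1. \<forall>z\<in>ball 0 1. K * defect z \<le> 1/2 \<longrightarrow>
    ennreal (norm (f z) powr p) \<le> ennreal (C * K powr t) * diff_int t \<alpha> p f z
      + ennreal (C * (K * defect z) powr (- (real CARD('n) + 1)))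
        * (\<integral>\<^sup>+ w. ennreal (norm (f w) powr p) * indicator (upper_set (K * defect z) z) w \<partial>lborel))"
proof -
  obtain c where c: "c > 0" and c': "\<forall>z :: complex ^ 'n \<in> ball 0 1. \<forall>h. defect z \<le> h \<longrightarrow> h \<le> 1/2 \<longrightarrow>
     ennreal (c * h ^ (CARD('n) + 1)) \<le> emeasure lborel (upper_set h z)"
    using emeasure_upper_set_ge by (elim exE conjE)
  \<comment> \<open>On the upper set h <= d(w) <= 2 k(z,w) <= 8h.\<close>
  define Mn where "Mn = min (1 powr \<alpha>) (8 powr \<alpha>)"
  have Mn: "Mn > 0" by (simp add: Mn_def)
  define L where "L = 4 powr (2 * t) / Mn"
  have L: "L > 0" using Mn by (simp add: L_def)
  define C where "C = 2 powr p / c * (L + 1)"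
  have C: "C > 0" using c L by (simp add: C_def)
  show ?thesis
  proof (intro exI[of _ C] conjI C allI impI ballI)
    fix f :: "complex ^ 'n \<Rightarrow> complex" and K :: real and z :: "complex ^ 'n"
    assume f [measurable]: "f \<in> borel_measurable borel" and K: "K \<ge> 1" and z: "z \<in> ball 0 1" and Kz: "K * defect z \<le> 1/2"
    define h where "h = K * defect z"
    have d: "defect z > 0" using defect_pos[OF z] .
    have hd: "defect z \<le> h" using K d mult_right_mono[of 1 K "defect z"] by (simp add: h_def)
    have h0: "h > 0" using hd d by simp
    let ?N = "real CARD('n) + 1"
    have hN: "h ^ (CARD('n) + 1) = h powr ?N" using h0 powr_realpow[of h "CARD('n) + 1"] by (simp add: add.commute)
    define E where "E = (indicator (upper_set h z) :: complex ^ 'n \<Rightarrow> ennreal)"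
    have [measurable]: "E \<in> borel_measurable borel" unfolding E_def by (intro borel_measurable_indicator upper_set_sets)
    let ?A = "\<integral>\<^sup>+ w. ennreal (norm (f w) powr p) * E w \<partial>lborel"
    let ?D = "\<integral>\<^sup>+ w. ennreal (norm (f z - f w) powr p) * E w \<partial>lborel"
    have D: "?D \<le> ennreal (L * K powr t * h powr ?N) * diff_int t \<alpha> p f z"
    proof -
      have "?D \<le> (\<integral>\<^sup>+ w. ennreal (L * K powr t * h powr ?N) * (ennreal (norm (f z - f w) powr p * pker t \<alpha> z w) * indicator (ball 0 1) w) \<partial>lborel)"
      proof (rule nn_integral_mono)
        fix w :: "complex ^ 'n"
        show "ennreal (norm (f z - f w) powr p) * E w
          \<le> ennreal (L * K powr t * h powr ?N) * (ennreal (norm (f z - f w) powr p * pker t \<alpha> z w) * indicator (ball 0 1) w)"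
        proof (cases "w \<in> upper_set h z")
          case True
          then have w: "w \<in> ball 0 1" and wh: "h \<le> defect w" "kdist z w \<le> 4 * h" by (simp_all add: upper_set_def)
          have w8: "defect w \<le> 8 * h" using defect_le_kdist'[OF z w] wh by linarith
          have 1: "Mn * h powr \<alpha> \<le> defect w powr \<alpha>"
            unfolding Mn_def by (rule powr_sandwich(2)[OF _ h0 _ w8]) (use wh in simp_all)
          have 2: "(4 * h) powr (- 2 * t) \<le> kdist z w powr (- 2 * t)"
            using wh kdist_pos[OF z w] t by (intro powr_mono2') simp_all
          have e1: "L * Mn * 4 powr (- 2 * t) = 1" using Mn by (simp add: L_def powr_minus)
          have e2: "(4 * h) powr (- 2 * t) = 4 powr (- 2 * t) * h powr (- 2 * t)" using h0 by (intro powr_mult)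
          have e3: "K powr t * defect z powr t = h powr t" using K d by (simp add: h_def powr_mult)
          have e4: "h powr ?N * h powr t * h powr \<alpha> * h powr (- 2 * t) = 1"
            using h0 by (simp add: powr_add[symmetric] t(1))
          have "1 = (L * Mn * 4 powr (- 2 * t)) * (h powr ?N * (K powr t * defect z powr t) * h powr \<alpha> * h powr (- 2 * t))"
            unfolding e1 e3 e4 by simp
          also have "\<dots> = L * K powr t * h powr ?N * (defect z powr t * (Mn * h powr \<alpha>) * (4 * h) powr (- 2 * t))"
            unfolding e2 by (simp only: mult_ac)
          also have "\<dots> \<le> L * K powr t * h powr ?N * (defect z powr t * defect w powr \<alpha> * kdist z w powr (- 2 * t))"
            using L Mn by (intro mult_left_mono mult_mono 1 2) simp_all
          finally have "1 \<le> L * K powr t * h powr ?N * bker t \<alpha> z w" by (simp add: bker_def)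
          then have "norm (f z - f w) powr p * 1 \<le> norm (f z - f w) powr p * (L * K powr t * h powr ?N * bker t \<alpha> z w)"
            by (intro mult_left_mono) simp_all
          also have "\<dots> = L * K powr t * h powr ?N * (norm (f z - f w) powr p * bker t \<alpha> z w)" by (simp only: mult_ac)
          also have "\<dots> \<le> L * K powr t * h powr ?N * (norm (f z - f w) powr p * pker t \<alpha> z w)"
            using L by (intro mult_left_mono diff_bker_le_diff_pker z w t) simp_all
          finally show ?thesis
            using True w L by (simp add: E_def ennreal_mult'[symmetric] ennreal_leI)
        qed (simp add: E_def)
      qed
      also have "\<dots> = ennreal (L * K powr t * h powr ?N) * diff_int t \<alpha> p f z"
        unfolding diff_int_def by (rule nn_integral_cmult) measurable
      finally show ?thesis .
    qed
    have "ennreal (c * h powr ?N) * ennreal (norm (f z) powr p) \<le> emeasure lborel (upper_set h z) * ennreal (norm (f z) powr p)"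
    proof (rule mult_right_mono)
      have "h \<le> 1/2" using Kz by (simp add: h_def)
      then show "ennreal (c * h powr ?N) \<le> emeasure lborel (upper_set h z)"
        unfolding hN[symmetric] by (rule c'[rule_format, OF z hd])
    qed simp
    also have "\<dots> = (\<integral>\<^sup>+ w. E w * ennreal (norm (f z) powr p) \<partial>lborel)"
      by (simp add: E_def nn_integral_multc)
    also have "\<dots> \<le> (\<integral>\<^sup>+ w. ennreal (2 powr p) * (ennreal (norm (f z - f w) powr p) * E w + ennreal (norm (f w) powr p) * E w) \<partial>lborel)"
    proof (rule nn_integral_mono)
      fix w
      have "norm (f z) powr p \<le> 2 powr p * (norm (f z - f w) powr p + norm (f w) powr p)"
        using norm_diff_powr_le[OF p, of "f z - f w" "- f w"] by simp
      then have "ennreal (norm (f z) powr p) \<le> ennreal (2 powr p) * (ennreal (norm (f z - f w) powr p) + ennreal (norm (f w) powr p))"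
        by (simp add: ennreal_mult'[symmetric] ennreal_plus[symmetric] ennreal_leI del: ennreal_plus)
      then have "E w * ennreal (norm (f z) powr p) \<le> E w * (ennreal (2 powr p) * (ennreal (norm (f z - f w) powr p) + ennreal (norm (f w) powr p)))"
        by (intro mult_left_mono) simp_all
      then show "E w * ennreal (norm (f z) powr p) \<le> ennreal (2 powr p) * (ennreal (norm (f z - f w) powr p) * E w + ennreal (norm (f w) powr p) * E w)"
        by (simp add: distrib_left distrib_right mult_ac)
    qed
    also have "\<dots> = ennreal (2 powr p) * (?D + ?A)"
    proof -
      have "(\<integral>\<^sup>+ w. ennreal (2 powr p) * (ennreal (norm (f z - f w) powr p) * E w + ennreal (norm (f w) powr p) * E w) \<partial>lborel)
        = ennreal (2 powr p) * (\<integral>\<^sup>+ w. ennreal (norm (f z - f w) powr p) * E w + ennreal (norm (f w) powr p) * E w \<partial>lborel)"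
        by (rule nn_integral_cmult) measurable
      also have "(\<integral>\<^sup>+ w. ennreal (norm (f z - f w) powr p) * E w + ennreal (norm (f w) powr p) * E w \<partial>lborel) = ?D + ?A"
        by (rule nn_integral_add) measurable
      finally show ?thesis .
    qed
    also have "\<dots> \<le> ennreal (2 powr p) * (ennreal (L * K powr t * h powr ?N) * diff_int t \<alpha> p f z + ?A)"
      by (intro mult_left_mono add_mono D) simp_all
    finally have main: "ennreal (c * h powr ?N) * ennreal (norm (f z) powr p)
      \<le> ennreal (2 powr p) * (ennreal (L * K powr t * h powr ?N) * diff_int t \<alpha> p f z + ?A)" .
    define q where "q = h powr (- ?N) / c"
    have q: "q > 0" "q * (c * h powr ?N) = 1" using h0 c by (simp_all add: q_def powr_add[symmetric])
    have "ennreal (norm (f z) powr p) = ennreal q * (ennreal (c * h powr ?N) * ennreal (norm (f z) powr p))"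
      using q c by (simp add: ennreal_mult'[symmetric] mult.assoc[symmetric])
    also have "\<dots> \<le> ennreal q * (ennreal (2 powr p) * (ennreal (L * K powr t * h powr ?N) * diff_int t \<alpha> p f z + ?A))"
      by (intro mult_left_mono main) simp
    also have "\<dots> = ennreal (q * 2 powr p * (L * K powr t * h powr ?N)) * diff_int t \<alpha> p f z + ennreal (q * 2 powr p) * ?A"
      using q L by (simp add: ennreal_mult distrib_left mult_ac)
    also have "\<dots> \<le> ennreal (C * K powr t) * diff_int t \<alpha> p f z + ennreal (C * h powr (- ?N)) * ?A"
    proof (intro add_mono mult_right_mono ennreal_leI)
      have "q * 2 powr p * (L * K powr t * h powr ?N) = (q * (c * h powr ?N)) * (2 powr p / c * L * K powr t)"
        using c by simp
      also have "\<dots> \<le> C * K powr t"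
        unfolding q(2) C_def using c by (simp add: distrib_left distrib_right)
      finally show "q * 2 powr p * (L * K powr t * h powr ?N) \<le> C * K powr t" .
      have "q * 2 powr p = (2 powr p / c * 1) * h powr (- ?N)" by (simp add: q_def)
      also have "\<dots> \<le> C * h powr (- ?N)"
        unfolding C_def using c L by (intro mult_right_mono mult_left_mono) simp_all
      finally show "q * 2 powr p \<le> C * h powr (- ?N)" .
    qed simp_all
    finally show "ennreal (norm (f z) powr p) \<le> ennreal (C * K powr t) * diff_int t \<alpha> p f z
      + ennreal (C * (K * defect z) powr (- ?N))
        * (\<integral>\<^sup>+ w. ennreal (norm (f w) powr p) * indicator (upper_set (K * defect z) z) w \<partial>lborel)"
      unfolding E_def h_def .
  qed
qed

section \<open>Absorption\<close>

lemma tent_shell_sets [measurable]: "{z \<in> tent b r. defect z < h} \<in> sets borel"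
proof -
  have "{z \<in> tent b r. defect z < h} = tent b r \<inter> {z \<in> space borel. defect z < h}" by auto
  also have "\<dots> \<in> sets borel" by (rule sets.Int) measurable
  finally show ?thesis .
qed

text \<open>The adjoint of averaging: for fixed w, with \<delta> = d(w), the contributing z have
  height about \<delta> / K and lie both in the given tent and in a tent of radius 5\<delta> around
  w. The shell estimate bounds their volume by a multiple of (\<delta> / K) min(r, \<delta>)^n, and
  the gain K^(-\<beta>-1) is the factor \<delta> / K together with (\<delta> / K)^\<beta>.\<close>

lemma nn_integral_bracket_le:
  assumes \<nu>: "0 \<le> \<nu>" "\<nu> \<le> real CARD('n)"
  shows "\<exists>C>0. \<forall>K\<ge>1. \<forall>b :: complex ^ 'n \<in> ball 0 1. \<forall>r>0. \<forall>w\<in>ball 0 1.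
    (\<integral>\<^sup>+ z. ennreal ((K * defect z) powr (- (real CARD('n) + 1)) * defect z powr \<beta>)
        * indicator (upper_set (K * defect z) z) w * indicator (tent b r) z \<partial>lborel)
      \<le> ennreal (C * K powr (- (\<beta> + 1)) * r powr \<nu> * (defect w powr \<beta> * kdist w b powr (- \<nu>)))
          * indicator (tent b (200 * K * r)) w"
proof -
  let ?N = "real CARD('n) + 1"
  obtain C0 where C0: "C0 > 0" and C0': "\<forall>b\<in>ball 0 1. \<forall>r>0. \<forall>h>0.
     emeasure lborel {z \<in> tent (b :: complex ^ 'n) r. defect z < h} \<le> ennreal (C0 * h * r ^ CARD('n))"
    using emeasure_tent_shell_le by (elim exE conjE)
  define Mx where "Mx = max ((1/8) powr \<beta>) (1 powr \<beta>)"
  have Mx: "Mx > 0" by (simp add: Mx_def less_max_iff_disj)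
  define C1 where "C1 = (1/8) powr (- ?N) * Mx * (C0 * 2 * 5 ^ CARD('n))"
  have C1: "C1 > 0" using Mx C0 by (simp add: C1_def)
  show ?thesis
  proof (intro exI[of _ "C1 * 15 powr \<nu>"] conjI allI impI ballI)
    fix K :: real and b w :: "complex ^ 'n" and r :: real
    assume K: "K \<ge> 1" and b: "b \<in> ball 0 1" and r: "r > 0" and w: "w \<in> ball 0 1"
    define \<delta> where "\<delta> = defect w"
    have \<delta>: "\<delta> > 0" using defect_pos[OF w] by (simp add: \<delta>_def)
    define G where "G z = ennreal ((K * defect z) powr (- ?N) * defect z powr \<beta>)
        * indicator (upper_set (K * defect z) z) w * indicator (tent b r) z" for z
    show "(\<integral>\<^sup>+ z. G z \<partial>lborel)
      \<le> ennreal (C1 * 15 powr \<nu> * K powr (- (\<beta> + 1)) * r powr \<nu> * (defect w powr \<beta> * kdist w b powr (- \<nu>)))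
          * indicator (tent b (200 * K * r)) w"
    proof (cases "\<exists>z. z \<in> tent b r \<and> w \<in> upper_set (K * defect z) z")
      case False
      then have "G z = 0" for z by (auto simp: G_def indicator_def)
      then show ?thesis by simp
    next
      case True
      then obtain z0 where z0: "z0 \<in> tent b r" "w \<in> upper_set (K * defect z0) z0" by blast
      have facts: "z \<in> ball 0 1" "kdist z b < r" "K * defect z \<le> \<delta>" "\<delta> \<le> 8 * (K * defect z)" "kdist z w \<le> 4 * \<delta>"
        if z: "z \<in> tent b r" "w \<in> upper_set (K * defect z) z" for z
      proof -
        show 1: "z \<in> ball 0 1" "kdist z b < r" using z(1) by (simp_all add: tent_def)
        show 2: "K * defect z \<le> \<delta>" using z(2) by (simp add: upper_set_def \<delta>_def)
        have 3: "kdist z w \<le> 4 * (K * defect z)" using z(2) by (simp add: upper_set_def)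
        show "\<delta> \<le> 8 * (K * defect z)" using defect_le_kdist'[OF 1(1) w] 3 by (simp add: \<delta>_def)
        show "kdist z w \<le> 4 * \<delta>" using 2 3 by linarith
      qed
      note f0 = facts[OF z0]
      have kwb: "kdist w b \<le> 12 * \<delta> + 3 * r"
        using kdist_triangle[OF w f0(1) b] f0(2,5) by (simp add: kdist_commute[of w z0])
      have "defect z0 \<le> 2 * r" using defect_le_kdist[OF f0(1) b] f0(2) by linarith
      then have "K * defect z0 \<le> K * (2 * r)" using K by (intro mult_left_mono) simp_all
      then have "\<delta> \<le> 16 * (K * r)" using f0(4) by linarith
      moreover have "r \<le> K * r" using K r mult_right_mono[of 1 K r] by simp
      \<comment> \<open>From k(w,b) <= 12\<delta> + 3r with \<delta> <= 16 K r and r <= K r, giving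
        12 * 16 + 3; the slack up to 200 makes the inequality strict.\<close>
      ultimately have "kdist w b \<le> 195 * (K * r)" using kwb by linarith
      moreover have "0 < K * r" using K r by simp
      ultimately have wt: "w \<in> tent b (200 * K * r)" using w by (simp add: tent_def)
      \<comment> \<open>The smaller of the two available tents is used to enclose the contributing
        points: the given one if r <= \<delta>, the one around w otherwise.\<close>
      define m where "m = min r \<delta>"
      have m: "0 < m" "m \<le> r" "m \<le> \<delta>" using r \<delta> by (simp_all add: m_def)
      define D where "D = 2 * \<delta> / K"
      have D: "D > 0" using \<delta> K by (simp add: D_def)
      obtain T where T: "T \<in> sets borel" "\<And>z. z \<in> tent b r \<Longrightarrow> w \<in> upper_set (K * defect z) z \<Longrightarrow> z \<in> T"
        "emeasure lborel T \<le> ennreal (C0 * D * (5 ^ CARD('n) * m ^ CARD('n)))"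
      proof -
        have dD: "defect z < D" if "z \<in> tent b r" "w \<in> upper_set (K * defect z) z" for z
        proof -
          have "defect z \<le> \<delta> / K" using facts(3)[OF that] K by (simp add: field_simps)
          also have "\<dots> < D" using \<delta> K by (simp add: D_def divide_strict_right_mono)
          finally show ?thesis .
        qed
        show ?thesis
        proof (cases "r \<le> \<delta>")
          case True
          show ?thesis
          proof (rule that[of "{z \<in> tent b r. defect z < D}"])
            have "emeasure lborel {z \<in> tent b r. defect z < D} \<le> ennreal (C0 * D * r ^ CARD('n))"
              by (rule C0'[rule_format, OF b r D])
            also have "\<dots> \<le> ennreal (C0 * D * (5 ^ CARD('n) * m ^ CARD('n)))"
            proof (intro ennreal_leI mult_left_mono)
              have "m = r" using True by (simp add: m_def)
              then show "r ^ CARD('n) \<le> 5 ^ CARD('n) * m ^ CARD('n)"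
                using mult_right_mono[of 1 "5 ^ CARD('n)" "r ^ CARD('n)"] r by simp
            qed (use C0 D in simp)
            finally show "emeasure lborel {z \<in> tent b r. defect z < D} \<le> ennreal (C0 * D * (5 ^ CARD('n) * m ^ CARD('n)))" .
          qed (simp_all add: dD tent_shell_sets)
        next
          case False
          have 5: "0 < 5 * \<delta>" using \<delta> by simp
          show ?thesis
          proof (rule that[of "{z \<in> tent w (5 * \<delta>). defect z < D}"])
            have "emeasure lborel {z \<in> tent w (5 * \<delta>). defect z < D} \<le> ennreal (C0 * D * (5 * \<delta>) ^ CARD('n))"
              by (rule C0'[rule_format, OF w 5 D])
            also have "(5 * \<delta>) ^ CARD('n) = 5 ^ CARD('n) * m ^ CARD('n)"
              using False by (simp add: m_def power_mult_distrib)
            finally show "emeasure lborel {z \<in> tent w (5 * \<delta>). defect z < D} \<le> ennreal (C0 * D * (5 ^ CARD('n) * m ^ CARD('n)))" .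
            show "z \<in> {z \<in> tent w (5 * \<delta>). defect z < D}" if z: "z \<in> tent b r" "w \<in> upper_set (K * defect z) z" for z
              using dD[OF z] facts(1)[OF z] facts(5)[OF z] \<delta> by (simp add: tent_def)
          qed (simp add: tent_shell_sets)
        qed
      qed
      define c where "c = (\<delta> / 8) powr (- ?N) * (Mx * (\<delta> / K) powr \<beta>)"
      have Gle: "G z \<le> ennreal c * indicator T z" for z
      proof (cases "z \<in> tent b r \<and> w \<in> upper_set (K * defect z) z")
        case True
        then have z: "z \<in> tent b r" "w \<in> upper_set (K * defect z) z" by simp_all
        note fz = facts[OF z]
        have dz: "defect z > 0" using defect_pos[OF fz(1)] .
        have 1: "(K * defect z) powr (- ?N) \<le> (\<delta> / 8) powr (- ?N)"
          using fz(4) \<delta> by (intro powr_mono2') simp_all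
        have lo: "1/8 * (\<delta> / K) \<le> defect z" using fz(4) K by (simp add: field_simps)
        have hi: "defect z \<le> 1 * (\<delta> / K)" using fz(3) K by (simp add: field_simps)
        have 2: "defect z powr \<beta> \<le> Mx * (\<delta> / K) powr \<beta>"
          unfolding Mx_def by (rule powr_sandwich(1)[OF _ _ lo hi]) (use \<delta> K in simp_all)
        have "(K * defect z) powr (- ?N) * defect z powr \<beta> \<le> c"
          unfolding c_def by (intro mult_mono 1 2) simp_all
        then show ?thesis using z T(2)[OF z] by (simp add: G_def ennreal_leI)
      next
        case False
        then have "G z = 0" by (auto simp: G_def indicator_def)
        then show ?thesis by simp
      qed
      have c0: "c \<ge> 0" using Mx by (simp add: c_def)
      have "(\<integral>\<^sup>+ z. G z \<partial>lborel) \<le> (\<integral>\<^sup>+ z. ennreal c * indicator T z \<partial>lborel)"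
        by (intro nn_integral_mono Gle)
      also have "\<dots> = ennreal c * emeasure lborel T"
        using T(1) by (intro nn_integral_cmult_indicator) simp
      also have "\<dots> \<le> ennreal c * ennreal (C0 * D * (5 ^ CARD('n) * m ^ CARD('n)))"
        by (intro mult_left_mono T(3)) simp
      also have "\<dots> = ennreal (c * (C0 * D * (5 ^ CARD('n) * m ^ CARD('n))))"
        using c0 by (simp add: ennreal_mult')
      also have "c * (C0 * D * (5 ^ CARD('n) * m ^ CARD('n))) = C1 * K powr (- (\<beta> + 1)) * \<delta> powr \<beta> * (m / \<delta>) ^ CARD('n)"
      proof -
        have e1: "(\<delta> / 8) powr (- ?N) = (1/8) powr (- ?N) * \<delta> powr (- ?N)"
          using powr_mult[of "1/8" \<delta> "- ?N"] \<delta> by simp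
        have e2: "(\<delta> / K) powr \<beta> * (\<delta> / K) = \<delta> powr \<beta> * \<delta> * K powr (- (\<beta> + 1))"
        proof -
          have "(\<delta> / K) powr \<beta> * (\<delta> / K) = (\<delta> / K) powr (\<beta> + 1)" using \<delta> K by (simp add: powr_add)
          also have "\<dots> = \<delta> powr (\<beta> + 1) / K powr (\<beta> + 1)" using \<delta> K by (intro powr_divide)
          also have "\<dots> = \<delta> powr (\<beta> + 1) * K powr (- (\<beta> + 1))" by (simp only: powr_minus divide_inverse)
          finally show ?thesis using \<delta> by (simp add: powr_add)
        qed
        have e3: "\<delta> powr (- ?N) * \<delta> * m ^ CARD('n) = (m / \<delta>) ^ CARD('n)"
        proof -
          have "\<delta> powr (- ?N) * \<delta> = \<delta> powr (- ?N) * \<delta> powr 1" using \<delta> by simp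
          also have "\<dots> = \<delta> powr (- real CARD('n))" by (simp only: powr_add[symmetric]) simp
          also have "\<dots> = inverse (\<delta> ^ CARD('n))" using \<delta> by (simp add: powr_minus powr_realpow)
          finally show ?thesis by (simp add: power_divide field_simps)
        qed
        have "c * (C0 * D * (5 ^ CARD('n) * m ^ CARD('n)))
          = (1/8) powr (- ?N) * Mx * (C0 * 2 * 5 ^ CARD('n)) * \<delta> powr (- ?N) * ((\<delta> / K) powr \<beta> * (\<delta> / K)) * m ^ CARD('n)"
          unfolding c_def e1 D_def by simp
        also have "\<dots> = C1 * K powr (- (\<beta> + 1)) * \<delta> powr \<beta> * (\<delta> powr (- ?N) * \<delta> * m ^ CARD('n))"
          unfolding e2 C1_def by (simp only: mult_ac)
        finally show ?thesis unfolding e3 .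
      qed
      also have "ennreal \<dots> \<le> ennreal (C1 * K powr (- (\<beta> + 1)) * \<delta> powr \<beta> * (15 powr \<nu> * r powr \<nu> * kdist w b powr (- \<nu>)))"
      proof (intro ennreal_leI mult_left_mono)
        have kp: "kdist w b > 0" using kdist_pos[OF w b] .
        have "(m / \<delta>) ^ CARD('n) = (m / \<delta>) powr real CARD('n)" using m \<delta> by (simp add: powr_realpow)
        \<comment> \<open>Since m <= \<delta>, the exponent n may be lowered to \<nu>. The remaining
          base is at most 15 r / k(w,b), which turns the overlap of the two tents into decay away
          from b.\<close>
        also have "\<dots> \<le> (m / \<delta>) powr \<nu>" using m \<delta> \<nu> by (intro powr_mono') simp_all
        also have "\<dots> \<le> (15 * r / kdist w b) powr \<nu>"
        proof (rule powr_mono2)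
          have "m * kdist w b \<le> m * (12 * \<delta> + 3 * r)" using kwb m by (intro mult_left_mono) simp_all
          also have "\<dots> = 12 * (m * \<delta>) + 3 * (m * r)" by (simp add: algebra_simps)
          also have "\<dots> \<le> 12 * (r * \<delta>) + 3 * (\<delta> * r)"
            using m \<delta> r by (intro add_mono mult_left_mono mult_right_mono) simp_all
          finally have "m * kdist w b \<le> 15 * r * \<delta>" by (simp add: mult_ac)
          then show "m / \<delta> \<le> 15 * r / kdist w b" using \<delta> kp by (simp add: field_simps)
        qed (use \<nu> m \<delta> in simp_all)
        also have "\<dots> = (15 * r) powr \<nu> / kdist w b powr \<nu>" using r kp by (intro powr_divide)
        also have "\<dots> = 15 powr \<nu> * r powr \<nu> * kdist w b powr (- \<nu>)"
          using r powr_mult[of 15 r \<nu>] by (simp add: powr_minus divide_inverse)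
        finally show "(m / \<delta>) ^ CARD('n) \<le> 15 powr \<nu> * r powr \<nu> * kdist w b powr (- \<nu>)" .
      qed (use C1 in simp)
      also have "\<dots> = ennreal (C1 * 15 powr \<nu> * K powr (- (\<beta> + 1)) * r powr \<nu> * (defect w powr \<beta> * kdist w b powr (- \<nu>)))
          * indicator (tent b (200 * K * r)) w"
        using wt by (simp add: \<delta>_def mult_ac)
      finally show ?thesis .
    qed
  qed (use C1 in simp)
qed

text \<open>Radii above 2 give nothing new, as k < 2. After capping, r' / 2 <= 1, so the natural
  exponent n + 1 + x may be replaced by any smaller positive one.\<close>

lemma nn_integral_tent_defect_le_powr:
  assumes x: "x > -1" and \<sigma>: "0 < \<sigma>" "\<sigma> \<le> real CARD('n) + 1 + x"
  shows "\<exists>C>0. \<forall>b\<in>ball 0 1. \<forall>r>0.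
    (\<integral>\<^sup>+ z. ennreal (defect z powr x) * indicator (tent (b :: complex ^ 'n) r) z \<partial>lborel) \<le> ennreal (C * r powr \<sigma>)"
proof -
  let ?e = "real CARD('n) + 1 + x"
  obtain C where C: "C > 0" and C': "\<forall>b\<in>ball 0 1. \<forall>r>0.
    (\<integral>\<^sup>+ z. ennreal (defect z powr x) * indicator (tent (b :: complex ^ 'n) r) z \<partial>lborel) \<le> ennreal (C * r powr ?e)"
    using nn_integral_tent_defect_le[OF x] by (elim exE conjE)
  show ?thesis
  proof (intro exI[of _ "C * 2 powr ?e"] conjI ballI allI impI)
    fix b :: "complex ^ 'n" and r :: real
    assume b: "b \<in> ball 0 1" and r: "r > 0"
    define r' where "r' = min r 2"
    have r': "0 < r'" "r' \<le> r" "r' / 2 \<le> 1" using r by (simp_all add: r'_def)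
    have "tent b r \<subseteq> tent b r'"
    proof
      fix z assume z: "z \<in> tent b r"
      then have zB: "z \<in> ball 0 1" by (simp add: tent_def)
      show "z \<in> tent b r'" using z kdist_le_2[OF zB b] by (simp add: tent_def r'_def)
    qed
    then have "(\<integral>\<^sup>+ z. ennreal (defect z powr x) * indicator (tent b r) z \<partial>lborel)
      \<le> (\<integral>\<^sup>+ z. ennreal (defect z powr x) * indicator (tent b r') z \<partial>lborel)"
      by (intro nn_integral_mono mult_left_mono) (auto split: split_indicator)
    also have "\<dots> \<le> ennreal (C * r' powr ?e)" by (rule C'[rule_format, OF b r'(1)])
    also have "\<dots> \<le> ennreal (C * 2 powr ?e * r powr \<sigma>)"
    proof (rule ennreal_leI)
      have "r' powr ?e = (2 * (r' / 2)) powr ?e" by simp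
      also have "\<dots> = 2 powr ?e * (r' / 2) powr ?e" using r' by (intro powr_mult)
      also have "(r' / 2) powr ?e \<le> (r' / 2) powr \<sigma>" using r' \<sigma> by (intro powr_mono') simp_all
      also have "(r' / 2) powr \<sigma> \<le> r powr \<sigma>" using r' \<sigma> by (intro powr_mono2) simp_all
      finally have "r' powr ?e \<le> 2 powr ?e * r powr \<sigma>" by (simp add: mult_left_mono)
      then have "C * r' powr ?e \<le> C * (2 powr ?e * r powr \<sigma>)" using C by (intro mult_left_mono) simp_all
      then show "C * r' powr ?e \<le> C * 2 powr ?e * r powr \<sigma>" by (simp only: mult.assoc)
    qed
    finally show "(\<integral>\<^sup>+ z. ennreal (defect z powr x) * indicator (tent b r) z \<partial>lborel) \<le> ennreal (C * 2 powr ?e * r powr \<sigma>)" .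
  qed (use C in simp)
qed

lemma powr_bounded_on_compact:
  fixes f :: "complex ^ 'n \<Rightarrow> complex"
  assumes "continuous_on (ball 0 1) f" "R < 1" "p > 0"
  shows "\<exists>S\<ge>0. \<forall>z. norm z \<le> R \<longrightarrow> norm (f z) powr p \<le> S"
proof -
  have "compact (f ` cball 0 R)"
    using assms(2) by (intro compact_continuous_image continuous_on_subset[OF assms(1)]) auto
  then have "bounded (f ` cball 0 R)" by (rule compact_imp_bounded)
  then obtain B where B: "\<And>x. x \<in> f ` cball 0 R \<Longrightarrow> norm x \<le> B" by (auto simp: bounded_iff)
  have "norm (f z) powr p \<le> \<bar>B\<bar> powr p" if "norm z \<le> R" for z
  proof (rule powr_mono2)
    have "norm (f z) \<le> B" by (rule B) (use that in simp)
    then show "norm (f z) \<le> \<bar>B\<bar>" by linarith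
  qed (use assms(3) in simp_all)
  then show ?thesis by (intro exI[of _ "\<bar>B\<bar> powr p"]) simp
qed

text \<open>Finiteness is essential: an infinite Q satisfies the first premise for every A. This is
  the reason for truncating to |z| < R.\<close>

lemma ennreal_absorb_half:
  fixes Q A :: ennreal
  assumes "Q \<le> A + ennreal (1/2) * Q" "Q < \<infinity>"
  shows "Q \<le> 2 * A"
proof (cases A)
  case (real a)
  obtain q where q: "0 \<le> q" "Q = ennreal q" using assms(2) by (cases Q) auto
  have "ennreal (1/2) * ennreal q = ennreal (1/2 * q)"
    by (rule ennreal_mult[symmetric]) (use q in simp_all)
  moreover have "ennreal a + ennreal (1/2 * q) = ennreal (a + 1/2 * q)"
    by (rule ennreal_plus[symmetric]) (use q real in simp_all)
  ultimately have "ennreal q \<le> ennreal (a + 1/2 * q)"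
    using assms(1) unfolding q real by (simp only:)
  then have "q \<le> a + 1/2 * q" using real q by (simp only: ennreal_le_iff)
  then have "q \<le> 2 * a" by simp
  then have "ennreal q \<le> ennreal (2 * a)" by (rule ennreal_leI)
  also have "\<dots> = 2 * A" using real by (simp add: ennreal_mult)
  finally show ?thesis using q by simp
qed (simp add: ennreal_mult_top)

text \<open>The parameter \<nu> is left free within its constraints. Besides \<nu> <= n, its upper
  bound \<nu> < \<sigma> makes k(w,b)^(-\<nu>) integrable against a \<sigma>-Carleson measure, and
  \<sigma> - \<nu> < \<beta> + 1 makes the net power of K negative.\<close>

proposition carleson_of_difference_form:
  fixes t \<alpha> \<beta> \<sigma> \<nu> p :: real and f :: "complex ^ 'n \<Rightarrow> complex"
  assumes t: "t = real CARD('n) + 1 + \<alpha>" "t > 0" and p: "p > 0" and \<beta>: "\<beta> > -1"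
    and \<sigma>: "\<sigma> > 0" "\<sigma> \<le> real CARD('n) + 1 + \<beta>"
    and \<nu>: "0 \<le> \<nu>" "\<nu> \<le> real CARD('n)" "\<nu> < \<sigma>" "\<sigma> - \<nu> < \<beta> + 1"
    and f [measurable]: "f \<in> borel_measurable borel" and cont: "continuous_on (ball 0 1) f"
    and M: "M < \<infinity>" "\<And>a. a \<in> ball 0 1 \<Longrightarrow>
      (\<integral>\<^sup>+ z. diff_int t \<alpha> p f z * ennreal (defect z powr \<beta> * mweight \<sigma> a z) * indicator (ball 0 1) z \<partial>lborel) \<le> M"
  shows "\<exists>M'<\<infinity>. \<forall>a\<in>ball 0 1.
    (\<integral>\<^sup>+ z. ennreal (norm (f z) powr p * (defect z powr \<beta> * mweight \<sigma> a z)) * indicator (ball 0 1) z \<partial>lborel) \<le> M'"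
proof -
  let ?N = "real CARD('n) + 1"
  obtain C1 where C1: "C1 > 0" and C1': "\<forall>f :: complex ^ 'n \<Rightarrow> complex. f \<in> borel_measurable borel \<longrightarrow> (\<forall>K\<ge>1. \<forall>z\<in>ball 0 1. K * defect z \<le> 1/2 \<longrightarrow>
    ennreal (norm (f z) powr p) \<le> ennreal (C1 * K powr t) * diff_int t \<alpha> p f z
      + ennreal (C1 * (K * defect z) powr (- ?N))
        * (\<integral>\<^sup>+ w. ennreal (norm (f w) powr p) * indicator (upper_set (K * defect z) z) w \<partial>lborel))"
    using powr_le_upper_average[OF t p] by (elim exE conjE)
  obtain C2 where C2: "C2 > 0" and C2': "\<forall>K\<ge>1. \<forall>b :: complex ^ 'n \<in> ball 0 1. \<forall>r>0. \<forall>w\<in>ball 0 1.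
    (\<integral>\<^sup>+ z. ennreal ((K * defect z) powr (- ?N) * defect z powr \<beta>)
        * indicator (upper_set (K * defect z) z) w * indicator (tent b r) z \<partial>lborel)
      \<le> ennreal (C2 * K powr (- (\<beta> + 1)) * r powr \<nu> * (defect w powr \<beta> * kdist w b powr (- \<nu>)))
          * indicator (tent b (200 * K * r)) w"
    using nn_integral_bracket_le[OF \<nu>(1,2), of \<beta>] by (elim exE conjE)
  obtain C3 where C3: "C3 > 0" and C3': "\<forall>b\<in>ball 0 1. \<forall>r>0.
    (\<integral>\<^sup>+ z. ennreal (defect z powr \<beta>) * indicator (tent (b :: complex ^ 'n) r) z \<partial>lborel) \<le> ennreal (C3 * r powr \<sigma>)"
    using nn_integral_tent_defect_le_powr[OF \<beta> \<sigma>] by (elim exE conjE)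
  define c where "c = 2 powr \<bar>\<nu>\<bar> / (1 - (1/2) powr (\<sigma> - \<nu>))"
  have "(1/2::real) powr (\<sigma> - \<nu>) < 1" using \<nu> by (intro half_powr_less_one) simp
  then have c: "c > 0" by (simp add: c_def)
  define \<Theta> where "\<Theta> = C1 * C2 * (c * 200 powr (\<sigma> - \<nu>))"
  have \<Theta>: "\<Theta> > 0" using C1 C2 c by (simp add: \<Theta>_def)
  define \<gamma> where "\<gamma> = \<beta> + 1 - (\<sigma> - \<nu>)"
  have \<gamma>: "\<gamma> > 0" using \<nu> by (simp add: \<gamma>_def)
  \<comment> \<open>Chosen to make the absorbed coefficient \<Theta> K^(-\<gamma>) at most 1/2. It
    is fixed before R, so the bounds below are uniform in R.\<close>
  define K where "K = max 1 ((2 * \<Theta>) powr (1 / \<gamma>))"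
  have K: "K \<ge> 1" by (simp add: K_def)
  have K0: "K > 0" using K by simp
  have K\<Theta>: "\<Theta> * K powr (- \<gamma>) \<le> 1/2"
  proof -
    have "2 * \<Theta> = ((2 * \<Theta>) powr (1 / \<gamma>)) powr \<gamma>" using \<Theta> \<gamma> by (simp add: powr_powr)
    also have "\<dots> \<le> K powr \<gamma>" using \<gamma> by (intro powr_mono2) (simp_all add: K_def)
    finally have "2 * \<Theta> \<le> K powr \<gamma>" .
    then have "\<Theta> / K powr \<gamma> \<le> 1/2" using K0 by (simp add: pos_divide_le_eq)
    then show ?thesis by (simp only: powr_minus divide_inverse)
  qed
  define B where "B = (indicator (ball 0 1) :: complex ^ 'n \<Rightarrow> ennreal)"
  define P where "P z = ennreal (norm (f z) powr p)" for z
  define w\<beta> where "w\<beta> z = ennreal (defect z powr \<beta>)" for z :: "complex ^ 'n"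
  define F where "F = diff_int t \<alpha> p f"
  have [measurable]: "B \<in> borel_measurable borel" "P \<in> borel_measurable borel" "w\<beta> \<in> borel_measurable borel" "F \<in> borel_measurable borel"
    unfolding B_def P_def[abs_def] w\<beta>_def[abs_def] F_def
    by (simp_all add: borel_measurable_indicator borel_measurable_diff_int)
  define I where "I R b r = (\<integral>\<^sup>+ z. P z * w\<beta> z * indicator (ball 0 R) z * indicator (tent b r) z \<partial>lborel)" for R b r
  define H where "H = M * ennreal (2 powr (2 * \<sigma>))"
  have H: "H < \<infinity>" using M(1) by (simp add: H_def ennreal_mult_less_top)
  have FJ: "(\<integral>\<^sup>+ z. F z * w\<beta> z * indicator (tent b r) z \<partial>lborel) \<le> H * ennreal (r powr \<sigma>)"
    if b: "b \<in> ball 0 1" and r: "r > 0" for b r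
  proof -
    have "(\<integral>\<^sup>+ z. (F z * w\<beta> z) * indicator (tent b r) z \<partial>lborel) \<le> M * ennreal (2 powr (2 * \<sigma>) * r powr \<sigma>)"
    proof (rule tent_le_of_carleson[OF \<sigma>(1) _ _ b r])
      fix a :: "complex ^ 'n" assume a: "a \<in> ball 0 1"
      show "(\<integral>\<^sup>+ z. (F z * w\<beta> z) * ennreal (defect a powr \<sigma> * kdist z a powr (- 2 * \<sigma>)) * indicator (ball 0 1) z \<partial>lborel) \<le> M"
        using M(2)[OF a] unfolding mweight_def[symmetric] F_def w\<beta>_def
        by (simp add: ennreal_mult mweight_nonneg mult.assoc)
    qed measurable
    then show ?thesis by (simp add: H_def ennreal_mult mult.assoc)
  qed
  \<comment> \<open>Where K d(z) > 1/2 there may be no higher points to average over. Such z lie in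
    a compact subset of the ball, on which continuity bounds |f|^p.\<close>
  obtain S where S: "S \<ge> 0" and S': "\<forall>z. norm z \<le> sqrt (1 - 1 / (2 * K)) \<longrightarrow> norm (f z) powr p \<le> S"
  proof -
    have "sqrt (1 - 1 / (2 * K)) < 1" using K0 by simp
    from powr_bounded_on_compact[OF cont this p] show ?thesis using that by (elim exE conjE)
  qed
  have pt: "P z \<le> ennreal S + (ennreal (C1 * K powr t) * F z
      + ennreal (C1 * (K * defect z) powr (- ?N)) * (\<integral>\<^sup>+ w. P w * indicator (upper_set (K * defect z) z) w \<partial>lborel))"
    if z: "z \<in> ball 0 1" for z
  proof (cases "K * defect z \<le> 1/2")
    case True
    have "P z \<le> ennreal (C1 * K powr t) * F z
      + ennreal (C1 * (K * defect z) powr (- ?N)) * (\<integral>\<^sup>+ w. P w * indicator (upper_set (K * defect z) z) w \<partial>lborel)"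
      unfolding P_def F_def by (rule C1'[rule_format, OF f K z True])
    then show ?thesis by (rule add_increasing[rotated]) simp
  next
    case False
    then have "1 / (2 * K) \<le> defect z" using K0 by (simp add: field_simps)
    then have "(norm z)\<^sup>2 \<le> 1 - 1 / (2 * K)" by (simp add: defect_def)
    then have "norm z \<le> sqrt (1 - 1 / (2 * K))" by (rule real_le_rsqrt)
    then have "P z \<le> ennreal S" unfolding P_def by (intro ennreal_leI S'[rule_format])
    then show ?thesis by (rule order_trans) (rule add_increasing2, simp_all)
  qed
  define A where "A = ennreal (S * C3) + ennreal (C1 * K powr t) * H"
  have A: "A < \<infinity>" using H by (simp add: A_def ennreal_mult_less_top)
  \<comment> \<open>Self-improvement: any Carleson constant Q of the truncated measure may be
    replaced by A + Q/2, with A independent of R. The three terms come from the compact part, from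
    the difference form and from the average.\<close>
  have step: "I R b r \<le> (A + ennreal (1/2) * Q) * ennreal (r powr \<sigma>)"
    if R: "R < 1" and Q: "\<And>b r. b \<in> ball 0 1 \<Longrightarrow> r > 0 \<Longrightarrow> I R b r \<le> Q * ennreal (r powr \<sigma>)"
      and b: "b \<in> ball 0 1" and r: "r > 0" for R Q b r
  proof -
    define U where "U z w = ennreal ((K * defect z) powr (- ?N) * defect z powr \<beta>)
        * indicator (upper_set (K * defect z) z) w * indicator (tent b r) z" for z w :: "complex ^ 'n"
    define BR where "BR = (indicator (ball 0 R) :: complex ^ 'n \<Rightarrow> ennreal)"
    have [measurable]: "BR \<in> borel_measurable borel" by (simp add: BR_def borel_measurable_indicator)
    define T where "T = (indicator (tent b r) :: complex ^ 'n \<Rightarrow> ennreal)"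
    have [measurable]: "T \<in> borel_measurable borel" unfolding T_def by (intro borel_measurable_indicator) simp
    have third: "(\<integral>\<^sup>+ z. (\<integral>\<^sup>+ w. ennreal C1 * (P w * (BR w * U z w)) \<partial>lborel) \<partial>lborel) \<le> ennreal (1/2) * Q * ennreal (r powr \<sigma>)"
    proof -
      have "(\<integral>\<^sup>+ z. (\<integral>\<^sup>+ w. ennreal C1 * (P w * (BR w * U z w)) \<partial>lborel) \<partial>lborel)
        = (\<integral>\<^sup>+ w. (\<integral>\<^sup>+ z. ennreal C1 * (P w * (BR w * U z w)) \<partial>lborel) \<partial>lborel)"
        unfolding U_def by (rule lborel_pair.Fubini') measurable
      also have "\<dots> \<le> (\<integral>\<^sup>+ w. ennreal (C1 * C2 * K powr (- (\<beta> + 1)) * r powr \<nu>)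
          * (P w * w\<beta> w * BR w * (ennreal (kdist w b powr (- \<nu>)) * indicator (tent b (200 * K * r)) w)) \<partial>lborel)"
      proof (rule nn_integral_mono)
        fix w :: "complex ^ 'n"
        have "(\<integral>\<^sup>+ z. ennreal C1 * (P w * (BR w * U z w)) \<partial>lborel) = (\<integral>\<^sup>+ z. (ennreal C1 * P w * BR w) * U z w \<partial>lborel)"
          by (simp only: mult.assoc)
        also have "\<dots> = (ennreal C1 * P w * BR w) * (\<integral>\<^sup>+ z. U z w \<partial>lborel)"
          unfolding U_def by (rule nn_integral_cmult) measurable
        also have "\<dots> \<le> (ennreal C1 * P w * BR w) * (ennreal (C2 * K powr (- (\<beta> + 1)) * r powr \<nu> * (defect w powr \<beta> * kdist w b powr (- \<nu>)))
          * indicator (tent b (200 * K * r)) w)"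
        proof (cases "w \<in> ball 0 1")
          case True
          show ?thesis unfolding U_def by (rule mult_left_mono[OF C2'[rule_format, OF K b r True]]) simp
        next
          case False
          then have "BR w = 0" using R by (simp add: BR_def)
          then show ?thesis by simp
        qed
        also have "\<dots> = ennreal (C1 * C2 * K powr (- (\<beta> + 1)) * r powr \<nu>)
          * (P w * w\<beta> w * BR w * (ennreal (kdist w b powr (- \<nu>)) * indicator (tent b (200 * K * r)) w))"
          using C1 C2 by (simp add: w\<beta>_def ennreal_mult mult_ac)
        finally show "(\<integral>\<^sup>+ z. ennreal C1 * (P w * (BR w * U z w)) \<partial>lborel) \<le> ennreal (C1 * C2 * K powr (- (\<beta> + 1)) * r powr \<nu>)
          * (P w * w\<beta> w * BR w * (ennreal (kdist w b powr (- \<nu>)) * indicator (tent b (200 * K * r)) w))" .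
      qed
      also have "\<dots> = ennreal (C1 * C2 * K powr (- (\<beta> + 1)) * r powr \<nu>)
          * (\<integral>\<^sup>+ w. P w * w\<beta> w * BR w * (ennreal (kdist w b powr (- \<nu>)) * indicator (tent b (200 * K * r)) w) \<partial>lborel)"
        by (rule nn_integral_cmult) measurable
      finally have le: "(\<integral>\<^sup>+ z. (\<integral>\<^sup>+ w. ennreal C1 * (P w * (BR w * U z w)) \<partial>lborel) \<partial>lborel)
        \<le> ennreal (C1 * C2 * K powr (- (\<beta> + 1)) * r powr \<nu>)
          * (\<integral>\<^sup>+ w. P w * w\<beta> w * BR w * (ennreal (kdist w b powr (- \<nu>)) * indicator (tent b (200 * K * r)) w) \<partial>lborel)" .
      have "(\<integral>\<^sup>+ w. P w * w\<beta> w * BR w * (ennreal (kdist w b powr (- \<nu>)) * indicator (tent b (200 * K * r)) w) \<partial>lborel)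
        \<le> Q * ennreal (c * (200 * K * r) powr (\<sigma> - \<nu>))"
      proof -
        \<comment> \<open>Under the truncated measure the tents around b have mass at most Q
          \<rho>^\<sigma>, so layers of k(w,b) inside radius 200 K r give Q (K r)^(\<sigma>-\<nu>)
          up to a constant. This is where the power of K lost by spreading is paid.\<close>
        let ?M = "density lborel (\<lambda>w. (P w * w\<beta> w * BR w) * indicator (ball 0 1) w)"
        have "(\<integral>\<^sup>+ w. P w * w\<beta> w * BR w * (ennreal (kdist w b powr (- \<nu>)) * indicator (tent b (200 * K * r)) w) \<partial>lborel)
          = (\<integral>\<^sup>+ w. ((P w * w\<beta> w * BR w) * indicator (ball 0 1) w) * (ennreal (kdist w b powr (- \<nu>)) * indicator (tent b (200 * K * r)) w) \<partial>lborel)"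
          by (intro nn_integral_cong) (simp add: tent_def indicator_def)
        also have "\<dots> = (\<integral>\<^sup>+ w. ennreal (kdist w b powr (- \<nu>)) * indicator (tent b (200 * K * r)) w \<partial>?M)"
          by (rule nn_integral_density[symmetric]) measurable
        also have "\<dots> \<le> Q * ennreal (2 powr \<bar>\<nu>\<bar> / (1 - (1/2) powr (\<sigma> - \<nu>)) * (200 * K * r) powr (\<sigma> - \<nu>))"
        proof (rule nn_integral_layer_small)
          show "0 < 200 * K * r" using K0 r by simp
          show "0 < kdist w b \<and> kdist w b < 200 * K * r" if w: "w \<in> tent b (200 * K * r)" for w
          proof -
            have "w \<in> ball 0 1" using w by (simp add: tent_def)
            from kdist_pos[OF this b] show ?thesis using w by (simp add: tent_def)
          qed
          fix \<rho> :: real assume \<rho>: "\<rho> > 0"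
          have Wm: "(\<lambda>w. P w * w\<beta> w * BR w) \<in> borel_measurable borel" by measurable
          show "emeasure ?M {x \<in> space ?M. kdist x b < \<rho>} \<le> Q * ennreal (\<rho> powr \<sigma>)"
            unfolding emeasure_weighted_sublevel[OF Wm b]
            using Q[OF b \<rho>] unfolding I_def BR_def .
        qed (use \<nu> in simp_all)
        finally show ?thesis unfolding c_def .
      qed
      then have "ennreal (C1 * C2 * K powr (- (\<beta> + 1)) * r powr \<nu>)
          * (\<integral>\<^sup>+ w. P w * w\<beta> w * BR w * (ennreal (kdist w b powr (- \<nu>)) * indicator (tent b (200 * K * r)) w) \<partial>lborel)
        \<le> ennreal (C1 * C2 * K powr (- (\<beta> + 1)) * r powr \<nu>) * (Q * ennreal (c * (200 * K * r) powr (\<sigma> - \<nu>)))"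
        by (rule mult_left_mono) simp
      also have "\<dots> = Q * ennreal (C1 * C2 * K powr (- (\<beta> + 1)) * r powr \<nu> * (c * (200 * K * r) powr (\<sigma> - \<nu>)))"
        using C1 C2 c by (simp add: ennreal_mult mult_ac)
      also have "\<dots> = Q * ennreal (\<Theta> * K powr (- \<gamma>) * r powr \<sigma>)"
      proof (rule arg_cong[where f = "\<lambda>x. Q * ennreal x"])
        show "C1 * C2 * K powr (- (\<beta> + 1)) * r powr \<nu> * (c * (200 * K * r) powr (\<sigma> - \<nu>)) = \<Theta> * K powr (- \<gamma>) * r powr \<sigma>"
        proof -
        have "(200 * K * r) powr (\<sigma> - \<nu>) = 200 powr (\<sigma> - \<nu>) * K powr (\<sigma> - \<nu>) * r powr (\<sigma> - \<nu>)"
          using K0 r by (simp add: powr_mult)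
        moreover have "K powr (- (\<beta> + 1)) * K powr (\<sigma> - \<nu>) = K powr (- \<gamma>)"
        proof -
          have "- (\<beta> + 1) + (\<sigma> - \<nu>) = - \<gamma>" by (simp add: \<gamma>_def)
          then show ?thesis by (simp only: powr_add[symmetric])
        qed
        moreover have "r powr \<nu> * r powr (\<sigma> - \<nu>) = r powr \<sigma>"
          by (simp add: powr_add[symmetric])
        moreover have "C1 * C2 * K powr (- (\<beta> + 1)) * r powr \<nu> * (c * (200 powr (\<sigma> - \<nu>) * K powr (\<sigma> - \<nu>) * r powr (\<sigma> - \<nu>)))
          = \<Theta> * (K powr (- (\<beta> + 1)) * K powr (\<sigma> - \<nu>)) * (r powr \<nu> * r powr (\<sigma> - \<nu>))"
          unfolding \<Theta>_def by (simp only: mult_ac)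
        ultimately show ?thesis by (simp only:)
        qed
      qed
      also have "\<dots> \<le> Q * ennreal (1/2 * r powr \<sigma>)"
        by (intro mult_left_mono ennreal_leI mult_right_mono K\<Theta>) simp_all
      also have "\<dots> = ennreal (1/2) * Q * ennreal (r powr \<sigma>)"
        by (subst ennreal_mult) (simp_all only: mult_ac, simp_all)
      finally show ?thesis using le by (rule order_trans[rotated])
    qed
    have "I R b r \<le> (\<integral>\<^sup>+ z. ennreal S * (w\<beta> z * T z) + (ennreal (C1 * K powr t) * (F z * w\<beta> z * T z)
        + (\<integral>\<^sup>+ w. ennreal C1 * (P w * (BR w * U z w)) \<partial>lborel)) \<partial>lborel)"
      unfolding I_def
    proof (rule nn_integral_mono)
      fix z :: "complex ^ 'n"
      show "P z * w\<beta> z * indicator (ball 0 R) z * indicator (tent b r) z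
        \<le> ennreal S * (w\<beta> z * T z) + (ennreal (C1 * K powr t) * (F z * w\<beta> z * T z)
        + (\<integral>\<^sup>+ w. ennreal C1 * (P w * (BR w * U z w)) \<partial>lborel))"
      proof (cases "z \<in> ball 0 R \<and> z \<in> tent b r")
        case True
        then have z: "z \<in> ball 0 1" and zR: "norm z < R" and zT: "T z = 1" by (simp_all add: tent_def T_def)
        have dz: "defect z > 0" using defect_pos[OF z] .
        let ?G = "\<integral>\<^sup>+ w. P w * indicator (upper_set (K * defect z) z) w \<partial>lborel"
        \<comment> \<open>Higher points have larger defect and hence smaller norm, so the average
          over z with |z| < R only sees the truncated measure and the estimate closes on
          itself.\<close>
        have in_R: "w \<in> ball 0 R" if w: "w \<in> upper_set (K * defect z) z" for w
        proof -
          have "defect z \<le> K * defect z" using K dz mult_right_mono[of 1 K "defect z"] by simp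
          then have "defect z \<le> defect w" using w by (simp add: upper_set_def)
          then have "(norm w)\<^sup>2 \<le> (norm z)\<^sup>2" by (simp add: defect_def)
          then have "norm w \<le> norm z" by (rule power2_le_imp_le) simp
          then show ?thesis using zR by simp
        qed
        have "P z * w\<beta> z \<le> (ennreal S + (ennreal (C1 * K powr t) * F z
          + ennreal (C1 * (K * defect z) powr (- ?N)) * ?G)) * w\<beta> z"
          by (intro mult_right_mono pt z) simp
        also have "\<dots> = ennreal S * w\<beta> z + (ennreal (C1 * K powr t) * (F z * w\<beta> z)
          + ennreal (C1 * (K * defect z) powr (- ?N)) * w\<beta> z * ?G)"
          by (simp only: distrib_right distrib_left mult_ac)
        also have "ennreal (C1 * (K * defect z) powr (- ?N)) * w\<beta> z * ?G
          = (\<integral>\<^sup>+ w. ennreal (C1 * (K * defect z) powr (- ?N)) * w\<beta> z * (P w * indicator (upper_set (K * defect z) z) w) \<partial>lborel)"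
          by (rule nn_integral_cmult[symmetric]) measurable
        also have "\<dots> = (\<integral>\<^sup>+ w. ennreal C1 * (P w * (BR w * U z w)) \<partial>lborel)"
        proof (rule nn_integral_cong)
          fix w :: "complex ^ 'n"
          show "ennreal (C1 * (K * defect z) powr (- ?N)) * w\<beta> z * (P w * indicator (upper_set (K * defect z) z) w)
            = ennreal C1 * (P w * (BR w * U z w))"
          proof (cases "w \<in> upper_set (K * defect z) z")
            case wU: True
            have "BR w = 1" using in_R[OF wU] by (simp add: BR_def)
            moreover have "U z w = ennreal ((K * defect z) powr (- ?N)) * w\<beta> z"
              using wU True by (simp add: U_def w\<beta>_def ennreal_mult)
            moreover have "ennreal (C1 * (K * defect z) powr (- ?N)) = ennreal C1 * ennreal ((K * defect z) powr (- ?N))"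
              using C1 by (intro ennreal_mult) simp_all
            ultimately show ?thesis using wU by (simp add: mult_ac)
          qed (simp add: U_def)
        qed
        finally show ?thesis using True zT by simp
      qed auto
    qed
    also have "\<dots> = (\<integral>\<^sup>+ z. ennreal S * (w\<beta> z * T z) \<partial>lborel) + (\<integral>\<^sup>+ z. ennreal (C1 * K powr t) * (F z * w\<beta> z * T z)
        + (\<integral>\<^sup>+ w. ennreal C1 * (P w * (BR w * U z w)) \<partial>lborel) \<partial>lborel)"
      unfolding U_def by (rule nn_integral_add) measurable
    also have "(\<integral>\<^sup>+ z. ennreal (C1 * K powr t) * (F z * w\<beta> z * T z)
        + (\<integral>\<^sup>+ w. ennreal C1 * (P w * (BR w * U z w)) \<partial>lborel) \<partial>lborel)
      = (\<integral>\<^sup>+ z. ennreal (C1 * K powr t) * (F z * w\<beta> z * T z) \<partial>lborel)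
        + (\<integral>\<^sup>+ z. (\<integral>\<^sup>+ w. ennreal C1 * (P w * (BR w * U z w)) \<partial>lborel) \<partial>lborel)"
      unfolding U_def by (rule nn_integral_add) measurable
    also have "(\<integral>\<^sup>+ z. ennreal S * (w\<beta> z * T z) \<partial>lborel) = ennreal S * (\<integral>\<^sup>+ z. w\<beta> z * T z \<partial>lborel)"
      by (rule nn_integral_cmult) measurable
    also have "(\<integral>\<^sup>+ z. ennreal (C1 * K powr t) * (F z * w\<beta> z * T z) \<partial>lborel)
      = ennreal (C1 * K powr t) * (\<integral>\<^sup>+ z. F z * w\<beta> z * T z \<partial>lborel)"
      by (rule nn_integral_cmult) measurable
    finally have "I R b r \<le> ennreal S * (\<integral>\<^sup>+ z. w\<beta> z * T z \<partial>lborel)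
      + (ennreal (C1 * K powr t) * (\<integral>\<^sup>+ z. F z * w\<beta> z * T z \<partial>lborel)
        + (\<integral>\<^sup>+ z. (\<integral>\<^sup>+ w. ennreal C1 * (P w * (BR w * U z w)) \<partial>lborel) \<partial>lborel))" .
    also have "\<dots> \<le> ennreal S * ennreal (C3 * r powr \<sigma>)
      + (ennreal (C1 * K powr t) * (H * ennreal (r powr \<sigma>)) + ennreal (1/2) * Q * ennreal (r powr \<sigma>))"
    proof (intro add_mono mult_left_mono third)
      show "(\<integral>\<^sup>+ z. w\<beta> z * T z \<partial>lborel) \<le> ennreal (C3 * r powr \<sigma>)"
        unfolding w\<beta>_def T_def by (rule C3'[rule_format, OF b r])
      show "(\<integral>\<^sup>+ z. F z * w\<beta> z * T z \<partial>lborel) \<le> H * ennreal (r powr \<sigma>)"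
        unfolding T_def by (rule FJ[OF b r])
    qed simp_all
    also have "\<dots> = (A + ennreal (1/2) * Q) * ennreal (r powr \<sigma>)"
    proof -
      have "ennreal S * ennreal (C3 * r powr \<sigma>) = ennreal (S * C3) * ennreal (r powr \<sigma>)"
        using S C3 by (simp add: ennreal_mult mult.assoc)
      then show ?thesis unfolding A_def by (simp only: distrib_right mult.assoc add.assoc)
    qed
    finally show ?thesis .
  qed
  have bound: "I R b r \<le> 2 * A * ennreal (r powr \<sigma>)" if R: "R < 1" and b: "b \<in> ball 0 1" and r: "r > 0" for R b r
  proof -
    \<comment> \<open>The best Carleson constant of the truncated measure; \<open>Qle\<close> says
      that it is below every admissible one.\<close>
    define Q where "Q = (SUP x\<in>ball 0 1 \<times> {0<..}. I R (fst x) (snd x) * ennreal (snd x powr (- \<sigma>)))"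
    have one: "ennreal (r powr (- \<sigma>)) * ennreal (r powr \<sigma>) = 1" if "r > 0" for r :: real
      using that by (simp add: ennreal_mult[symmetric] powr_add[symmetric])
    have Q: "I R b r \<le> Q * ennreal (r powr \<sigma>)" if b: "b \<in> ball 0 1" and r: "r > 0" for b r
    proof -
      have "I R b r * ennreal (r powr (- \<sigma>)) \<le> Q"
        unfolding Q_def using b r by (intro SUP_upper2[of "(b, r)"]) simp_all
      then have "I R b r * ennreal (r powr (- \<sigma>)) * ennreal (r powr \<sigma>) \<le> Q * ennreal (r powr \<sigma>)"
        by (rule mult_right_mono) simp
      then show ?thesis using one[OF r] by (simp add: mult.assoc)
    qed
    have Qle: "Q \<le> D" if D: "\<And>b r. b \<in> ball 0 1 \<Longrightarrow> r > 0 \<Longrightarrow> I R b r \<le> D * ennreal (r powr \<sigma>)" for D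
      unfolding Q_def
    proof (rule SUP_least)
      fix x :: "(complex ^ 'n) \<times> real" assume "x \<in> ball 0 1 \<times> {0<..}"
      then have x: "fst x \<in> ball 0 1" "snd x > 0" by (simp_all add: mem_Times_iff)
      have "I R (fst x) (snd x) * ennreal (snd x powr (- \<sigma>)) \<le> D * ennreal (snd x powr \<sigma>) * ennreal (snd x powr (- \<sigma>))"
        by (rule mult_right_mono[OF D[OF x]]) simp
      also have "\<dots> = D" using one[OF x(2)] by (simp add: mult.assoc mult.commute[of "ennreal (snd x powr \<sigma>)"])
      finally show "I R (fst x) (snd x) * ennreal (snd x powr (- \<sigma>)) \<le> D" .
    qed
    obtain SR where SR: "SR \<ge> 0" and SR': "\<forall>z. norm z \<le> R \<longrightarrow> norm (f z) powr p \<le> SR"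
      using powr_bounded_on_compact[OF cont R p] by (elim exE conjE)
    \<comment> \<open>A crude bound depending on R, used only for finiteness: f is bounded on |z| <=
      R and d^\<beta> dV is itself \<sigma>-Carleson.\<close>
    have "Q \<le> ennreal (SR * C3)"
    proof (rule Qle)
      fix b :: "complex ^ 'n" and r :: real assume b: "b \<in> ball 0 1" and r: "r > 0"
      have "I R b r \<le> (\<integral>\<^sup>+ z. ennreal SR * (ennreal (defect z powr \<beta>) * indicator (tent b r) z) \<partial>lborel)"
        unfolding I_def
      proof (rule nn_integral_mono)
        fix z :: "complex ^ 'n"
        show "P z * w\<beta> z * indicator (ball 0 R) z * indicator (tent b r) z
          \<le> ennreal SR * (ennreal (defect z powr \<beta>) * indicator (tent b r) z)"
        proof (cases "z \<in> ball 0 R")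
          case True
          then have "P z \<le> ennreal SR" unfolding P_def by (intro ennreal_leI SR'[rule_format]) simp
          then have "P z * (w\<beta> z * indicator (tent b r) z) \<le> ennreal SR * (w\<beta> z * indicator (tent b r) z)"
            by (rule mult_right_mono) simp
          then show ?thesis using True by (simp add: w\<beta>_def mult.assoc)
        qed simp
      qed
      also have "\<dots> = ennreal SR * (\<integral>\<^sup>+ z. ennreal (defect z powr \<beta>) * indicator (tent b r) z \<partial>lborel)"
        by (rule nn_integral_cmult) measurable
      also have "\<dots> \<le> ennreal SR * ennreal (C3 * r powr \<sigma>)"
        by (intro mult_left_mono C3'[rule_format] b r) simp
      also have "\<dots> = ennreal (SR * C3) * ennreal (r powr \<sigma>)"
        using SR C3 by (simp add: ennreal_mult mult.assoc)
      finally show "I R b r \<le> ennreal (SR * C3) * ennreal (r powr \<sigma>)" .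
    qed
    then have Qfin: "Q < \<infinity>" by (simp add: order.strict_trans1)
    have "Q \<le> A + ennreal (1/2) * Q"
      by (rule Qle) (rule step[OF R Q])
    then have "Q \<le> 2 * A" using Qfin by (rule ennreal_absorb_half)
    then have "Q * ennreal (r powr \<sigma>) \<le> 2 * A * ennreal (r powr \<sigma>)" by (rule mult_right_mono) simp
    then show ?thesis using Q[OF b r] by (rule order_trans[rotated])
  qed
  have full: "(\<integral>\<^sup>+ z. (P z * w\<beta> z) * indicator (tent b r) z \<partial>lborel) \<le> (2 * A) * ennreal (r powr \<sigma>)"
    if b: "b \<in> ball 0 1" and r: "r > 0" for b r
  proof -
    \<comment> \<open>Radii increasing to 1; the bound 2A does not depend on the radius and passes
      to the limit by monotone convergence.\<close>
    define R where "R i = 1 - 1 / real (Suc i)" for i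
    have R1: "R i < 1" for i by (simp add: R_def)
    have Rm: "R i \<le> R j" if "i \<le> j" for i j
      using that by (simp add: R_def frac_le)
    define g where "g i z = P z * w\<beta> z * indicator (ball 0 (R i)) z * indicator (tent b r) z" for i z
    have [measurable]: "g i \<in> borel_measurable lborel" for i
    proof -
      have [measurable]: "(indicator (ball 0 (R i)) :: complex ^ 'n \<Rightarrow> ennreal) \<in> borel_measurable borel"
        by (simp add: borel_measurable_indicator)
      show ?thesis unfolding g_def[abs_def] by measurable
    qed
    have inc: "incseq g"
    proof (rule incseq_SucI, rule le_funI)
      fix i and z :: "complex ^ 'n"
      have "R i \<le> R (Suc i)" by (rule Rm) simp
      then have "indicator (ball 0 (R i)) z \<le> (indicator (ball 0 (R (Suc i))) z :: ennreal)"
        by (simp add: indicator_def)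
      then show "g i z \<le> g (Suc i) z" unfolding g_def by (intro mult_right_mono mult_left_mono) simp_all
    qed
    have "(\<integral>\<^sup>+ z. (P z * w\<beta> z) * indicator (tent b r) z \<partial>lborel) \<le> (\<integral>\<^sup>+ z. (SUP i. g i z) \<partial>lborel)"
    proof (rule nn_integral_mono)
      fix z
      show "(P z * w\<beta> z) * indicator (tent b r) z \<le> (SUP i. g i z)"
      proof (cases "z \<in> tent b r")
        case True
        then have "0 < 1 - norm z" by (simp add: tent_def)
        then obtain i where "inverse (real (Suc i)) < 1 - norm z" using reals_Archimedean by blast
        then have "norm z < R i" by (simp add: R_def inverse_eq_divide)
        then have "(P z * w\<beta> z) * indicator (tent b r) z = g i z" by (simp add: g_def)
        also have "\<dots> \<le> (SUP i. g i z)" by (rule SUP_upper) simp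
        finally show ?thesis .
      qed simp
    qed
    also have "\<dots> = (SUP i. \<integral>\<^sup>+ z. g i z \<partial>lborel)"
      by (rule nn_integral_monotone_convergence_SUP[OF inc]) measurable
    also have "\<dots> \<le> (2 * A) * ennreal (r powr \<sigma>)"
      by (rule SUP_least) (use bound[OF R1 b r] in \<open>simp add: g_def I_def\<close>)
    finally show ?thesis .
  qed
  define M' where "M' = (2 * A) * ennreal (2 powr (2 * \<sigma>) / (1 - 2 powr (- \<sigma>)) * 2 powr \<sigma>)"
  show ?thesis
  proof (intro exI[of _ M'] conjI ballI)
    show "M' < \<infinity>" using A by (simp add: M'_def ennreal_mult_less_top)
    fix a :: "complex ^ 'n" assume a: "a \<in> ball 0 1"
    have "(\<integral>\<^sup>+ z. (P z * w\<beta> z) * ennreal (defect a powr \<sigma> * kdist z a powr (- 2 * \<sigma>)) * indicator (ball 0 1) z \<partial>lborel) \<le> M'"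
      unfolding M'_def by (rule carleson_of_tent_le[OF \<sigma>(1) _ full a]) measurable
    then show "(\<integral>\<^sup>+ z. ennreal (norm (f z) powr p * (defect z powr \<beta> * mweight \<sigma> a z)) * indicator (ball 0 1) z \<partial>lborel) \<le> M'"
      unfolding mweight_def[symmetric] P_def w\<beta>_def
      by (simp add: ennreal_mult mweight_nonneg mult.assoc)
  qed
qed

section \<open>The theorem\<close>

lemma nn_integral_ball_vol:
  fixes g :: "complex ^ 'n \<Rightarrow> ennreal"
  assumes g: "g \<in> borel_measurable borel"
  shows "(\<integral>\<^sup>+ z. g z \<partial>ball_vol)
    = ennreal (1 / measure lborel (ball (0 :: complex ^ 'n) 1)) * (\<integral>\<^sup>+ z. g z * indicator (ball 0 1) z \<partial>lborel)"
proof -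
  let ?B = "ball (0 :: complex ^ 'n) 1"
  define V where "V = measure lborel ?B"
  have V: "V > 0" unfolding V_def by (simp add: content_ball_pos)
  have eV: "emeasure lborel ?B = ennreal V"
    unfolding V_def using emeasure_lborel_ball_finite[of "0::complex ^ 'n" 1]
    by (intro emeasure_eq_ennreal_measure) simp
  have gr: "g \<in> borel_measurable (restrict_space lborel ?B)"
    using g by (intro measurable_restrict_space1) simp
  have B: "?B \<in> sets (restrict_space lborel ?B)" by (simp add: sets_restrict_space_iff)
  have "(\<integral>\<^sup>+ z. g z \<partial>ball_vol)
    = (\<integral>\<^sup>+ z. g z * indicator ?B z \<partial>restrict_space lborel ?B) / emeasure (restrict_space lborel ?B) ?B"
    unfolding ball_vol_def by (rule nn_integral_uniform_measure[OF gr B])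
  also have "emeasure (restrict_space lborel ?B) ?B = ennreal V"
    by (subst emeasure_restrict_space) (simp_all add: eV)
  also have "(\<integral>\<^sup>+ z. g z * indicator ?B z \<partial>restrict_space lborel ?B)
    = (\<integral>\<^sup>+ z. g z * indicator ?B z * indicator ?B z \<partial>lborel)"
    by (rule nn_integral_restrict_space) simp
  also have "\<dots> = (\<integral>\<^sup>+ z. g z * indicator ?B z \<partial>lborel)"
    by (intro nn_integral_cong) (simp split: split_indicator)
  also have "\<dots> / ennreal V = ennreal (1 / V) * (\<integral>\<^sup>+ z. g z * indicator ?B z \<partial>lborel)"
    using V by (simp add: divide_ennreal_def inverse_ennreal inverse_eq_divide mult.commute)
  finally show ?thesis by (simp only: V_def)
qed

text \<open>The integrand G involves f, whose values off the ball are arbitrary, so it need not be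
  Borel on the whole space. It is exchanged for a Borel function g that agrees with it on the
  ball.\<close>

lemma nn_integral_ball_vol_density:
  fixes G g :: "complex ^ 'n \<Rightarrow> ennreal" and h :: "complex ^ 'n \<Rightarrow> real"
  assumes h [measurable]: "h \<in> borel_measurable borel" and g [measurable]: "g \<in> borel_measurable borel"
    and eq: "\<And>z. z \<in> ball 0 1 \<Longrightarrow> G z = g z"
  shows "(\<integral>\<^sup>+ z. G z \<partial>density ball_vol (\<lambda>z. ennreal (h z)))
    = ennreal (1 / measure lborel (ball (0 :: complex ^ 'n) 1)) * (\<integral>\<^sup>+ z. ennreal (h z) * g z * indicator (ball 0 1) z \<partial>lborel)"
proof -
  have meas: "f \<in> borel_measurable ball_vol" if "f \<in> borel_measurable borel" for f :: "complex ^ 'n \<Rightarrow> ennreal"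
  proof -
    have "f \<in> borel_measurable (restrict_space lborel (ball 0 1))"
      using that by (intro measurable_restrict_space1) simp
    then show ?thesis by (simp add: ball_vol_def cong: measurable_cong_sets)
  qed
  have "(\<integral>\<^sup>+ z. G z \<partial>density ball_vol (\<lambda>z. ennreal (h z))) = (\<integral>\<^sup>+ z. g z \<partial>density ball_vol (\<lambda>z. ennreal (h z)))"
    by (intro nn_integral_cong) (simp add: space_ball_vol eq)
  also have "\<dots> = (\<integral>\<^sup>+ z. ennreal (h z) * g z \<partial>ball_vol)"
  proof (rule nn_integral_density)
    have "(\<lambda>z. ennreal (h z)) \<in> borel_measurable borel" by measurable
    then show "(\<lambda>z. ennreal (h z)) \<in> borel_measurable ball_vol" by (rule meas)
    show "g \<in> borel_measurable ball_vol" by (rule meas[OF g])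
  qed
  also have "\<dots> = ennreal (1 / measure lborel (ball (0 :: complex ^ 'n) 1)) * (\<integral>\<^sup>+ z. ennreal (h z) * g z * indicator (ball 0 1) z \<partial>lborel)"
    by (rule nn_integral_ball_vol) measurable
  finally show ?thesis .
qed

lemma SUP_cmult_less_top_iff:
  assumes c: "c > 0" and eq: "\<And>a. a \<in> A \<Longrightarrow> Y a = ennreal c * X a"
  shows "(SUP a\<in>A. Y a) < \<infinity> \<longleftrightarrow> (\<exists>M<\<infinity>. \<forall>a\<in>A. X a \<le> (M :: ennreal))"
proof
  assume fin: "(SUP a\<in>A. Y a) < \<infinity>"
  show "\<exists>M<\<infinity>. \<forall>a\<in>A. X a \<le> M"
  proof (intro exI[of _ "ennreal (1 / c) * (SUP a\<in>A. Y a)"] conjI ballI)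
    show "ennreal (1 / c) * (SUP a\<in>A. Y a) < \<infinity>" using fin by (simp add: ennreal_mult_less_top)
    fix a assume a: "a \<in> A"
    have "X a = ennreal (1 / c) * (ennreal c * X a)"
      using c by (simp add: mult.assoc[symmetric] ennreal_mult[symmetric])
    also have "\<dots> \<le> ennreal (1 / c) * (SUP a\<in>A. Y a)"
      unfolding eq[OF a, symmetric] by (intro mult_left_mono SUP_upper a) simp
    finally show "X a \<le> ennreal (1 / c) * (SUP a\<in>A. Y a)" .
  qed
next
  assume "\<exists>M<\<infinity>. \<forall>a\<in>A. X a \<le> M"
  then obtain M where M: "M < \<infinity>" "\<forall>a\<in>A. X a \<le> M" by (elim exE conjE)
  have "(SUP a\<in>A. Y a) \<le> ennreal c * M"
  proof (rule SUP_least)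
    fix a assume a: "a \<in> A"
    show "Y a \<le> ennreal c * M" unfolding eq[OF a] using M(2) a by (intro mult_left_mono) simp_all
  qed
  also have "\<dots> < \<infinity>" using M(1) by (simp add: ennreal_mult_less_top)
  finally show "(SUP a\<in>A. Y a) < \<infinity>" .
qed

text \<open>The power of d(z) is split off so that it can merge with d(z)^q and the density of the
  measure into the single weight d^\<beta>; what remains is the kernel tested in the Carleson
  condition.\<close>

lemma moebius_weight_eq:
  assumes a: "a \<in> ball 0 1" and z: "z \<in> ball 0 1"
  shows "(1 - (norm (Phi a z))\<^sup>2) powr \<sigma> = defect z powr \<sigma> * mweight \<sigma> a z"
proof -
  have k: "kdist z a > 0" using kdist_pos[OF z a] .
  have d: "defect a > 0" "defect z > 0" using defect_pos[OF a] defect_pos[OF z] by simp_all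
  have "(1 - (norm (Phi a z))\<^sup>2) powr \<sigma> = (defect a * defect z) powr \<sigma> / ((kdist z a)\<^sup>2) powr \<sigma>"
    unfolding one_minus_norm_Phi_sq[OF a z] using d by (intro powr_divide)
  also have "((kdist z a)\<^sup>2) powr \<sigma> = kdist z a powr (2 * \<sigma>)"
    using k powr_realpow[of "kdist z a" 2] powr_powr[of "kdist z a" 2 \<sigma>] by simp
  also have "(defect a * defect z) powr \<sigma> = defect a powr \<sigma> * defect z powr \<sigma>" using d by (intro powr_mult)
  finally show ?thesis by (simp add: mweight_def powr_minus divide_inverse mult_ac)
qed

theorem theorem3p2:
  fixes f :: "complex ^ 'n \<Rightarrow> complex" and p q s \<alpha> :: real
  assumes "holomorphic_Cn_on f (ball 0 1)"
    and "q > 0"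
    and "s > max 0 (1 - q / real CARD('n))"
    and "\<alpha> > q + real CARD('n) * s - real CARD('n) - 1"
    and "p \<ge> 2 * (real CARD('n) + 1 + \<alpha>)"
  shows "f \<in> N_space p q s \<longleftrightarrow>
    (SUP a \<in> ball 0 1. \<integral>\<^sup>+ z. (\<integral>\<^sup>+ w. ennreal
        (norm (f z - f w) powr p / norm (Phi_num w z) powr (2 * (real CARD('n) + 1 + \<alpha>))
          * (1 - (norm z)\<^sup>2) powr q
          * (1 - (norm (Phi a z))\<^sup>2) powr (real CARD('n) * s))
        \<partial>weighted_vol \<alpha>) \<partial>weighted_vol \<alpha>) < \<infinity>"
proof -
  define n where "n = real CARD('n)"
  define \<sigma> where "\<sigma> = n * s"
  define \<beta> where "\<beta> = q + \<sigma> - n - 1"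
  define t where "t = n + 1 + \<alpha>"
  have n: "n \<ge> 1" using zero_less_card_finite[where 'a='n] by (simp add: n_def)
  have q: "q > 0" by fact
  have s: "s > 0" "1 - q / n < s" using assms(3) by (simp_all add: n_def)
  have \<sigma>: "\<sigma> > 0" using s n by (simp add: \<sigma>_def)
  have "n * (1 - q / n) < \<sigma>" unfolding \<sigma>_def using s n by (intro mult_strict_left_mono) simp_all
  then have \<sigma>q: "n - q < \<sigma>" using n by (simp add: right_diff_distrib)
  have \<beta>: "\<beta> > -1" using \<sigma>q by (simp add: \<beta>_def)
  have \<alpha>: "\<beta> < \<alpha>" using assms(4) by (simp add: \<beta>_def \<sigma>_def n_def)
  have \<alpha>1: "\<alpha> > -1" using \<alpha> \<beta> by linarith
  have t1: "t > 1" using \<alpha>1 n by (simp add: t_def)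
  have p: "p > 1" "p \<ge> 2 * t" using assms(5) t1 by (simp_all add: t_def n_def)
  \<comment> \<open>Here n + 1 + t + \<beta> = t + q + \<sigma>, and \<alpha> > \<beta> gives t > q
    + \<sigma> > \<sigma>.\<close>
  have \<sigma>t: "2 * \<sigma> < n + 1 + t + \<beta>" using \<alpha> q by (simp add: \<beta>_def t_def)
  have \<sigma>\<beta>: "\<sigma> \<le> n + 1 + \<beta>" using q by (simp add: \<beta>_def)
  \<comment> \<open>The midpoint of the admissible interval: \<sigma> - \<nu> < \<beta> + 1 is the
    same as \<nu> > n - q. The interval is nonempty by q > 0, n > 0, \<sigma> > 0 and \<sigma> > n -
    q.\<close>
  define \<nu> where "\<nu> = (max 0 (n - q) + min n \<sigma>) / 2"
  have \<nu>: "0 \<le> \<nu>" "\<nu> \<le> n" "\<nu> < \<sigma>" "\<sigma> - \<nu> < \<beta> + 1"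
  proof -
    have m: "max 0 (n - q) < min n \<sigma>" using n q \<sigma> \<sigma>q by simp
    have m': "0 \<le> max 0 (n - q)" "n - q \<le> max 0 (n - q)" "min n \<sigma> \<le> n" "min n \<sigma> \<le> \<sigma>" by simp_all
    have 2: "2 * \<nu> = max 0 (n - q) + min n \<sigma>" by (simp add: \<nu>_def)
    show "0 \<le> \<nu>" using m m' 2 by linarith
    show "\<nu> \<le> n" using m m' 2 by linarith
    show "\<nu> < \<sigma>" using m m' 2 by linarith
    show "\<sigma> - \<nu> < \<beta> + 1" unfolding \<beta>_def using m m' 2 by linarith
  qed
  \<comment> \<open>Extension by zero makes the function Borel on the whole space; on the open ball
    nothing changes, including holomorphy.\<close>
  define f0 where "f0 z = (if z \<in> ball 0 1 then f z else 0)" for z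
  have f0: "f0 z = f z" if "z \<in> ball 0 1" for z using that by (simp add: f0_def)
  have cont: "continuous_on (ball 0 1) f" by (rule holomorphic_Cn_on_continuous[OF assms(1)])
  have f0m [measurable]: "f0 \<in> borel_measurable borel"
  proof -
    have "(\<lambda>z. indicat_real (ball 0 1) z *\<^sub>R f z) \<in> borel_measurable borel"
      by (rule borel_measurable_continuous_on_indicator[OF _ cont]) simp
    also have "(\<lambda>z. indicat_real (ball 0 1) z *\<^sub>R f z) = f0"
      by (simp add: fun_eq_iff f0_def indicator_def)
    finally show ?thesis .
  qed
  have f0h: "holomorphic_Cn_on f0 (ball 0 1)"
    unfolding holomorphic_Cn_on_def
  proof
    fix z :: "complex ^ 'n" assume z: "z \<in> ball 0 1"
    obtain D where D: "(f has_derivative D) (at z)" "\<forall>c v. D (c *s v) = c * D v"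
      using assms(1) z unfolding holomorphic_Cn_on_def by blast
    have "(f0 has_derivative D) (at z)"
      by (rule has_derivative_transform_within_open[OF D(1) open_ball z]) (simp add: f0)
    then show "\<exists>D. (f0 has_derivative D) (at z) \<and> (\<forall>c v. D (c *s v) = c * D v)" using D(2) by blast
  qed
  have f0c: "continuous_on (ball 0 1) f0" by (rule holomorphic_Cn_on_continuous[OF f0h])
  define N where "N a = (\<integral>\<^sup>+ z. ennreal (norm (f0 z) powr p * (defect z powr \<beta> * mweight \<sigma> a z)) * indicator (ball 0 1) z \<partial>lborel)" for a
  define J where "J a = (\<integral>\<^sup>+ z. diff_int t \<alpha> p f0 z * ennreal (defect z powr \<beta> * mweight \<sigma> a z) * indicator (ball 0 1) z \<partial>lborel)" for a
  have main: "(\<exists>M<\<infinity>. \<forall>a\<in>ball 0 1. N a \<le> M) \<longleftrightarrow> (\<exists>M<\<infinity>. \<forall>a\<in>ball 0 1. J a \<le> M)"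
  proof
    assume "\<exists>M<\<infinity>. \<forall>a\<in>ball 0 1. N a \<le> M"
    then obtain M where M: "M < \<infinity>" "\<forall>a\<in>ball 0 1. N a \<le> M" by (elim exE conjE)
    obtain C where C: "\<forall>f :: complex ^ 'n \<Rightarrow> complex. f \<in> borel_measurable borel \<longrightarrow> holomorphic_Cn_on f (ball 0 1) \<longrightarrow>
      (\<forall>a \<in> ball 0 1. (\<integral>\<^sup>+ z. diff_int t \<alpha> p f z * ennreal (defect z powr \<beta> * mweight \<sigma> a z) * indicator (ball 0 1) z \<partial>lborel)
      \<le> ennreal C * (\<integral>\<^sup>+ z. ennreal (norm (f z) powr p * (defect z powr \<beta> * mweight \<sigma> a z)) * indicator (ball 0 1) z \<partial>lborel))"
      using difference_form_le[OF t_def[unfolded n_def] \<alpha>1 \<beta> \<alpha> \<sigma> \<sigma>t[unfolded n_def] p] by (elim exE conjE)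
    show "\<exists>M<\<infinity>. \<forall>a\<in>ball 0 1. J a \<le> M"
    proof (intro exI[of _ "ennreal C * M"] conjI ballI)
      show "ennreal C * M < \<infinity>" using M(1) by (simp add: ennreal_mult_less_top)
      fix a :: "complex ^ 'n" assume a: "a \<in> ball 0 1"
      have "J a \<le> ennreal C * N a" unfolding J_def N_def by (rule C[rule_format, OF f0m f0h a])
      also have "\<dots> \<le> ennreal C * M" using M(2) a by (intro mult_left_mono) simp_all
      finally show "J a \<le> ennreal C * M" .
    qed
  next
    assume "\<exists>M<\<infinity>. \<forall>a\<in>ball 0 1. J a \<le> M"
    then obtain M where M: "M < \<infinity>" "\<forall>a\<in>ball 0 1. J a \<le> M" by (elim exE conjE)
    have t0: "t > 0" and p0: "p > 0" using t1 p by simp_all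
    show "\<exists>M<\<infinity>. \<forall>a\<in>ball 0 1. N a \<le> M"
      unfolding N_def
      by (rule carleson_of_difference_form[OF t_def[unfolded n_def] t0 p0 \<beta> \<sigma> \<sigma>\<beta>[unfolded n_def]
          \<nu>(1) \<nu>(2)[unfolded n_def] \<nu>(3,4) f0m f0c M(1) M(2)[rule_format, unfolded J_def]])
  qed
  define V where "V = measure lborel (ball (0 :: complex ^ 'n) 1)"
  have V: "V > 0" unfolding V_def by (simp add: content_ball_pos)
  define g where "g = Gamma (real CARD('n) + \<alpha> + 1) / (fact CARD('n) * Gamma (\<alpha> + 1))"
  have g: "g > 0" unfolding g_def using \<alpha>1 by (intro divide_pos_pos mult_pos_pos Gamma_real_pos) simp_all
  have Neq: "(\<integral>\<^sup>+ z. ennreal (norm (f z) powr p * (1 - (norm z)\<^sup>2) powr q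
      * (1 - (norm (Phi a z))\<^sup>2) powr (real CARD('n) * s)) \<partial>invariant_vol) = ennreal (1 / V) * N a"
    if a: "a \<in> ball 0 1" for a
  proof -
    have "(\<integral>\<^sup>+ z. ennreal (norm (f z) powr p * (1 - (norm z)\<^sup>2) powr q
      * (1 - (norm (Phi a z))\<^sup>2) powr (real CARD('n) * s)) \<partial>invariant_vol)
      = ennreal (1 / V) * (\<integral>\<^sup>+ z. ennreal (defect z powr (- n - 1))
          * ennreal (norm (f0 z) powr p * defect z powr q * (defect z powr \<sigma> * mweight \<sigma> a z)) * indicator (ball 0 1) z \<partial>lborel)"
      unfolding invariant_vol_def V_def defect_def[symmetric] n_def[symmetric] \<sigma>_def[symmetric]
    proof (rule nn_integral_ball_vol_density)
      fix z :: "complex ^ 'n" assume z: "z \<in> ball 0 1"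
      show "ennreal (norm (f z) powr p * defect z powr q * defect (Phi a z) powr \<sigma>)
        = ennreal (norm (f0 z) powr p * defect z powr q * (defect z powr \<sigma> * mweight \<sigma> a z))"
        unfolding defect_def[of "Phi a z"] moebius_weight_eq[OF a z] f0[OF z] ..
    qed measurable
    also have "(\<integral>\<^sup>+ z. ennreal (defect z powr (- n - 1))
          * ennreal (norm (f0 z) powr p * defect z powr q * (defect z powr \<sigma> * mweight \<sigma> a z)) * indicator (ball 0 1) z \<partial>lborel) = N a"
      unfolding N_def
    proof (rule nn_integral_cong)
      fix z :: "complex ^ 'n"
      have e: "defect z powr \<beta> = defect z powr (- n - 1) * (defect z powr q * defect z powr \<sigma>)"
        by (simp add: powr_add[symmetric] \<beta>_def algebra_simps)
      have "defect z powr (- n - 1) * (norm (f0 z) powr p * defect z powr q * (defect z powr \<sigma> * mweight \<sigma> a z))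
        = norm (f0 z) powr p * (defect z powr \<beta> * mweight \<sigma> a z)"
        unfolding e by (simp only: mult_ac)
      then show "ennreal (defect z powr (- n - 1))
          * ennreal (norm (f0 z) powr p * defect z powr q * (defect z powr \<sigma> * mweight \<sigma> a z)) * indicator (ball 0 1) z
        = ennreal (norm (f0 z) powr p * (defect z powr \<beta> * mweight \<sigma> a z)) * indicator (ball 0 1) z"
        by (simp only: ennreal_mult'[OF powr_ge_zero, symmetric])
    qed
    finally show ?thesis .
  qed
  have Jeq: "(\<integral>\<^sup>+ z. (\<integral>\<^sup>+ w. ennreal
        (norm (f z - f w) powr p / norm (Phi_num w z) powr (2 * (real CARD('n) + 1 + \<alpha>))
          * (1 - (norm z)\<^sup>2) powr q
          * (1 - (norm (Phi a z))\<^sup>2) powr (real CARD('n) * s))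
        \<partial>weighted_vol \<alpha>) \<partial>weighted_vol \<alpha>) = ennreal ((g / V) * (g / V)) * J a"
    if a: "a \<in> ball 0 1" for a
  proof -
    have dens: "weighted_vol \<alpha> = density ball_vol (\<lambda>z :: complex ^ 'n. ennreal (g * defect z powr \<alpha>))"
      by (simp add: weighted_vol_def g_def defect_def)
    define A where "A z w = norm (f0 z - f0 w) powr p * pdist z w powr (- 2 * t)
        * defect z powr q * (defect z powr \<sigma> * mweight \<sigma> a z)" for z w
    define I where "I z = (\<integral>\<^sup>+ w. ennreal (g * defect w powr \<alpha>) * ennreal (A z w) * indicator (ball 0 1) w \<partial>lborel)" for z
    have [measurable]: "(\<lambda>w. ennreal (A z w)) \<in> borel_measurable borel" for z unfolding A_def by measurable
    have [measurable]: "I \<in> borel_measurable borel" unfolding I_def[abs_def] A_def by measurable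
    have inner: "(\<integral>\<^sup>+ w. ennreal
        (norm (f z - f w) powr p / norm (Phi_num w z) powr (2 * (real CARD('n) + 1 + \<alpha>))
          * (1 - (norm z)\<^sup>2) powr q
          * (1 - (norm (Phi a z))\<^sup>2) powr (real CARD('n) * s)) \<partial>weighted_vol \<alpha>) = ennreal (1 / V) * I z"
      if z: "z \<in> ball 0 1" for z
      unfolding dens V_def I_def
    proof (rule nn_integral_ball_vol_density)
      fix w :: "complex ^ 'n" assume w: "w \<in> ball 0 1"
      \<comment> \<open>The statement has the numerator based at w, the estimates have it based at
        z; \<open>pdist\<close> is symmetric, so both have the same norm.\<close>
      have "norm (f z - f w) powr p / pdist z w powr (2 * t) * defect z powr q * (defect z powr \<sigma> * mweight \<sigma> a z) = A z w"
        unfolding A_def f0[OF z] f0[OF w] by (simp add: powr_minus divide_inverse)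
      then show "ennreal (norm (f z - f w) powr p / norm (Phi_num w z) powr (2 * (real CARD('n) + 1 + \<alpha>))
          * (1 - (norm z)\<^sup>2) powr q * (1 - (norm (Phi a z))\<^sup>2) powr (real CARD('n) * s)) = ennreal (A z w)"
        unfolding pdist_eq[OF w] pdist_commute[of w z] defect_def[of z, symmetric] n_def[symmetric]
          \<sigma>_def[symmetric] moebius_weight_eq[OF a z] t_def[symmetric] by (simp only:)
    qed measurable
    have "(\<integral>\<^sup>+ z. (\<integral>\<^sup>+ w. ennreal
        (norm (f z - f w) powr p / norm (Phi_num w z) powr (2 * (real CARD('n) + 1 + \<alpha>))
          * (1 - (norm z)\<^sup>2) powr q
          * (1 - (norm (Phi a z))\<^sup>2) powr (real CARD('n) * s))
        \<partial>weighted_vol \<alpha>) \<partial>weighted_vol \<alpha>)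
      = (\<integral>\<^sup>+ z. ennreal (1 / V) * I z \<partial>weighted_vol \<alpha>)"
      by (intro nn_integral_cong inner) (simp add: weighted_vol_def space_ball_vol)
    also have "\<dots> = ennreal (1 / V) * (\<integral>\<^sup>+ z. ennreal (g * defect z powr \<alpha>) * (ennreal (1 / V) * I z) * indicator (ball 0 1) z \<partial>lborel)"
      unfolding dens V_def by (rule nn_integral_ball_vol_density[OF _ _ refl]) measurable
    also have "(\<integral>\<^sup>+ z. ennreal (g * defect z powr \<alpha>) * (ennreal (1 / V) * I z) * indicator (ball 0 1) z \<partial>lborel)
      = (\<integral>\<^sup>+ z. ennreal (g * g / V) * (diff_int t \<alpha> p f0 z * ennreal (defect z powr \<beta> * mweight \<sigma> a z) * indicator (ball 0 1) z) \<partial>lborel)"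
    proof (rule nn_integral_cong)
      fix z :: "complex ^ 'n"
      \<comment> \<open>Bookkeeping of the z-weight: \<alpha> + q + \<sigma> = t + \<beta>. The
        power t completes the kernel \<open>pker\<close>, and \<beta> is the weight on the norm side
        as well.\<close>
      have e: "defect z powr \<alpha> * (defect z powr q * defect z powr \<sigma>) = defect z powr t * defect z powr \<beta>"
        by (simp add: powr_add[symmetric] \<beta>_def t_def algebra_simps)
      have "ennreal (defect z powr \<alpha>) * I z = (\<integral>\<^sup>+ w. ennreal (defect z powr \<alpha>) * (ennreal (g * defect w powr \<alpha>) * ennreal (A z w) * indicator (ball 0 1) w) \<partial>lborel)"
        unfolding I_def by (rule nn_integral_cmult[symmetric]) measurable
      also have "\<dots> = (\<integral>\<^sup>+ w. ennreal (g * (defect z powr \<beta> * mweight \<sigma> a z)) * (ennreal (norm (f0 z - f0 w) powr p * pker t \<alpha> z w) * indicator (ball 0 1) w) \<partial>lborel)"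
      proof (rule nn_integral_cong)
        fix w :: "complex ^ 'n"
        have "defect z powr \<alpha> * (g * defect w powr \<alpha> * A z w)
          = g * (norm (f0 z - f0 w) powr p * pdist z w powr (- 2 * t) * defect w powr \<alpha>)
            * (defect z powr \<alpha> * (defect z powr q * defect z powr \<sigma>)) * mweight \<sigma> a z"
          unfolding A_def by (simp only: mult_ac)
        also have "\<dots> = (g * (defect z powr \<beta> * mweight \<sigma> a z)) * (norm (f0 z - f0 w) powr p * pker t \<alpha> z w)"
          unfolding e pker_def by (simp only: mult_ac)
        finally have r: "defect z powr \<alpha> * (g * defect w powr \<alpha> * A z w)
          = (g * (defect z powr \<beta> * mweight \<sigma> a z)) * (norm (f0 z - f0 w) powr p * pker t \<alpha> z w)" .
        have nn: "0 \<le> g * defect w powr \<alpha>" "0 \<le> g * (defect z powr \<beta> * mweight \<sigma> a z)"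
          using g by (simp_all add: mweight_nonneg)
        have "ennreal (defect z powr \<alpha>) * (ennreal (g * defect w powr \<alpha>) * ennreal (A z w))
          = ennreal (defect z powr \<alpha> * (g * defect w powr \<alpha> * A z w))"
          by (simp only: ennreal_mult'[OF powr_ge_zero] ennreal_mult'[OF nn(1)])
        also have "\<dots> = ennreal (g * (defect z powr \<beta> * mweight \<sigma> a z)) * ennreal (norm (f0 z - f0 w) powr p * pker t \<alpha> z w)"
          unfolding r by (simp only: ennreal_mult'[OF nn(2)])
        finally show "ennreal (defect z powr \<alpha>) * (ennreal (g * defect w powr \<alpha>) * ennreal (A z w) * indicator (ball 0 1) w)
          = ennreal (g * (defect z powr \<beta> * mweight \<sigma> a z)) * (ennreal (norm (f0 z - f0 w) powr p * pker t \<alpha> z w) * indicator (ball 0 1) w)"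
          by (simp only: mult.assoc[symmetric])
      qed
      also have "\<dots> = ennreal (g * (defect z powr \<beta> * mweight \<sigma> a z)) * diff_int t \<alpha> p f0 z"
        unfolding diff_int_def by (rule nn_integral_cmult) measurable
      finally have "ennreal (defect z powr \<alpha>) * I z = ennreal g * ennreal (defect z powr \<beta> * mweight \<sigma> a z) * diff_int t \<alpha> p f0 z"
        using g by (simp add: ennreal_mult')
      then have "ennreal (g / V) * (ennreal (defect z powr \<alpha>) * I z)
        = ennreal (g / V) * (ennreal g * ennreal (defect z powr \<beta> * mweight \<sigma> a z) * diff_int t \<alpha> p f0 z)" by simp
      moreover have "ennreal (g * defect z powr \<alpha>) * ennreal (1 / V) = ennreal (g / V) * ennreal (defect z powr \<alpha>)"
        using g V by (simp add: ennreal_mult[symmetric])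
      moreover have "ennreal (g / V) * ennreal g = ennreal (g * g / V)"
        using g V by (simp add: ennreal_mult[symmetric])
      ultimately have "ennreal (g * defect z powr \<alpha>) * (ennreal (1 / V) * I z)
        = ennreal (g * g / V) * (diff_int t \<alpha> p f0 z * ennreal (defect z powr \<beta> * mweight \<sigma> a z))"
        by (metis mult.assoc mult.commute)
      then show "ennreal (g * defect z powr \<alpha>) * (ennreal (1 / V) * I z) * indicator (ball 0 1) z
        = ennreal (g * g / V) * (diff_int t \<alpha> p f0 z * ennreal (defect z powr \<beta> * mweight \<sigma> a z) * indicator (ball 0 1) z)"
        by (simp only: mult.assoc)
    qed
    also have "\<dots> = ennreal (g * g / V) * J a"
      unfolding J_def by (rule nn_integral_cmult) measurable
    also have "ennreal (1 / V) * (ennreal (g * g / V) * J a) = ennreal ((g / V) * (g / V)) * J a"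
      using g V by (simp add: mult.assoc[symmetric] ennreal_mult[symmetric])
    finally show ?thesis .
  qed
  have "f \<in> N_space p q s \<longleftrightarrow> (SUP a \<in> ball 0 1. \<integral>\<^sup>+ z. ennreal
        (norm (f z) powr p * (1 - (norm z)\<^sup>2) powr q
          * (1 - (norm (Phi a z))\<^sup>2) powr (real CARD('n) * s)) \<partial>invariant_vol) < \<infinity>"
    unfolding N_space_def using assms(1) by simp
  also have "\<dots> \<longleftrightarrow> (\<exists>M<\<infinity>. \<forall>a\<in>ball 0 1. N a \<le> M)"
    by (rule SUP_cmult_less_top_iff[OF _ Neq]) (use V in simp_all)
  also have "\<dots> \<longleftrightarrow> (\<exists>M<\<infinity>. \<forall>a\<in>ball 0 1. J a \<le> M)" by (rule main)
  also have "\<dots> \<longleftrightarrow> (SUP a \<in> ball 0 1. \<integral>\<^sup>+ z. (\<integral>\<^sup>+ w. ennreal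
        (norm (f z - f w) powr p / norm (Phi_num w z) powr (2 * (real CARD('n) + 1 + \<alpha>))
          * (1 - (norm z)\<^sup>2) powr q
          * (1 - (norm (Phi a z))\<^sup>2) powr (real CARD('n) * s))
        \<partial>weighted_vol \<alpha>) \<partial>weighted_vol \<alpha>) < \<infinity>"
    by (rule SUP_cmult_less_top_iff[OF _ Jeq, symmetric]) (use V g in simp_all)
  finally show ?thesis .
qed

end
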